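(* Let $k$ be a field and let $I$ be a rainbow monomial ideal, in the polynomial ring $R=k[x_{ij}\mid 1\leq i\leq n,\ 1\leq j\leq d_i]$, with linear resolution. Then $I$ is Golod.
   Context: Rainbow monomial ideal: Let $n\geq 1$ and $d_1,\dots,d_n\geq 1$, and let $R=k[x_{ij}\mid 1\leq i\leq n,\ 1\leq j\leq d_i]$ with the standard grading. A rainbow monomial ideal on $n$ colors is any monomial ideal of $R$ generated by monomials of the form $x_{1a_1}x_{2a_2}\cdots x_{na_n}$ for some choices of $a_1,\dots,a_n$ with $1\leq a_i\leq d_i$ (the variables $x_{i1},\dots,x_{id_i}$ form the $i$th color class). Golod: Let $J\subset R$ be a proper homogeneous ideal. Let $K^{R/J}$ be the Koszul complex on a minimal generating set of the graded maximal ideal of $R/J$, viewed as a DG-algebra (exterior algebra with the Koszul differential $d$). The ring $R/J$ (equivalently, the ideal $J$) is called Golod if $A=K^{R/J}$ admits a trivial Massey operation: for some homogeneous $k$-basis $\mathcal{B}=\{h_\lambda\}_{\lambda\in\Lambda}$ of $H_{\geq 1}(A)$ there is a function $\mu:\coprod_{i=1}^\infty\mathcal{B}^i\to A$ (with homogeneous values) such that $\mu(h_\lambda)$ is a cycle with homology class $h_\lambda$, and $$d\mu(h_{\lambda_1},\dots,h_{\lambda_p})=\sum_{j=1}^{p-1}\overline{\mu(h_{\lambda_1},\dots,h_{\lambda_j})}\,\mu(h_{\lambda_{j+1}},\dots,h_{\lambda_p}),$$ where $\overline{a}:=(-1)^{|a|+1}a$ and $|a|$ is the homological degree of $a$. 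*)

theory Defs
  imports
    "HOL-Library.Poly_Mapping"
    "HOL-Algebra.QuotRing"
    "HOL-Algebra.Embedded_Algebras"
begin

section \<open>Polynomial rings\<close>

text \<open>Polynomials are finitely supported functions from monomials to coefficients, and monomials
  are finitely supported exponent functions; multiplication is convolution.
  The set \<open>V\<close> of variables is an explicit carrier.\<close>

type_synonym 'v monom = "'v \<Rightarrow>\<^sub>0 nat"
type_synonym ('v, 'k) mpoly = "'v monom \<Rightarrow>\<^sub>0 'k"

definition poly_ring :: "'v set \<Rightarrow> ('v, 'k::field) mpoly ring" where
  "poly_ring V =
     \<lparr>carrier = {p. \<forall>m \<in> Poly_Mapping.keys p. Poly_Mapping.keys m \<subseteq> V},
      mult = (*), one = 1, zero = 0, add = (+)\<rparr>"

definition var :: "'v \<Rightarrow> ('v, 'k::field) mpoly" where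
  "var v = Poly_Mapping.single (Poly_Mapping.single v 1) 1"

definition const :: "'k \<Rightarrow> ('v, 'k::field) mpoly" where
  "const c = Poly_Mapping.single 0 c"

definition mdeg :: "'v monom \<Rightarrow> nat" where
  "mdeg m = (\<Sum>v \<in> Poly_Mapping.keys m. Poly_Mapping.lookup m v)"

definition homogeneous :: "nat \<Rightarrow> ('v, 'k::field) mpoly \<Rightarrow> bool" where
  "homogeneous e p \<longleftrightarrow> (\<forall>m \<in> Poly_Mapping.keys p. mdeg m = e)"


section \<open>Rainbow monomial ideals\<close>

definition rainbow_vars :: "nat \<Rightarrow> (nat \<Rightarrow> nat) \<Rightarrow> (nat \<times> nat) set" where
  "rainbow_vars n d = {(i, j). i \<in> {1..n} \<and> j \<in> {1..d i}}"

definition rainbow_monomials :: "nat \<Rightarrow> (nat \<Rightarrow> nat) \<Rightarrow> (nat \<times> nat, 'k::field) mpoly set" where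
  "rainbow_monomials n d =
     {(\<Prod>i = 1..n. var (i, a i)) | a. \<forall>i \<in> {1..n}. a i \<in> {1..d i}}"

definition rainbow_monomial_ideal ::
    "nat \<Rightarrow> (nat \<Rightarrow> nat) \<Rightarrow> (nat \<times> nat, 'k::field) mpoly set \<Rightarrow> bool" where
  "rainbow_monomial_ideal n d I \<longleftrightarrow>
     (\<exists>G \<subseteq> rainbow_monomials n d. I = Idl\<^bsub>poly_ring (rainbow_vars n d)\<^esub> G)"


section \<open>Minimal graded free resolutions and linear resolutions\<close>

text \<open>The free module of rank \<open>b\<close> consists of the vectors supported in \<open>{..<b}\<close>.\<close>

definition free_module :: "'v set \<Rightarrow> nat \<Rightarrow> (nat \<Rightarrow> ('v, 'k::field) mpoly) set" where
  "free_module V b =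
     {v. (\<forall>j < b. v j \<in> carrier (poly_ring V)) \<and> (\<forall>j \<ge> b. v j = 0)}"

definition mat_apply ::
    "nat \<Rightarrow> nat \<Rightarrow> (nat \<Rightarrow> nat \<Rightarrow> ('v, 'k::field) mpoly) \<Rightarrow>
     (nat \<Rightarrow> ('v, 'k) mpoly) \<Rightarrow> (nat \<Rightarrow> ('v, 'k) mpoly)" where
  "mat_apply r c M v = (\<lambda>i. if i < r then (\<Sum>j < c. M i j * v j) else 0)"

text \<open>The resolution is
  \<open>\<dots> \<rightarrow> F 2 \<rightarrow> F 1 \<rightarrow> F 0 \<rightarrow> I \<rightarrow> 0\<close>, where \<open>F s\<close> is the direct sum of the \<open>R(- a s j)\<close> for
  \<open>j < b s\<close>. The augmentation \<open>F 0 \<rightarrow> I\<close> is the row \<open>g\<close> and \<open>F (s + 1) \<rightarrow> F s\<close> is the matrix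
  \<open>\<phi> s\<close>; the conditions on the degrees of the entries say that these maps have degree 0.\<close>

definition graded_free_resolution ::
    "'v set \<Rightarrow> ('v, 'k::field) mpoly set \<Rightarrow> (nat \<Rightarrow> nat) \<Rightarrow> (nat \<Rightarrow> nat \<Rightarrow> nat) \<Rightarrow>
     (nat \<Rightarrow> ('v, 'k) mpoly) \<Rightarrow> (nat \<Rightarrow> nat \<Rightarrow> nat \<Rightarrow> ('v, 'k) mpoly) \<Rightarrow> bool" where
  "graded_free_resolution V I b a g \<phi> \<longleftrightarrow>
     (\<forall>j < b 0. g j \<in> carrier (poly_ring V) \<and> homogeneous (a 0 j) (g j)) \<and>
     (\<forall>s. \<forall>i < b s. \<forall>j < b (Suc s). \<phi> s i j \<in> carrier (poly_ring V) \<and>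
        (\<forall>m \<in> Poly_Mapping.keys (\<phi> s i j). mdeg m + a s i = a (Suc s) j)) \<and>
     (\<lambda>v. \<Sum>j < b 0. g j * v j) ` free_module V (b 0) = I \<and>
     mat_apply (b 0) (b 1) (\<phi> 0) ` free_module V (b 1) =
       {v \<in> free_module V (b 0). (\<Sum>j < b 0. g j * v j) = 0} \<and>
     (\<forall>s. mat_apply (b (Suc s)) (b (Suc (Suc s))) (\<phi> (Suc s)) ` free_module V (b (Suc (Suc s))) =
       {v \<in> free_module V (b (Suc s)). mat_apply (b s) (b (Suc s)) (\<phi> s) v = (\<lambda>_. 0)})"

definition minimal_graded_free_resolution ::
    "'v set \<Rightarrow> ('v, 'k::field) mpoly set \<Rightarrow> (nat \<Rightarrow> nat) \<Rightarrow> (nat \<Rightarrow> nat \<Rightarrow> nat) \<Rightarrow>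
     (nat \<Rightarrow> ('v, 'k) mpoly) \<Rightarrow> (nat \<Rightarrow> nat \<Rightarrow> nat \<Rightarrow> ('v, 'k) mpoly) \<Rightarrow> bool" where
  "minimal_graded_free_resolution V I b a g \<phi> \<longleftrightarrow>
     graded_free_resolution V I b a g \<phi> \<and>
     (\<forall>s. \<forall>i < b s. \<forall>j < b (Suc s). Poly_Mapping.lookup (\<phi> s i j) 0 = 0)"

text \<open>\<open>I\<close> is generated in one degree \<open>t\<close> and the \<open>s\<close>-th free module of its minimal resolution is a
  sum of copies of \<open>R(- s - t)\<close>. The zero ideal qualifies (with all ranks zero).\<close>

definition has_linear_resolution :: "'v set \<Rightarrow> ('v, 'k::field) mpoly set \<Rightarrow> bool" where
  "has_linear_resolution V I \<longleftrightarrow>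
     (\<exists>t b a g \<phi>. minimal_graded_free_resolution V I b a g \<phi> \<and> (\<forall>s. \<forall>j < b s. a s j = s + t))"


section \<open>The Koszul complex as a DG-algebra\<close>

text \<open>For a commutative ring \<open>Q\<close> and a list \<open>xs\<close> of elements of \<open>Q\<close> of length \<open>r\<close>, the Koszul complex
  is the exterior algebra on a basis \<open>e\<^sub>i\<close>, \<open>i < r\<close>. An element is given by its coefficients
  on the monomials \<open>e\<^sub>S\<close>, \<open>S \<subseteq> {..<r}\<close>, with factors in increasing order; \<open>e\<^sub>S\<close> has
  homological degree \<open>card S\<close>. The product is determined by
  \<open>e\<^sub>S e\<^sub>T = \<plusminus> e\<^bsub>S \<union> T\<^esub>\<close> for disjoint \<open>S\<close>, \<open>T\<close>, with the sign of the number of inversions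
  between \<open>S\<close> and \<open>T\<close>, and \<open>e\<^sub>S e\<^sub>T = 0\<close> otherwise.\<close>

definition sgn_mult :: "('a, 'm) ring_scheme \<Rightarrow> nat \<Rightarrow> 'a \<Rightarrow> 'a" where
  "sgn_mult Q p x = (if even p then x else \<ominus>\<^bsub>Q\<^esub> x)"

definition koszul :: "('a, 'm) ring_scheme \<Rightarrow> 'a list \<Rightarrow> (nat set \<Rightarrow> 'a) ring" where
  "koszul Q xs =
     \<lparr>carrier = {a. (\<forall>S. a S \<in> carrier Q) \<and> (\<forall>S. \<not> S \<subseteq> {..<length xs} \<longrightarrow> a S = \<zero>\<^bsub>Q\<^esub>)},
      mult = (\<lambda>a b U. \<Oplus>\<^bsub>Q\<^esub>S \<in> Pow U.
        sgn_mult Q (card {(s, t). s \<in> S \<and> t \<in> U - S \<and> t < s}) (a S \<otimes>\<^bsub>Q\<^esub> b (U - S))),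
      one = (\<lambda>S. if S = {} then \<one>\<^bsub>Q\<^esub> else \<zero>\<^bsub>Q\<^esub>),
      zero = (\<lambda>S. \<zero>\<^bsub>Q\<^esub>),
      add = (\<lambda>a b S. a S \<oplus>\<^bsub>Q\<^esub> b S)\<rparr>"

text \<open>The differential sends \<open>e\<^sub>S\<close> to the sum over \<open>i \<in> S\<close> of
  \<open>(-1)^(card {j \<in> S. j < i}) xs!i e\<^bsub>S - {i}\<^esub>\<close>; below, the coefficient of \<open>e\<^sub>T\<close> collects the
  contributions of all \<open>S = insert i T\<close>.\<close>

definition koszul_diff ::
    "('a, 'm) ring_scheme \<Rightarrow> 'a list \<Rightarrow> (nat set \<Rightarrow> 'a) \<Rightarrow> (nat set \<Rightarrow> 'a)" where
  "koszul_diff Q xs a = (\<lambda>T. \<Oplus>\<^bsub>Q\<^esub>i \<in> {..<length xs} - T.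
     sgn_mult Q (card {j \<in> T. j < i}) (xs ! i \<otimes>\<^bsub>Q\<^esub> a (insert i T)))"

definition koszul_homogeneous :: "('a, 'm) ring_scheme \<Rightarrow> nat \<Rightarrow> (nat set \<Rightarrow> 'a) \<Rightarrow> bool" where
  "koszul_homogeneous Q p a \<longleftrightarrow> (\<forall>S. a S \<noteq> \<zero>\<^bsub>Q\<^esub> \<longrightarrow> card S = p)"

text \<open>The additive extension of \<open>a \<mapsto> (-1)^(|a| + 1) a\<close> from homogeneous elements to all elements.\<close>

definition koszul_bar :: "('a, 'm) ring_scheme \<Rightarrow> (nat set \<Rightarrow> 'a) \<Rightarrow> (nat set \<Rightarrow> 'a)" where
  "koszul_bar Q a = (\<lambda>S. sgn_mult Q (card S + 1) (a S))"

definition koszul_cycles :: "('a, 'm) ring_scheme \<Rightarrow> 'a list \<Rightarrow> (nat set \<Rightarrow> 'a) set" where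
  "koszul_cycles Q xs =
     {z \<in> carrier (koszul Q xs). koszul_diff Q xs z = \<zero>\<^bsub>koszul Q xs\<^esub>}"

definition koszul_boundaries :: "('a, 'm) ring_scheme \<Rightarrow> 'a list \<Rightarrow> (nat set \<Rightarrow> 'a) set" where
  "koszul_boundaries Q xs = koszul_diff Q xs ` carrier (koszul Q xs)"

text \<open>The boundaries are an ideal of the ring of cycles, and homology is the quotient ring.\<close>

definition koszul_homology :: "('a, 'm) ring_scheme \<Rightarrow> 'a list \<Rightarrow> (nat set \<Rightarrow> 'a) set ring" where
  "koszul_homology Q xs = (koszul Q xs)\<lparr>carrier := koszul_cycles Q xs\<rparr> Quot koszul_boundaries Q xs"

definition homology_class ::
    "('a, 'm) ring_scheme \<Rightarrow> 'a list \<Rightarrow> (nat set \<Rightarrow> 'a) \<Rightarrow> (nat set \<Rightarrow> 'a) set" where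
  "homology_class Q xs z = koszul_boundaries Q xs +>\<^bsub>koszul Q xs\<^esub> z"

definition positive_homology :: "('a, 'm) ring_scheme \<Rightarrow> 'a list \<Rightarrow> (nat set \<Rightarrow> 'a) set set" where
  "positive_homology Q xs =
     homology_class Q xs ` {z \<in> koszul_cycles Q xs. z {} = \<zero>\<^bsub>Q\<^esub>}"

text \<open>Scalars from a subfield \<open>F\<close> of \<open>Q\<close> act on homology through their classes in degree 0.\<close>

definition homology_scalars ::
    "('a, 'm) ring_scheme \<Rightarrow> 'a list \<Rightarrow> 'a set \<Rightarrow> (nat set \<Rightarrow> 'a) set set" where
  "homology_scalars Q xs F =
     (\<lambda>c. homology_class Q xs (\<lambda>S. if S = {} then c else \<zero>\<^bsub>Q\<^esub>)) ` F"

definition homogeneous_basis ::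
    "('a, 'm) ring_scheme \<Rightarrow> 'a list \<Rightarrow> 'a set \<Rightarrow> (nat set \<Rightarrow> 'a) set set \<Rightarrow> bool" where
  "homogeneous_basis Q xs F B \<longleftrightarrow>
     (\<forall>h \<in> B. \<exists>p \<ge> 1. \<exists>z \<in> koszul_cycles Q xs.
        koszul_homogeneous Q p z \<and> h = homology_class Q xs z) \<and>
     (\<forall>hs. distinct hs \<and> set hs \<subseteq> B \<longrightarrow>
        ring.independent (koszul_homology Q xs) (homology_scalars Q xs F) hs) \<and>
     (\<Union>hs \<in> lists B. ring.Span (koszul_homology Q xs) (homology_scalars Q xs F) hs) =
       positive_homology Q xs"


section \<open>Trivial Massey operations and Golod rings\<close>

text \<open>The tuples in the domain of \<open>\<mu>\<close> are the nonempty lists over \<open>B\<close>.\<close>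

definition trivial_massey_operation ::
    "('a, 'm) ring_scheme \<Rightarrow> 'a list \<Rightarrow> (nat set \<Rightarrow> 'a) set set \<Rightarrow>
     ((nat set \<Rightarrow> 'a) set list \<Rightarrow> (nat set \<Rightarrow> 'a)) \<Rightarrow> bool" where
  "trivial_massey_operation Q xs B \<mu> \<longleftrightarrow>
     (\<forall>hs \<in> lists B. hs \<noteq> [] \<longrightarrow>
        \<mu> hs \<in> carrier (koszul Q xs) \<and> (\<exists>p. koszul_homogeneous Q p (\<mu> hs))) \<and>
     (\<forall>h \<in> B. \<mu> [h] \<in> koszul_cycles Q xs \<and> homology_class Q xs (\<mu> [h]) = h) \<and>
     (\<forall>hs \<in> lists B. hs \<noteq> [] \<longrightarrow>
        koszul_diff Q xs (\<mu> hs) =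
          (\<Oplus>\<^bsub>koszul Q xs\<^esub>j \<in> {1..<length hs}.
             koszul_bar Q (\<mu> (take j hs)) \<otimes>\<^bsub>koszul Q xs\<^esub> \<mu> (drop j hs)))"

definition admits_trivial_massey ::
    "('a, 'm) ring_scheme \<Rightarrow> 'a list \<Rightarrow> 'a set \<Rightarrow> bool" where
  "admits_trivial_massey Q xs F \<longleftrightarrow>
     (\<exists>B \<mu>. homogeneous_basis Q xs F B \<and> trivial_massey_operation Q xs B \<mu>)"

definition quotient_ring ::
    "'v set \<Rightarrow> ('v, 'k::field) mpoly set \<Rightarrow> ('v, 'k) mpoly set ring" where
  "quotient_ring V J = poly_ring V Quot J"

definition residue ::
    "'v set \<Rightarrow> ('v, 'k::field) mpoly set \<Rightarrow> ('v, 'k) mpoly \<Rightarrow> ('v, 'k) mpoly set" where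
  "residue V J p = J +>\<^bsub>poly_ring V\<^esub> p"

definition graded_maximal_ideal ::
    "'v set \<Rightarrow> ('v, 'k::field) mpoly set \<Rightarrow> ('v, 'k) mpoly set set" where
  "graded_maximal_ideal V J =
     residue V J ` {p \<in> carrier (poly_ring V). Poly_Mapping.lookup p 0 = 0}"

text \<open>A minimal generating set is understood to consist of homogeneous elements; it is listed
  without repetition, the order fixing the signs in the exterior algebra. When \<open>J\<close> contains linear
  forms, it has fewer elements than \<open>V\<close>.\<close>

definition minimal_generators ::
    "'v set \<Rightarrow> ('v, 'k::field) mpoly set \<Rightarrow> ('v, 'k) mpoly set list \<Rightarrow> bool" where
  "minimal_generators V J xs \<longleftrightarrow>
     distinct xs \<and>
     (\<forall>x \<in> set xs. \<exists>e. \<exists>p \<in> carrier (poly_ring V). homogeneous e p \<and> x = residue V J p) \<and>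
     Idl\<^bsub>quotient_ring V J\<^esub> (set xs) = graded_maximal_ideal V J \<and>
     (\<forall>Y. Y \<subset> set xs \<longrightarrow> Idl\<^bsub>quotient_ring V J\<^esub> Y \<noteq> graded_maximal_ideal V J)"

text \<open>Meant for finite \<open>V\<close> and a proper homogeneous ideal \<open>J\<close>. The Koszul complex does not depend on the minimal
  generating set up to isomorphism of DG-algebras; the definition asks for all of them. The
  coefficient field is embedded in the quotient as the residues of constants.\<close>

definition golod :: "'v set \<Rightarrow> ('v, 'k::field) mpoly set \<Rightarrow> bool" where
  "golod V J \<longleftrightarrow>
     (\<forall>xs. minimal_generators V J xs \<longrightarrow>
        admits_trivial_massey (quotient_ring V J) xs (residue V J ` range const))"

end

theory Submission
  imports Defs "HOL-Library.Function_Algebras"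
begin

text \<open>The proof is a degree argument. Grade the Koszul complex of \<open>R/I\<close> by the homological degree \<open>q\<close>
  and by the polynomial degree \<open>e\<close> of the coefficients; the basis elements of the exterior algebra
  correspond to linear forms, so the differential lowers \<open>q\<close> by one and raises \<open>e\<close> by one, while
  products add both degrees.

  If \<open>I\<close> is generated in degree \<open>t\<close> and has a linear resolution, then the homology in every
  homological degree \<open>q \<ge> 1\<close> sits in the single coefficient degree \<open>t - 1\<close>
  (\<open>koszul_concentrated\<close>). To see this, let \<open>a\<close> be a chain over \<open>R\<close> that is a cycle modulo \<open>I\<close>.
  Its boundary has values in \<open>I\<close> and so comes from a chain with values in the first module of the
  resolution; taking boundaries and lifting in turn trades one homological degree for one step in
  the resolution, and leaves the polynomial degree unchanged because all the matrices are linear.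
  After \<open>q\<close> steps there is an element of a free module with coefficients of degree \<open>e + 1 - t\<close>. If
  this degree is positive, the element lies in the maximal ideal times the module and is therefore a
  boundary; as the Koszul complex over \<open>R\<close> is acyclic in positive degrees, this can be carried back
  through all the steps (\<open>boundary_lift\<close>).

  Now choose representatives of a basis of the homology in coefficient degree \<open>t - 1\<close>. A Massey
  operation on a list of length \<open>l\<close> then has to take its value in coefficient degree
  \<open>l (t - 2) + 1\<close>, and the cycle that it has to bound has coefficient degree \<open>l (t - 2) + 2\<close>. For
  \<open>l \<ge> 2\<close> and \<open>t \<ge> 2\<close> this differs from \<open>t - 1\<close>, so the cycle is a boundary, and the operation can be
  constructed by recursion on \<open>l\<close> (\<open>admits_trivial_massey\<close>).

  The generators of a rainbow ideal have degree \<open>n\<close>, which gives \<open>t \<ge> 2\<close> when \<open>n \<ge> 2\<close> and \<open>I\<close> is not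
  zero. For \<open>n = 1\<close> the ideal is generated by variables, \<open>R/I\<close> is a polynomial ring, and the Koszul
  homology vanishes in positive degrees, as it does for \<open>I = 0\<close>.

  All minimal generating sets of the graded maximal ideal are covered at once: such a set consists
  of the residues of linear forms \<open>p\<^sub>i\<close> that are linearly independent modulo \<open>I\<close> and span the
  variables modulo \<open>I\<close> (\<open>minimal_generators_linear_forms\<close>). The substitution of \<open>p\<^sub>i\<close> for new variables
  \<open>y\<^sub>i\<close> compares their Koszul complex with that of the \<open>y\<^sub>i\<close>, which form a regular sequence
  (\<open>acyclic_mod\<close>).\<close>

section \<open>The exterior algebra over a commutative ring\<close>

text \<open>The sign of the permutation that sorts the increasing list of \<open>S\<close> followed by that of a
  disjoint set \<open>T\<close>.\<close>

definition shuffle_sign :: "nat set \<Rightarrow> nat set \<Rightarrow> 'a::comm_ring_1" where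
  "shuffle_sign S T = (-1) ^ card {(s, t). s \<in> S \<and> t \<in> T \<and> t < s}"

lemma shuffle_sign_empty [simp]: "shuffle_sign {} T = 1" "shuffle_sign S {} = 1"
  by (auto simp: shuffle_sign_def)

lemma finite_inversions:
  assumes "finite S"
  shows "finite {(s, t). s \<in> S \<and> t \<in> T \<and> t < (s::nat)}"
proof (rule finite_subset)
  show "{(s, t). s \<in> S \<and> t \<in> T \<and> t < s} \<subseteq> Sigma S (\<lambda>s. {..<s})" by auto
qed (use assms in auto)

lemma shuffle_sign_Un_left:
  assumes "finite S" "finite S'" "S \<inter> S' = {}"
  shows "shuffle_sign (S \<union> S') T = shuffle_sign S T * shuffle_sign S' T"
proof -
  have "{(s, t). s \<in> S \<union> S' \<and> t \<in> T \<and> t < s} =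
      {(s, t). s \<in> S \<and> t \<in> T \<and> t < s} \<union> {(s, t). s \<in> S' \<and> t \<in> T \<and> t < s}"
    by auto
  moreover have "{(s, t). s \<in> S \<and> t \<in> T \<and> t < s} \<inter> {(s, t). s \<in> S' \<and> t \<in> T \<and> t < s} = {}"
    using assms by auto
  ultimately show ?thesis
    by (simp add: shuffle_sign_def card_Un_disjoint finite_inversions assms power_add)
qed

lemma shuffle_sign_Un_right:
  assumes "finite S" "T \<inter> T' = {}"
  shows "shuffle_sign S (T \<union> T') = shuffle_sign S T * shuffle_sign S T'"
proof -
  have "{(s, t). s \<in> S \<and> t \<in> T \<union> T' \<and> t < s} =
      {(s, t). s \<in> S \<and> t \<in> T \<and> t < s} \<union> {(s, t). s \<in> S \<and> t \<in> T' \<and> t < s}"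
    by auto
  moreover have "{(s, t). s \<in> S \<and> t \<in> T \<and> t < s} \<inter> {(s, t). s \<in> S \<and> t \<in> T' \<and> t < s} = {}"
    using assms by auto
  ultimately show ?thesis
    by (simp add: shuffle_sign_def card_Un_disjoint finite_inversions assms power_add)
qed

lemma shuffle_sign_insert_left:
  assumes "finite S" "i \<notin> S"
  shows "shuffle_sign (insert i S) T = shuffle_sign {i} T * shuffle_sign S T"
  using shuffle_sign_Un_left[of "{i}" S T] assms by simp

lemma shuffle_sign_insert_right:
  assumes "finite S" "i \<notin> T"
  shows "shuffle_sign S (insert i T) = shuffle_sign S {i} * shuffle_sign S T"
  using shuffle_sign_Un_right[of S "{i}" T] assms by simp

lemma shuffle_sign_square [simp]: "shuffle_sign S T * shuffle_sign S T = 1"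
  "shuffle_sign S T * (shuffle_sign S T * a) = a"
  by (simp_all add: shuffle_sign_def flip: power_mult_distrib mult.assoc)

lemma shuffle_sign_singletons: "shuffle_sign {i} {j} = (if j < i then -1 else 1)"
proof -
  have "{(s, t). s \<in> {i} \<and> t \<in> {j} \<and> t < s} = (if j < i then {(i, j)} else {})"
    by auto
  then show ?thesis by (simp add: shuffle_sign_def del: singleton_iff)
qed

text \<open>Exactly one of \<open>(i, j)\<close>, \<open>(j, i)\<close> is an inversion for each \<open>j \<in> A\<close>.\<close>

lemma shuffle_sign_swap:
  assumes "finite A" "i \<notin> A"
  shows "shuffle_sign {i} A * shuffle_sign A {i} = (-1) ^ card A"
  using assms
proof (induction A)
  case (insert j A)
  have ij: "shuffle_sign {i} {j} * shuffle_sign {j} {i} = (-1::'a)"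
    using insert by (auto simp: shuffle_sign_singletons)
  have "shuffle_sign {i} (insert j A) * shuffle_sign (insert j A) {i} =
      (shuffle_sign {i} {j} * shuffle_sign {j} {i}) * (shuffle_sign {i} A * shuffle_sign A {i} :: 'a)"
    using insert.hyps insert.prems
    by (simp add: shuffle_sign_insert_left[of A j "{i}"] shuffle_sign_insert_right[of "{i}" j A] mult_ac)
  also have "\<dots> = - ((-1) ^ card A)"
    using insert ij by (simp only: insert.IH) simp
  finally show ?case using insert by simp
qed simp

text
  \<open>All identities between products and differentials are proved over a commutative ring given by a type class, where computing with signs and sums is easy. They pass to the quotient ring, whose elements are cosets, because every element of its Koszul complex can be lifted.\<close>

type_synonym 'a ext = "nat set \<Rightarrow> 'a"

definition emul :: "'a::comm_ring_1 ext \<Rightarrow> 'a ext \<Rightarrow> 'a ext" where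
  "emul a b = (\<lambda>U. \<Sum>S\<in>Pow U. shuffle_sign S (U - S) * (a S * b (U - S)))"

definition ebar :: "'a::comm_ring_1 ext \<Rightarrow> 'a ext" where
  "ebar a = (\<lambda>S. (-1) ^ (card S + 1) * a S)"

text \<open>Interior product with the \<open>i\<close>-th dual basis vector. The Koszul differential is the
  combination of these antiderivations with the elements of the sequence as coefficients, so its
  algebraic properties reduce to properties of a single contraction.\<close>

definition contract :: "nat \<Rightarrow> 'a::comm_ring_1 ext \<Rightarrow> 'a ext" where
  "contract i a = (\<lambda>T. if i \<in> T then 0 else shuffle_sign {i} T * a (insert i T))"

definition ediff :: "nat \<Rightarrow> (nat \<Rightarrow> 'a::comm_ring_1) \<Rightarrow> 'a ext \<Rightarrow> 'a ext" where
  "ediff r x a = (\<lambda>T. \<Sum>i<r. x i * contract i a T)"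

definition escale :: "'a::comm_ring_1 \<Rightarrow> 'a ext \<Rightarrow> 'a ext" where
  "escale c a = (\<lambda>S. c * a S)"

definition eone :: "'a::comm_ring_1 ext" where
  "eone = (\<lambda>S. if S = {} then 1 else 0)"

lemma sum_fun_apply: "(\<Sum>i\<in>A. f i) x = (\<Sum>i\<in>A. f i x)"
  by (induction A rule: infinite_finite_induct) auto

lemma minus_fun_apply' [simp]: "(f - g) x = f x - g x" "(- f) x = - f x"
  by (simp_all add: fun_diff_def fun_Compl_def)

lemma emul_infinite: "infinite U \<Longrightarrow> emul a b U = 0"
  by (simp add: emul_def)

text \<open>Both sides are sums over the decompositions of \<open>U\<close> into three disjoint sets \<open>A\<close>, \<open>B\<close>, \<open>C\<close>,
  and the sign of each term is the product of the signs of the three pairs.\<close>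

lemma emul_assoc: "emul (emul a b) c = emul a (emul b c)"
proof
  fix U :: "nat set"
  show "emul (emul a b) c U = emul a (emul b c) U"
  proof (cases "finite U")
    case True
    have "emul (emul a b) c U = (\<Sum>S\<in>Pow U. \<Sum>A\<in>Pow S.
        shuffle_sign S (U - S) * shuffle_sign A (S - A) * (a A * b (S - A) * c (U - S)))"
      by (simp add: emul_def sum_distrib_left sum_distrib_right mult_ac)
    also have "\<dots> = (\<Sum>(S, A)\<in>Sigma (Pow U) Pow.
        shuffle_sign S (U - S) * shuffle_sign A (S - A) * (a A * b (S - A) * c (U - S)))"
      by (rule sum.Sigma) (use True finite_subset in auto)
    also have "\<dots> = (\<Sum>(A, B)\<in>Sigma (Pow U) (\<lambda>A. Pow (U - A)).
        shuffle_sign A (U - A) * shuffle_sign B (U - A - B) * (a A * b B * c (U - A - B)))"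
    proof (rule sum.reindex_bij_witness[where i = "\<lambda>(A, B). (A \<union> B, A)" and j = "\<lambda>(S, A). (A, S - A)"],
        goal_cases)
      case (5 p)
      obtain S A where p: "p = (S, A)" by fastforce
      with 5 have sub: "S \<subseteq> U" "A \<subseteq> S" by auto
      then have fin: "finite S" "finite A" "finite (U - S)" "finite (S - A)"
        using True finite_subset by (auto simp: finite_subset)
      have eqs: "U - A - (S - A) = U - S" "S = A \<union> (S - A)" "U - A = (S - A) \<union> (U - S)"
        using sub by auto
      have "shuffle_sign S (U - S) = (shuffle_sign A (U - S) * shuffle_sign (S - A) (U - S) :: 'a)"
        by (subst eqs(2), rule shuffle_sign_Un_left) (use fin in auto)
      moreover have "shuffle_sign A (U - A) = (shuffle_sign A (S - A) * shuffle_sign A (U - S) :: 'a)"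
        by (subst eqs(3), rule shuffle_sign_Un_right) (use fin in auto)
      ultimately show ?case
        by (simp add: p eqs(1) mult_ac)
    qed auto
    also have "\<dots> = (\<Sum>A\<in>Pow U. \<Sum>B\<in>Pow (U - A).
        shuffle_sign A (U - A) * shuffle_sign B (U - A - B) * (a A * b B * c (U - A - B)))"
      by (rule sum.Sigma[symmetric]) (use True finite_subset in auto)
    also have "\<dots> = emul a (emul b c) U"
      by (simp add: emul_def sum_distrib_left sum_distrib_right mult_ac)
    finally show ?thesis .
  qed (simp add: emul_infinite)
qed

lemma emul_add_left: "emul (a + b) c = emul a c + emul b c"
  by (auto simp: emul_def fun_eq_iff algebra_simps sum.distrib)

lemma emul_add_right: "emul a (b + c) = emul a b + emul a c"
  by (auto simp: emul_def fun_eq_iff algebra_simps sum.distrib)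

lemma emul_minus_left: "emul (- a) c = - emul a c"
  by (auto simp: emul_def fun_eq_iff sum_negf)

lemma emul_minus_right: "emul a (- c) = - emul a c"
  by (auto simp: emul_def fun_eq_iff sum_negf)

lemma emul_diff_left: "emul (a - b) c = emul a c - emul b c"
  by (metis emul_add_left emul_minus_left diff_conv_add_uminus)

lemma emul_diff_right: "emul a (b - c) = emul a b - emul a c"
  by (metis emul_add_right emul_minus_right diff_conv_add_uminus)

lemma emul_sum_left: "emul (\<Sum>i\<in>A. f i) c = (\<Sum>i\<in>A. emul (f i) c)"
proof
  fix U
  have "emul (\<Sum>i\<in>A. f i) c U = (\<Sum>S\<in>Pow U. \<Sum>i\<in>A. shuffle_sign S (U - S) * (f i S * c (U - S)))"
    by (simp add: emul_def sum_fun_apply sum_distrib_left sum_distrib_right)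
  also have "\<dots> = (\<Sum>i\<in>A. emul (f i) c) U"
    by (subst sum.swap) (simp add: emul_def sum_fun_apply)
  finally show "emul (\<Sum>i\<in>A. f i) c U = (\<Sum>i\<in>A. emul (f i) c) U" .
qed

lemma emul_sum_right: "emul c (\<Sum>i\<in>A. f i) = (\<Sum>i\<in>A. emul c (f i))"
proof
  fix U
  have "emul c (\<Sum>i\<in>A. f i) U = (\<Sum>S\<in>Pow U. \<Sum>i\<in>A. shuffle_sign S (U - S) * (c S * f i (U - S)))"
    by (simp add: emul_def sum_fun_apply sum_distrib_left sum_distrib_right)
  also have "\<dots> = (\<Sum>i\<in>A. emul c (f i)) U"
    by (subst sum.swap) (simp add: emul_def sum_fun_apply)
  finally show "emul c (\<Sum>i\<in>A. f i) U = (\<Sum>i\<in>A. emul c (f i)) U" .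
qed

lemma emul_scale_left: "emul (escale c a) b = escale c (emul a b)"
  by (auto simp: emul_def escale_def fun_eq_iff sum_distrib_left mult_ac)

lemma emul_scale_right: "emul a (escale c b) = escale c (emul a b)"
  by (auto simp: emul_def escale_def fun_eq_iff sum_distrib_left mult_ac)

lemma emul_degree_0_left:
  assumes "finite U"
  shows "emul (\<lambda>S. if S = {} then c else 0) a U = c * a U"
proof -
  have "emul (\<lambda>S. if S = {} then c else 0) a U = (\<Sum>S\<in>Pow U. if S = {} then c * a U else 0)"
    unfolding emul_def by (rule sum.cong) auto
  then show ?thesis using assms by simp
qed

lemma emul_degree_0_right:
  assumes "finite U"
  shows "emul a (\<lambda>S. if S = {} then c else 0) U = c * a U"
proof -
  have "emul a (\<lambda>S. if S = {} then c else 0) U = (\<Sum>S\<in>Pow U. if S = U then c * a U else 0)"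
    unfolding emul_def by (rule sum.cong) (auto simp: mult_ac)
  then show ?thesis using assms by simp
qed

lemma ebar_sum: "ebar (\<Sum>i\<in>A. f i) = (\<Sum>i\<in>A. ebar (f i))"
  by (auto simp: ebar_def fun_eq_iff sum_fun_apply sum_distrib_left)

lemma ebar_ebar [simp]: "ebar (ebar a) = a"
  by (simp add: ebar_def fun_eq_iff flip: mult.assoc power_mult_distrib)

lemma ebar_emul: "ebar (emul a b) = - emul (ebar a) (ebar b)"
proof
  fix U
  show "ebar (emul a b) U = (- emul (ebar a) (ebar b)) U"
  proof (cases "finite U")
    case True
    then have "card U = card S + card (U - S)" if "S \<subseteq> U" for S
      using card_mono[OF True that] that by (simp add: card_Diff_subset finite_subset)
    then show ?thesis
      by (auto simp: ebar_def emul_def sum_distrib_left power_add mult_ac simp flip: sum_negf intro!: sum.cong)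
  qed (simp add: emul_infinite ebar_def)
qed

lemma sum_Pow_insert:
  assumes "finite T" "i \<notin> T"
  shows "(\<Sum>S\<in>Pow (insert i T). f S) = (\<Sum>S\<in>Pow T. f S + f (insert i S))"
proof -
  have "Pow T \<inter> insert i ` Pow T = {}" using assms by auto
  moreover have "inj_on (insert i) (Pow T)"
    using assms by (auto simp: inj_on_def)
  ultimately show ?thesis
    using assms by (simp add: Pow_insert sum.union_disjoint sum.reindex sum.distrib)
qed

text \<open>If \<open>i\<close> is outside \<open>T\<close>, every decomposition of \<open>insert i T\<close> puts \<open>i\<close> into one of the two
  factors, and this gives the two products on the right. If \<open>i\<close> is in \<open>T\<close>, the left-hand side is
  zero, and the terms on the right cancel in pairs that differ in the factor from which \<open>i\<close> is
  missing.\<close>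

lemma contract_emul: "contract i (emul a b) = emul (contract i a) b - emul (ebar a) (contract i b)"
proof
  fix T
  consider "infinite T" | "finite T" "i \<notin> T" | "finite T" "i \<in> T" by blast
  then show "contract i (emul a b) T = (emul (contract i a) b - emul (ebar a) (contract i b)) T"
  proof cases
    case 1
    then show ?thesis by (simp add: contract_def emul_infinite)
  next
    case 2
    have "contract i (emul a b) T = (\<Sum>S\<in>Pow T.
        shuffle_sign {i} T * (shuffle_sign S (insert i T - S) * (a S * b (insert i T - S)) +
        shuffle_sign (insert i S) (insert i T - insert i S) * (a (insert i S) * b (insert i T - insert i S))))"
      using 2 by (simp add: contract_def emul_def sum_Pow_insert sum_distrib_left)
    also have "\<dots> = (\<Sum>S\<in>Pow T. shuffle_sign S (T - S) * (contract i a S * b (T - S)) -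
        shuffle_sign S (T - S) * (ebar a S * contract i b (T - S)))"
    proof (rule sum.cong[OF refl])
      fix S assume S: "S \<in> Pow T"
      then have fin: "finite S" "finite (T - S)" "i \<notin> S" "i \<notin> T - S"
        using 2 finite_subset by auto
      have e1: "insert i T - S = insert i (T - S)" "insert i T - insert i S = T - S" "T = S \<union> (T - S)"
        using S 2 by auto
      have e2: "shuffle_sign {i} T = (shuffle_sign {i} S * shuffle_sign {i} (T - S) :: 'a)"
        by (subst e1(3), rule shuffle_sign_Un_right) (use fin in auto)
      have e3: "(-1) ^ card S = (shuffle_sign {i} S * shuffle_sign S {i} :: 'a)"
        using shuffle_sign_swap[of S i, where 'a = 'a] fin by simp
      show "shuffle_sign {i} T * (shuffle_sign S (insert i T - S) * (a S * b (insert i T - S)) +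
        shuffle_sign (insert i S) (insert i T - insert i S) * (a (insert i S) * b (insert i T - insert i S)))
        = shuffle_sign S (T - S) * (contract i a S * b (T - S)) -
        shuffle_sign S (T - S) * (ebar a S * contract i b (T - S))"
        unfolding e1(1,2) e2 contract_def ebar_def
        using fin by (simp add: shuffle_sign_insert_left[of S i "T - S"] shuffle_sign_insert_right[of S i "T - S"] e3 algebra_simps)
    qed
    finally show ?thesis by (simp add: emul_def sum_subtractf)
  next
    case 3
    define T0 where "T0 = T - {i}"
    have T0: "T = insert i T0" "i \<notin> T0" "finite T0" using 3 by (auto simp: T0_def)
    have "(emul (contract i a) b - emul (ebar a) (contract i b)) T = (\<Sum>S\<in>Pow T0.
        shuffle_sign S (T - S) * (contract i a S * b (T - S)) +
        shuffle_sign (insert i S) (T - insert i S) * (contract i a (insert i S) * b (T - insert i S)) -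
        (shuffle_sign S (T - S) * (ebar a S * contract i b (T - S)) +
        shuffle_sign (insert i S) (T - insert i S) * (ebar a (insert i S) * contract i b (T - insert i S))))"
      unfolding emul_def minus_fun_apply' T0(1) using T0(2,3)
      by (simp only: sum_Pow_insert[OF T0(3,2)] sum_subtractf)
    also have "\<dots> = 0"
    proof (rule sum.neutral, rule ballI)
      fix S assume S: "S \<in> Pow T0"
      then have fin: "finite S" "finite (T0 - S)" "i \<notin> S" "i \<notin> T0 - S"
        using T0 finite_subset by auto
      have e1: "insert i T0 - S = insert i (T0 - S)" "insert i T0 - insert i S = T0 - S"
        using S T0 by auto
      have e3: "(-1) ^ card S = (shuffle_sign {i} S * shuffle_sign S {i} :: 'a)"
        using shuffle_sign_swap[of S i, where 'a = 'a] fin by simp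
      show "shuffle_sign S (T - S) * (contract i a S * b (T - S)) +
        shuffle_sign (insert i S) (T - insert i S) * (contract i a (insert i S) * b (T - insert i S)) -
        (shuffle_sign S (T - S) * (ebar a S * contract i b (T - S)) +
        shuffle_sign (insert i S) (T - insert i S) * (ebar a (insert i S) * contract i b (T - insert i S))) = 0"
        unfolding T0(1) e1 contract_def ebar_def
        using fin by (simp add: shuffle_sign_insert_left[of S i "T0 - S"] shuffle_sign_insert_right[of S i "T0 - S"] e3 algebra_simps)
    qed
    finally show ?thesis using 3 by (simp add: contract_def)
  qed
qed

lemma contract_contract_same: "contract i (contract i a) = 0"
  by (auto simp: contract_def fun_eq_iff)

lemma contract_add: "contract i (a + b) = contract i a + contract i b"
  by (auto simp: contract_def fun_eq_iff algebra_simps)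

lemma contract_swap:
  assumes "i \<noteq> j"
  shows "contract i (contract j a) = - contract j (contract i a)"
proof -
  have swap: "shuffle_sign {i} {j} = (- shuffle_sign {j} {i} :: 'a)"
    using assms by (auto simp: shuffle_sign_singletons)
  show ?thesis
  proof
    fix T
    show "contract i (contract j a) T = (- contract j (contract i a)) T"
    proof (cases "i \<in> T \<or> j \<in> T")
      case False
      have "contract i (contract j a) T =
          shuffle_sign {j} {i} * (shuffle_sign {i} T * (shuffle_sign {j} T * a (insert j (insert i T))))"
        using False assms shuffle_sign_insert_right[of "{j}" i T, where 'a = 'a]
        by (simp add: contract_def mult.left_commute)
      moreover have "contract j (contract i a) T =
          shuffle_sign {i} {j} * (shuffle_sign {i} T * (shuffle_sign {j} T * a (insert i (insert j T))))"
        using False assms shuffle_sign_insert_right[of "{i}" j T, where 'a = 'a]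
        by (simp add: contract_def mult.left_commute)
      ultimately show ?thesis
        unfolding swap insert_commute[of i j T] by simp
    qed (auto simp: contract_def)
  qed
qed

lemma ediff_eq_sum: "ediff r x a = (\<Sum>i<r. escale (x i) (contract i a))"
  by (auto simp: ediff_def escale_def sum_fun_apply fun_eq_iff)

lemma ediff_add: "ediff r x (a + b) = ediff r x a + ediff r x b"
  by (auto simp: ediff_def contract_add fun_eq_iff algebra_simps sum.distrib)

lemma ediff_scale: "ediff r x (escale c a) = escale c (ediff r x a)"
  by (auto simp: ediff_def contract_def escale_def fun_eq_iff sum_distrib_left mult.left_commute
      intro!: sum.cong)

lemma ediff_minus: "ediff r x (- a) = - ediff r x a"
  by (auto simp: ediff_def contract_def fun_eq_iff sum_negf[symmetric] intro!: sum.cong)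

lemma ediff_zero [simp]: "ediff r x 0 = 0"
  using ediff_scale[of r x 0 0] by (simp add: escale_def zero_fun_def)

lemma ediff_diff: "ediff r x (a - b) = ediff r x a - ediff r x b"
  using ediff_add[of r x a "- b"] by (simp add: ediff_minus)

lemma ediff_sum: "ediff r x (\<Sum>i\<in>A. f i) = (\<Sum>i\<in>A. ediff r x (f i))"
proof
  fix T
  have contr: "contract j (\<Sum>i\<in>A. f i) T = (\<Sum>i\<in>A. contract j (f i) T)" for j
    by (simp add: contract_def sum_fun_apply sum_distrib_left)
  have "ediff r x (\<Sum>i\<in>A. f i) T = (\<Sum>j<r. \<Sum>i\<in>A. x j * contract j (f i) T)"
    by (simp add: ediff_def contr sum_distrib_left)
  also have "\<dots> = (\<Sum>i\<in>A. ediff r x (f i)) T"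
    by (subst sum.swap) (simp add: ediff_def sum_fun_apply)
  finally show "ediff r x (\<Sum>i\<in>A. f i) T = (\<Sum>i\<in>A. ediff r x (f i)) T" .
qed

lemma ediff_emul: "ediff r x (emul a b) = emul (ediff r x a) b - emul (ebar a) (ediff r x b)"
  by (simp add: ediff_eq_sum emul_sum_left emul_sum_right emul_scale_left emul_scale_right
      contract_emul flip: sum_subtractf)
    (auto simp: escale_def fun_eq_iff algebra_simps sum_fun_apply sum_subtractf)

text \<open>The diagonal needs its own hypothesis, because \<open>f i i = - f i i\<close> is no condition in
  characteristic two.\<close>

lemma sum_antisymmetric:
  fixes f :: "nat \<Rightarrow> nat \<Rightarrow> 'a::ab_group_add"
  assumes "\<And>i. f i i = 0" "\<And>i j. i \<noteq> j \<Longrightarrow> f i j = - f j i"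
  shows "(\<Sum>i<r. \<Sum>j<r. f i j) = 0"
proof (induction r)
  case (Suc r)
  have "(\<Sum>i<Suc r. \<Sum>j<Suc r. f i j) = (\<Sum>i<r. \<Sum>j<r. f i j) + (\<Sum>i<r. f i r + f r i)"
    by (simp add: sum.distrib assms(1))
  also have "(\<Sum>i<r. f i r + f r i) = 0"
  proof (rule sum.neutral, rule ballI)
    fix i assume "i \<in> {..<r}"
    then show "f i r + f r i = 0" using assms(2)[of i r] by simp
  qed
  finally show ?case using Suc by simp
qed simp

lemma ediff_ediff: "ediff r x (ediff r x a) = 0"
proof
  fix T
  have "ediff r x (ediff r x a) T = (\<Sum>i<r. \<Sum>j<r. x i * (x j * contract i (contract j a) T))"
    by (auto simp: ediff_def contract_def sum_distrib_left mult_ac intro!: sum.cong)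
  also have "\<dots> = 0"
  proof (rule sum_antisymmetric)
    show "x i * (x j * contract i (contract j a) T) = - (x j * (x i * contract j (contract i a) T))"
      if "i \<noteq> j" for i j
      using contract_swap[OF that, of a] by (simp add: mult.left_commute)
  qed (simp add: contract_contract_same)
  finally show "ediff r x (ediff r x a) T = 0 T" by simp
qed

text \<open>The sign \<open>-1\<close> is the change of the cardinality in \<open>insert i T\<close>; it needs a finite \<open>T\<close>.\<close>

lemma ediff_ebar: "ediff r x (ebar a) T = - ebar (ediff r x a) T" if "finite T"
proof -
  have "contract i (ebar a) T = - ((-1) ^ (card T + 1) * contract i a T)" for i
    using that by (simp add: ebar_def contract_def)
  then show ?thesis
    by (simp add: ediff_def ebar_def sum_distrib_left mult.left_commute sum_negf)
qed

section \<open>The Koszul complex of a regular sequence\<close>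

definition esupp :: "nat \<Rightarrow> 'a::zero ext \<Rightarrow> bool" where
  "esupp r a \<longleftrightarrow> (\<forall>S. \<not> S \<subseteq> {..<r} \<longrightarrow> a S = 0)"

lemma esuppD: "esupp r a \<Longrightarrow> \<not> S \<subseteq> {..<r} \<Longrightarrow> a S = 0"
  by (auto simp: esupp_def)

lemma esupp_outside: "esupp r a \<Longrightarrow> x \<in> S \<Longrightarrow> \<not> x < r \<Longrightarrow> a S = 0"
  by (auto simp: esupp_def)

lemma esupp_add: "esupp r a \<Longrightarrow> esupp r b \<Longrightarrow> esupp r (a + b)" for a :: "'a::comm_ring_1 ext"
  by (auto simp: esupp_def)

lemma esupp_diff: "esupp r a \<Longrightarrow> esupp r b \<Longrightarrow> esupp r (a - b)" for a :: "'a::comm_ring_1 ext"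
  by (auto simp: esupp_def)

lemma esupp_scale: "esupp r a \<Longrightarrow> esupp r (escale c a)"
  by (auto simp: esupp_def escale_def)

lemma esupp_ebar: "esupp r a \<Longrightarrow> esupp r (ebar a)"
  by (auto simp: esupp_def ebar_def)

lemma esupp_ediff:
  assumes "esupp r a"
  shows "esupp r (ediff r x a)"
  unfolding esupp_def ediff_def contract_def
proof (intro allI impI sum.neutral ballI)
  fix S i assume "\<not> S \<subseteq> {..<r}" "i \<in> {..<r}"
  then have "a (insert i S) = 0" by (intro esuppD[OF assms]) auto
  then show "x i * (if i \<in> S then 0 else shuffle_sign {i} S * a (insert i S)) = 0" by simp
qed

lemma esupp_zero: "esupp r 0"
  by (simp add: esupp_def)

lemma esupp_sum: "(\<And>i. i \<in> A \<Longrightarrow> esupp r (f i)) \<Longrightarrow> esupp r (\<Sum>i\<in>A. f i)"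
  for f :: "'b \<Rightarrow> 'a::comm_ring_1 ext"
  by (auto simp: esupp_def sum_fun_apply)

lemma esupp_emul:
  assumes a: "esupp r a" and b: "esupp r b"
  shows "esupp r (emul a b)"
  unfolding esupp_def emul_def
proof (intro allI impI sum.neutral ballI)
  fix U S assume "\<not> U \<subseteq> {..<r}" "S \<in> Pow U"
  then have "\<not> S \<subseteq> {..<r} \<or> \<not> U - S \<subseteq> {..<r}" by auto
  then show "shuffle_sign S (U - S) * (a S * b (U - S)) = 0"
    using esuppD[OF a, of S] esuppD[OF b, of "U - S"] by (elim disjE) simp_all
qed

definition lin_combs :: "(nat \<Rightarrow> 'a::comm_ring_1) \<Rightarrow> nat \<Rightarrow> 'a set" where
  "lin_combs x k = {\<Sum>j<k. x j * h j | h. True}"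

text \<open>Weak regularity: the members may generate the unit ideal.\<close>

definition regular_seq :: "(nat \<Rightarrow> 'a::comm_ring_1) \<Rightarrow> nat \<Rightarrow> bool" where
  "regular_seq x r \<longleftrightarrow> (\<forall>i<r. \<forall>f. x i * f \<in> lin_combs x i \<longrightarrow> f \<in> lin_combs x i)"

text \<open>The element \<open>a + b e\<^sub>r\<close>: the exterior algebra on \<open>r + 1\<close> generators is two copies of the one
  on \<open>r\<close> generators.\<close>

definition ejoin :: "nat \<Rightarrow> 'a ext \<Rightarrow> 'a ext \<Rightarrow> 'a ext" where
  "ejoin r a b = (\<lambda>S. if r \<in> S then b (S - {r}) else a S)"

lemma ejoin_split:
  assumes "esupp (Suc r) (a :: 'a::comm_ring_1 ext)"
  obtains a0 a1 where "esupp r a0" "esupp r a1" "a = ejoin r a0 a1"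
proof
  show "esupp r (\<lambda>S. if r \<in> S then 0 else a S)"
    using assms by (auto simp: esupp_def lessThan_Suc)
  show "esupp r (\<lambda>S. if r \<in> S then 0 else a (insert r S))"
    unfolding esupp_def
  proof (intro allI impI)
    fix S assume "\<not> S \<subseteq> {..<r}"
    then have "r \<in> S \<or> \<not> insert r S \<subseteq> {..<Suc r}" by (auto simp: lessThan_Suc)
    then show "(if r \<in> S then 0 else a (insert r S)) = 0"
      using esuppD[OF assms, of "insert r S"] by presburger
  qed
  show "a = ejoin r (\<lambda>S. if r \<in> S then 0 else a S) (\<lambda>S. if r \<in> S then 0 else a (insert r S))"
    by (auto simp: ejoin_def fun_eq_iff insert_absorb)
qed

lemma ejoin_eqD:
  assumes "ejoin r a b = ejoin r a' b'" "esupp r a" "esupp r b" "esupp r a'" "esupp r b'"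
  shows "a = a'" "b = b'"
proof -
  show "a = a'"
  proof
    fix S
    show "a S = a' S"
      using fun_cong[OF assms(1), of S] esupp_outside[OF assms(2), of r S]
        esupp_outside[OF assms(4), of r S]
      by (cases "r \<in> S") (auto simp: ejoin_def)
  qed
  show "b = b'"
  proof
    fix S
    show "b S = b' S"
      using fun_cong[OF assms(1), of "insert r S"] esupp_outside[OF assms(3), of r S]
        esupp_outside[OF assms(5), of r S]
      by (cases "r \<in> S") (auto simp: ejoin_def)
  qed
qed

lemma esupp_ejoin:
  assumes "esupp r a" "esupp r b"
  shows "esupp (Suc r) (ejoin r a b)"
  unfolding esupp_def
proof (intro allI impI)
  fix S :: "nat set" assume "\<not> S \<subseteq> {..<Suc r}"
  then have "\<not> S - {r} \<subseteq> {..<r}" "\<not> S \<subseteq> {..<r}" by (auto simp: lessThan_Suc)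
  then show "ejoin r a b S = 0"
    using esuppD[OF assms(1)] esuppD[OF assms(2)] by (simp add: ejoin_def)
qed

text \<open>The Koszul complex of \<open>r + 1\<close> elements is the mapping cone of multiplication by the last
  element on the Koszul complex of the first \<open>r\<close>.\<close>

lemma ediff_ejoin:
  assumes "esupp r a" "esupp r b"
  shows "ediff (Suc r) x (ejoin r a b) = ejoin r (ediff r x a - escale (x r) (ebar b)) (ediff r x b)"
proof
  fix T
  consider (out) "\<not> T \<subseteq> {..<Suc r}" | (in0) "T \<subseteq> {..<r}" | (in1) T0 where "T = insert r T0" "T0 \<subseteq> {..<r}"
  proof (cases "T \<subseteq> {..<Suc r}")
    case True
    show thesis
    proof (cases "r \<in> T")
      case True
      then show thesis using \<open>T \<subseteq> {..<Suc r}\<close> in1[of "T - {r}"] by (force simp: lessThan_Suc)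
    qed (use True in0 in \<open>force simp: lessThan_Suc\<close>)
  qed
  then show "ediff (Suc r) x (ejoin r a b) T =
      ejoin r (ediff r x a - escale (x r) (ebar b)) (ediff r x b) T"
  proof cases
    case out
    have "esupp (Suc r) (ejoin r a b)" by (rule esupp_ejoin) (fact assms)+
    then have "ediff (Suc r) x (ejoin r a b) T = 0"
      using out by (meson esuppD esupp_ediff)
    moreover have "\<not> T - {r} \<subseteq> {..<r}" "\<not> T \<subseteq> {..<r}" using out by (auto simp: lessThan_Suc)
    then have "(ediff r x a - escale (x r) (ebar b)) T = 0" "ediff r x b (T - {r}) = 0"
      using assms by (meson esuppD esupp_ediff esupp_diff esupp_scale esupp_ebar)+
    ultimately show ?thesis by (simp add: ejoin_def)
  next
    case in0
    have fin: "finite T" using in0 finite_subset by blast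
    have "{(s, t). s \<in> {r} \<and> t \<in> T \<and> t < s} = {r} \<times> T" using in0 by auto
    then have "shuffle_sign {r} T = ((-1) ^ card T :: 'a)"
      unfolding shuffle_sign_def by (simp add: card_cartesian_product)
    then have "x r * contract r (ejoin r a b) T = - (escale (x r) (ebar b)) T"
      using in0 by (auto simp: contract_def ejoin_def escale_def ebar_def Diff_insert_absorb)
    moreover have "contract i (ejoin r a b) T = contract i a T" if "i < r" for i
      using in0 that by (auto simp: contract_def ejoin_def)
    ultimately show ?thesis
      using in0 by (auto simp: ediff_def ejoin_def)
  next
    case in1
    have fin: "finite T0" using in1 finite_subset by blast
    have "r \<notin> T0" using in1 by auto
    have "contract i (ejoin r a b) T = contract i b T0" if "i < r" for i
    proof -
      have "shuffle_sign {i} (insert r T0) = (shuffle_sign {i} T0 :: 'a)"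
        using shuffle_sign_insert_right[of "{i}" r T0, where 'a = 'a] that \<open>r \<notin> T0\<close>
        by (simp add: shuffle_sign_singletons)
      moreover have "insert i (insert r T0) - {r} = insert i T0"
        using that \<open>r \<notin> T0\<close> by auto
      ultimately show ?thesis
        using that in1(1) by (auto simp: contract_def ejoin_def)
    qed
    moreover have "contract r (ejoin r a b) T = 0" using in1 by (simp add: contract_def)
    ultimately show ?thesis
      using in1(1) \<open>r \<notin> T0\<close> by (simp add: ediff_def ejoin_def)
  qed
qed

lemma ediff_cong: "(\<And>S. S \<noteq> {} \<Longrightarrow> a S = b S) \<Longrightarrow> ediff r x a = ediff r x b"
  by (simp add: ediff_def contract_def fun_eq_iff cong: if_cong)

lemma ediff_empty: "ediff r x a {} = (\<Sum>i<r. x i * a {i})"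
  by (simp add: ediff_def contract_def)

lemma lin_combs_ediff:
  assumes "f \<in> lin_combs x r"
  obtains c where "esupp r c" "ediff r x c {} = f"
proof -
  obtain h where h: "f = (\<Sum>j<r. x j * h j)" using assms by (auto simp: lin_combs_def)
  let ?c = "\<lambda>S. \<Sum>j<r. if S = {j} then h j else 0"
  have "esupp r ?c" by (auto simp: esupp_def intro!: sum.neutral)
  moreover have "?c {i} = h i" if "i < r" for i
    using that by (simp add: eq_commute[of i])
  then have "ediff r x ?c {} = f" unfolding h ediff_empty by simp
  ultimately show thesis using that by blast
qed

text \<open>Induction on the length of the sequence by means of the mapping cone. In a cycle \<open>(a0, a1)\<close>
  the component \<open>a1\<close> is a cycle, and \<open>x\<^sub>r a1\<close> is a boundary up to sign. Regularity makes the part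
  of \<open>a1\<close> in homological degree 0 a boundary, the induction hypothesis treats the rest of \<open>a1\<close>,
  and after a correction by \<open>x\<^sub>r\<close> times a primitive of \<open>a1\<close> it applies to \<open>a0\<close>.\<close>

theorem koszul_acyclic:
  fixes x :: "nat \<Rightarrow> 'a::comm_ring_1"
  assumes "regular_seq x r" "esupp r a" "a {} = 0" "ediff r x a = 0"
  shows "\<exists>b. esupp r b \<and> a = ediff r x b"
  using assms
proof (induction r arbitrary: a)
  case 0
  then have "a S = 0" for S by (cases "S = {}") (auto simp: esupp_def)
  then have "a = 0" by auto
  then show ?case using esupp_zero ediff_zero by metis
next
  case (Suc r)
  have reg: "regular_seq x r" "\<And>f. x r * f \<in> lin_combs x r \<Longrightarrow> f \<in> lin_combs x r"
    using Suc.prems(1) by (auto simp: regular_seq_def)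
  obtain a0 a1 where a: "esupp r a0" "esupp r a1" "a = ejoin r a0 a1"
    using ejoin_split Suc.prems(2) by blast
  have "ejoin r (ediff r x a0 - escale (x r) (ebar a1)) (ediff r x a1) = ejoin r 0 0"
    using Suc.prems(4) unfolding a(3) ediff_ejoin[OF a(1,2)]
    by (auto simp: ejoin_def fun_eq_iff)
  then have eqs: "ediff r x a0 - escale (x r) (ebar a1) = 0" "ediff r x a1 = 0"
    using ejoin_eqD a(1,2)
    by (metis esupp_ediff esupp_diff esupp_scale esupp_ebar esupp_zero)+
  have "x r * (- a1 {}) = (\<Sum>i<r. x i * a0 {i})"
    using fun_cong[OF eqs(1), of "{}"]
    by (simp add: escale_def ebar_def ediff_empty neg_eq_iff_add_eq_0 add.commute)
  then have "x r * (- a1 {}) \<in> lin_combs x r"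
    unfolding lin_combs_def by (intro CollectI exI[of _ "\<lambda>i. a0 {i}"]) simp
  then have "- a1 {} \<in> lin_combs x r" by (rule reg(2))
  then obtain c where c: "esupp r c" "ediff r x c {} = - a1 {}"
    by (rule lin_combs_ediff)
  have "\<exists>b. esupp r b \<and> a1 + ediff r x c = ediff r x b"
  proof (rule Suc.IH)
    show "esupp r (a1 + ediff r x c)" by (intro esupp_add esupp_ediff a c)
    show "ediff r x (a1 + ediff r x c) = 0" by (simp only: ediff_add ediff_ediff eqs(2) add_0_left)
  qed (use reg c in simp_all)
  then obtain b1 where b1: "esupp r b1" "a1 + ediff r x c = ediff r x b1" by blast
  \<comment> \<open>The coefficient at the empty set has no influence on the boundary; as 0 it lets \<open>a0'\<close> below
    vanish there.\<close>
  define d where "d = (\<lambda>S. if S = {} then 0 else (b1 - c) S)"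
  have "ediff r x d = ediff r x (b1 - c)"
    by (rule ediff_cong) (simp add: d_def)
  then have d: "ediff r x d = a1" unfolding ediff_diff b1(2)[symmetric] by simp
  have d_supp: "esupp r d" using b1(1) c(1) by (auto simp: d_def esupp_def)
  define a0' where "a0' = a0 + escale (x r) (ebar d)"
  have a0'_supp: "esupp r a0'"
    unfolding a0'_def by (intro esupp_add esupp_scale esupp_ebar a d_supp)
  have "ediff r x (ebar d) = - ebar a1"
  proof
    fix T
    show "ediff r x (ebar d) T = (- ebar a1) T"
    proof (cases "finite T")
      case True
      then show ?thesis by (simp add: ediff_ebar d)
    next
      case False
      then have "\<not> T \<subseteq> {..<r}" using finite_subset by blast
      then show ?thesis
        using esuppD[OF esupp_ediff[OF esupp_ebar[OF d_supp]], of T x]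
          esuppD[OF esupp_ebar[OF a(2)], of T] by simp
    qed
  qed
  then have "ediff r x a0' = 0"
    using eqs(1) unfolding a0'_def ediff_add ediff_scale by (simp add: escale_def fun_eq_iff)
  moreover have "a0' {} = 0"
    using Suc.prems(3) by (simp add: a0'_def a(3) ejoin_def d_def escale_def ebar_def)
  ultimately obtain b0 where b0: "esupp r b0" "a0' = ediff r x b0"
    using Suc.IH[of a0'] a0'_supp reg by blast
  have "ediff (Suc r) x (ejoin r b0 d) = a"
    unfolding ediff_ejoin[OF b0(1) d_supp] d b0(2)[symmetric] a0'_def a(3) by simp
  moreover have "esupp (Suc r) (ejoin r b0 d)" by (rule esupp_ejoin) (fact b0 d_supp)+
  ultimately show ?case by metis
qed

section \<open>Polynomials: degrees and substitution\<close>

abbreviation keys :: "('a \<Rightarrow>\<^sub>0 'b::zero) \<Rightarrow> 'a set" where "keys \<equiv> Poly_Mapping.keys"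
abbreviation lookup :: "('a \<Rightarrow>\<^sub>0 'b::zero) \<Rightarrow> 'a \<Rightarrow> 'b" where "lookup \<equiv> Poly_Mapping.lookup"
abbreviation single :: "'a \<Rightarrow> 'b \<Rightarrow> 'a \<Rightarrow>\<^sub>0 'b::zero" where "single \<equiv> Poly_Mapping.single"

abbreviation polys :: "'v set \<Rightarrow> ('v, 'k::field) mpoly set" where
  "polys V \<equiv> carrier (poly_ring V)"

lemma polys_iff: "p \<in> polys V \<longleftrightarrow> (\<forall>m. lookup p m \<noteq> 0 \<longrightarrow> keys m \<subseteq> V)"
  by (auto simp: poly_ring_def in_keys_iff)

lemma polys_zero: "0 \<in> polys V" and polys_one: "1 \<in> polys V"
  by (auto simp: polys_iff lookup_one when_def split: if_splits)

lemma polys_add: "p \<in> polys V \<Longrightarrow> q \<in> polys V \<Longrightarrow> p + q \<in> polys V"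
  by (auto simp: polys_iff lookup_add) (metis add_0 in_keys_iff subsetD)

lemma polys_uminus: "p \<in> polys V \<Longrightarrow> - p \<in> polys V"
  by (auto simp: polys_iff)

lemma polys_diff: "p \<in> polys V \<Longrightarrow> q \<in> polys V \<Longrightarrow> p - q \<in> polys V"
  using polys_add[of p V "- q"] polys_uminus[of q V] by simp

lemma keys_monom_add: "keys (m + m') = keys m \<union> keys m'"
  for m m' :: "'v monom"
  by (auto simp: in_keys_iff lookup_add)

lemma polys_mult: "p \<in> polys V \<Longrightarrow> q \<in> polys V \<Longrightarrow> p * q \<in> polys V"
  using keys_mult[of p q] by (fastforce simp: poly_ring_def keys_monom_add)

lemma polys_sum: "(\<And>i. i \<in> A \<Longrightarrow> f i \<in> polys V) \<Longrightarrow> (\<Sum>i\<in>A. f i) \<in> polys V"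
  by (induction A rule: infinite_finite_induct) (auto intro: polys_zero polys_add)

lemma polys_prod: "(\<And>i. i \<in> A \<Longrightarrow> f i \<in> polys V) \<Longrightarrow> (\<Prod>i\<in>A. f i) \<in> polys V"
  by (induction A rule: infinite_finite_induct) (auto intro: polys_one polys_mult)

lemma polys_power: "p \<in> polys V \<Longrightarrow> p ^ k \<in> polys V"
  by (induction k) (auto intro: polys_one polys_mult)

lemma polys_single: "keys m \<subseteq> V \<Longrightarrow> single m c \<in> polys V"
  by (auto simp: poly_ring_def split: if_splits)

lemma polys_const: "const c \<in> polys V"
  by (simp add: const_def polys_single)

lemma polys_var: "v \<in> V \<Longrightarrow> var v \<in> polys V"
  by (simp add: var_def polys_single)

lemma poly_ring_simps [simp]:
  "mult (poly_ring V) = (*)" "one (poly_ring V) = 1" "zero (poly_ring V) = 0" "add (poly_ring V) = (+)"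
  by (simp_all add: poly_ring_def)

lemma poly_ring_cring: "cring (poly_ring V :: ('v, 'k::field) mpoly ring)"
proof (rule cringI)
  show "abelian_group (poly_ring V :: ('v, 'k) mpoly ring)"
  proof (rule abelian_groupI)
    fix p :: "('v, 'k) mpoly" assume "p \<in> polys V"
    then show "\<exists>q\<in>polys V. q \<oplus>\<^bsub>poly_ring V\<^esub> p = \<zero>\<^bsub>poly_ring V :: ('v, 'k) mpoly ring\<^esub>"
      using polys_uminus[of p] by (intro bexI[of _ "- p"]) simp_all
  qed (auto simp: polys_add polys_zero add_ac)
  show "comm_monoid (poly_ring V :: ('v, 'k) mpoly ring)"
    by (rule comm_monoidI) (auto simp: polys_mult polys_one mult_ac)
qed (auto simp: algebra_simps)

lemma poly_ring_a_minus: "p \<in> polys V \<Longrightarrow> \<ominus>\<^bsub>poly_ring V\<^esub> p = - p"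
  using cring.cring_simprules(3)[OF poly_ring_cring] cring.sum_zero_eq_neg[OF poly_ring_cring, of "- p" V p]
  by (simp add: polys_uminus)

lemma const_add: "const (a + b) = const a + const b"
  by (simp add: const_def single_add)

lemma const_mult: "const (a * b) = const a * const b"
  by (simp add: const_def mult_single)

lemma const_0 [simp]: "const 0 = 0" and const_1 [simp]: "const 1 = 1"
  by (simp_all add: const_def)

lemma const_uminus: "const (- a) = - const a"
  by (simp add: const_def single_uminus)

lemma const_sum: "const (\<Sum>i\<in>A. f i) = (\<Sum>i\<in>A. const (f i))"
  by (induction A rule: infinite_finite_induct) (auto simp: const_add)

lemma lookup_const_mult: "lookup (const c * p) m = c * lookup p m"
  for p :: "('v, 'k::field) mpoly"
proof -
  have "const c * p = Poly_Mapping.map ((*) c) p"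
    by (simp add: const_def mult_map_scale_conv_mult)
  then show ?thesis by (simp add: Poly_Mapping.map.rep_eq when_def)
qed

lemma sum_singles: "(\<Sum>m\<in>keys p. single m (lookup p m)) = p"
proof (rule poly_mapping_eqI)
  fix k
  have "(\<Sum>m\<in>keys p. lookup (single m (lookup p m)) k)
    = (\<Sum>m\<in>keys p. if m = k then lookup p k else 0)"
    by (rule sum.cong) (auto simp: lookup_single when_def)
  then show "lookup (\<Sum>m\<in>keys p.
      single m (lookup p m)) k = lookup p k"
    by (simp add: lookup_sum in_keys_iff)
qed

lemma lookup_var_mult:
  "lookup (var v * p) (single v 1 + m) = lookup p m"
  for p :: "('v, 'k::field) mpoly"
proof -
  have "var v * p = (\<Sum>k\<in>keys p.
      single (single v 1 + k) (lookup p k))"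
    by (subst sum_singles[of p, symmetric]) (simp add: sum_distrib_left var_def mult_single)
  then have "lookup (var v * p) (single v 1 + m) =
      (\<Sum>k\<in>keys p. if k = m then lookup p m else 0)"
    by (auto simp: lookup_sum lookup_single when_def intro!: sum.cong)
  then show ?thesis by (simp add: in_keys_iff)
qed

lemma mdeg_superset:
  assumes "finite A" "keys m \<subseteq> A"
  shows "mdeg m = (\<Sum>v\<in>A. lookup m v)"
  unfolding mdeg_def by (rule sum.mono_neutral_left) (use assms in \<open>auto simp: in_keys_iff\<close>)

lemma mdeg_add: "mdeg (m + m') = mdeg m + mdeg m'"
proof -
  let ?A = "keys m \<union> keys m'"
  have "mdeg (m + m') = (\<Sum>v\<in>?A. lookup (m + m') v)"
    by (rule mdeg_superset) (auto simp: keys_monom_add)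
  then show ?thesis
    by (simp add: lookup_add sum.distrib mdeg_superset[of ?A])
qed

lemma mdeg_zero [simp]: "mdeg 0 = 0"
  by (simp add: mdeg_def)

lemma mdeg_single [simp]: "mdeg (single v k) = k"
  by (simp add: mdeg_def)

lemma mdeg_eq_0_iff: "mdeg m = 0 \<longleftrightarrow> m = 0"
proof
  assume "mdeg m = 0"
  then have "lookup m v = 0" for v
    unfolding mdeg_def by (cases "v \<in> keys m") (auto simp: in_keys_iff)
  then show "m = 0" by (auto intro: poly_mapping_eqI)
qed simp

lemma monom_remove_var:
  fixes m :: "'v monom"
  assumes "v \<in> keys m"
  shows "m = single v 1 + (m - single v 1)"
  using assms by (intro poly_mapping_eqI) (auto simp: lookup_add lookup_minus lookup_single when_def in_keys_iff)

lemma mdeg_eq_1: "mdeg m = 1 \<Longrightarrow> \<exists>v. m = single v 1"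
proof -
  assume 1: "mdeg m = 1"
  then have "m \<noteq> 0" by auto
  then obtain v where "v \<in> keys m" by (metis keys_eq_empty all_not_in_conv)
  then have m: "m = single v 1 + (m - single v 1)" by (rule monom_remove_var)
  then have "mdeg (m - single v 1) = 0" using 1 mdeg_add
    by (metis add_cancel_right_right mdeg_single)
  then show ?thesis using m by (metis mdeg_eq_0_iff add.right_neutral)
qed

lemma homogeneous_iff: "homogeneous e p \<longleftrightarrow> (\<forall>m. lookup p m \<noteq> 0 \<longrightarrow> mdeg m = e)"
  by (auto simp: homogeneous_def in_keys_iff)

lemma homogeneous_0 [simp]: "homogeneous e 0"
  by (simp add: homogeneous_iff)

lemma homogeneous_add: "homogeneous e p \<Longrightarrow> homogeneous e q \<Longrightarrow> homogeneous e (p + q)"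
  unfolding homogeneous_iff lookup_add by (metis add_0)

lemma homogeneous_uminus: "homogeneous e p \<Longrightarrow> homogeneous e (- p)"
  by (auto simp: homogeneous_iff)

lemma homogeneous_diff: "homogeneous e p \<Longrightarrow> homogeneous e q \<Longrightarrow> homogeneous e (p - q)"
  using homogeneous_add[of e p "- q"] homogeneous_uminus[of e q] by simp

lemma homogeneous_sum: "(\<And>i. i \<in> A \<Longrightarrow> homogeneous e (f i)) \<Longrightarrow> homogeneous e (\<Sum>i\<in>A. f i)"
  by (induction A rule: infinite_finite_induct) (auto intro: homogeneous_add)

lemma homogeneous_mult: "homogeneous e p \<Longrightarrow> homogeneous e' q \<Longrightarrow> homogeneous (e + e') (p * q)"
  using keys_mult[of p q] by (fastforce simp: homogeneous_def mdeg_add)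

lemma homogeneous_const: "homogeneous 0 (const c)"
  by (auto simp: homogeneous_def const_def split: if_splits)

lemma homogeneous_const_mult: "homogeneous e p \<Longrightarrow> homogeneous e (const c * p)"
  using homogeneous_mult[OF homogeneous_const] by simp

lemma homogeneous_var: "homogeneous 1 (var v)"
  by (auto simp: homogeneous_def var_def split: if_splits)

lemma homogeneous_one: "homogeneous 0 1"
  using homogeneous_const[of 1] by simp

lemma homogeneous_prod_var:
  "finite A \<Longrightarrow> homogeneous (card A) (\<Prod>i\<in>A. var (f i) :: ('v, 'k::field) mpoly)"
proof (induction A rule: finite_induct)
  case (insert i A)
  then show ?case using homogeneous_mult[OF homogeneous_var insert.IH] by simp
qed (simp add: homogeneous_one)

definition hcomp :: "nat \<Rightarrow> ('v, 'k::field) mpoly \<Rightarrow> ('v, 'k) mpoly" where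
  "hcomp e p = Poly_Mapping.mapp (\<lambda>m c. c when mdeg m = e) p"

lemma lookup_hcomp: "lookup (hcomp e p) m = (lookup p m when mdeg m = e)"
  by (auto simp: hcomp_def lookup_mapp when_def in_keys_iff)

lemma hcomp_add: "hcomp e (p + q) = hcomp e p + hcomp e q"
  by (rule poly_mapping_eqI) (simp add: lookup_hcomp lookup_add when_def)

lemma hcomp_0 [simp]: "hcomp e 0 = 0"
  by (rule poly_mapping_eqI) (simp add: lookup_hcomp)

lemma hcomp_uminus: "hcomp e (- p) = - hcomp e p"
  by (rule poly_mapping_eqI) (simp add: lookup_hcomp when_def)

lemma hcomp_diff: "hcomp e (p - q) = hcomp e p - hcomp e q"
  using hcomp_add[of e p "- q"] by (simp add: hcomp_uminus)

lemma hcomp_sum: "hcomp e (\<Sum>i\<in>A. f i) = (\<Sum>i\<in>A. hcomp e (f i))"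
  by (induction A rule: infinite_finite_induct) (auto simp: hcomp_add)

lemma hcomp_homogeneous: "homogeneous e p \<Longrightarrow> hcomp e' p = (if e' = e then p else 0)"
  by (rule poly_mapping_eqI) (auto simp: lookup_hcomp when_def homogeneous_iff)

lemma homogeneous_hcomp [simp]: "homogeneous e (hcomp e p)"
  by (auto simp: homogeneous_iff lookup_hcomp)

lemma hcomp_polys: "p \<in> polys V \<Longrightarrow> hcomp e p \<in> polys V"
  by (auto simp: polys_iff lookup_hcomp)

lemma sum_hcomp:
  assumes "finite E" "mdeg ` keys p \<subseteq> E"
  shows "(\<Sum>e\<in>E. hcomp e p) = p"
proof (rule poly_mapping_eqI)
  fix m
  have "lookup (\<Sum>e\<in>E. hcomp e p) m = (\<Sum>e\<in>E. if e = mdeg m then lookup p m else 0)"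
    by (auto simp: lookup_sum lookup_hcomp when_def intro!: sum.cong)
  also have "\<dots> = lookup p m"
    using assms by (auto simp flip: not_in_keys_iff_lookup_eq_zero)
  finally show "lookup (\<Sum>e\<in>E. hcomp e p) m = lookup p m" .
qed

lemma hcomp_mult:
  assumes "homogeneous k l"
  shows "hcomp e (l * p) = (if k \<le> e then l * hcomp (e - k) p else 0)"
proof -
  let ?E = "mdeg ` keys p"
  have "hcomp e (l * p) = hcomp e (l * (\<Sum>j\<in>?E. hcomp j p))"
    by (simp add: sum_hcomp)
  also have "\<dots> = (\<Sum>j\<in>?E. hcomp e (l * hcomp j p))"
    by (simp add: sum_distrib_left hcomp_sum)
  also have "\<dots> = (\<Sum>j\<in>?E. if e = k + j then l * hcomp j p else 0)"
    using homogeneous_mult[OF assms homogeneous_hcomp] by (intro sum.cong) (auto simp: hcomp_homogeneous)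
  also have "\<dots> = (if k \<le> e then l * hcomp (e - k) p else 0)"
  proof (cases "k \<le> e")
    case True
    then have eq: "e = k + j \<longleftrightarrow> j = e - k" for j by auto
    have "hcomp (e - k) p = 0" if "e - k \<notin> ?E"
    proof (rule poly_mapping_eqI)
      fix m show "lookup (hcomp (e - k) p) m = lookup 0 m"
        using that by (force simp: lookup_hcomp when_def simp flip: not_in_keys_iff_lookup_eq_zero)
    qed
    then show ?thesis using True unfolding eq by auto
  next
    case False
    then show ?thesis by (auto intro!: sum.neutral)
  qed
  finally show ?thesis .
qed

definition monom_eval :: "('v \<Rightarrow> 'a::comm_ring_1) \<Rightarrow> 'v monom \<Rightarrow> 'a" where
  "monom_eval f m = (\<Prod>v\<in>keys m. f v ^ lookup m v)"

text
  \<open>Since the type of the new variables may differ from the old one, this also changes the number of variables.\<close>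

definition poly_subst :: "('v \<Rightarrow> ('w, 'k::field) mpoly) \<Rightarrow> ('v, 'k) mpoly \<Rightarrow> ('w, 'k) mpoly" where
  "poly_subst f p = (\<Sum>m\<in>keys p. const (lookup p m) * monom_eval f m)"

lemma monom_eval_add: "monom_eval f (m + m') = monom_eval f m * monom_eval f m'"
proof -
  let ?A = "keys m \<union> keys m'"
  have ext: "monom_eval f k = (\<Prod>v\<in>?A. f v ^ lookup k v)"
    if "keys k \<subseteq> ?A" for k
    unfolding monom_eval_def by (rule prod.mono_neutral_left) (use that in \<open>auto simp: in_keys_iff\<close>)
  show ?thesis
    by (simp add: ext keys_monom_add lookup_add power_add prod.distrib)
qed

lemma poly_subst_superset:
  assumes "finite A" "keys p \<subseteq> A"
  shows "poly_subst f p = (\<Sum>m\<in>A. const (lookup p m) * monom_eval f m)"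
  unfolding poly_subst_def by (rule sum.mono_neutral_left) (use assms in \<open>auto simp: in_keys_iff\<close>)

lemma poly_subst_add: "poly_subst f (p + q) = poly_subst f p + poly_subst f q"
proof -
  let ?A = "keys p \<union> keys q"
  have "poly_subst f (p + q) = (\<Sum>m\<in>?A. const (lookup (p + q) m) * monom_eval f m)"
    by (rule poly_subst_superset) (use keys_add[of p q] in auto)
  then show ?thesis
    by (simp add: lookup_add const_add distrib_right sum.distrib poly_subst_superset[of ?A])
qed

lemma poly_subst_0 [simp]: "poly_subst f 0 = 0"
  by (simp add: poly_subst_def)

lemma poly_subst_sum: "poly_subst f (\<Sum>i\<in>A. g i) = (\<Sum>i\<in>A. poly_subst f (g i))"
  by (induction A rule: infinite_finite_induct) (auto simp: poly_subst_add)

lemma poly_subst_uminus: "poly_subst f (- p) = - poly_subst f p"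
  using poly_subst_add[of f p "- p"] by (simp add: eq_neg_iff_add_eq_0 add.commute)

lemma poly_subst_single: "poly_subst f (single m c) = const c * monom_eval f m"
  by (cases "c = 0") (auto simp: poly_subst_def)

lemma poly_subst_const [simp]: "poly_subst f (const c) = const c"
  by (subst const_def, subst poly_subst_single) (simp add: monom_eval_def)

lemma poly_subst_1 [simp]: "poly_subst f 1 = 1"
  using poly_subst_const[of f 1] by simp

lemma poly_subst_var [simp]: "poly_subst f (var v) = f v"
  by (simp add: var_def poly_subst_single monom_eval_def)

text \<open>Both sides are bilinear, so it is enough to compare them on pairs of terms.\<close>

lemma poly_subst_mult: "poly_subst f (p * q) = poly_subst f p * poly_subst f q"
proof -
  have single_single: "poly_subst f (single m c * single m' c') =
      poly_subst f (single m c) * poly_subst f (single m' c')" for m m' c c'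
    by (simp add: mult_single poly_subst_single monom_eval_add const_mult mult_ac)
  have "poly_subst f ((\<Sum>m\<in>keys p. single m (lookup p m)) *
      (\<Sum>m\<in>keys q. single m (lookup q m))) =
      poly_subst f (\<Sum>m\<in>keys p. single m (lookup p m)) *
      poly_subst f (\<Sum>m\<in>keys q. single m (lookup q m))"
    by (simp only: sum_product poly_subst_sum single_single)
  then show ?thesis unfolding sum_singles .
qed

lemma poly_subst_power: "poly_subst f (p ^ k) = poly_subst f p ^ k"
  by (induction k) (auto simp: poly_subst_mult)

lemma poly_subst_polys:
  assumes "\<And>v. v \<in> V \<Longrightarrow> f v \<in> polys W" "p \<in> polys V"
  shows "poly_subst f p \<in> polys W"
  unfolding poly_subst_def monom_eval_def
proof (intro polys_sum polys_mult polys_const polys_prod polys_power)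
  fix m v assume "m \<in> keys p" "v \<in> keys m"
  then have "v \<in> V" using assms(2) by (auto simp: poly_ring_def)
  then show "f v \<in> polys W" by (rule assms)
qed

lemma poly_subst_ext_ediff:
  "(\<lambda>S. poly_subst f (ediff r x a S)) = ediff r (\<lambda>i. poly_subst f (x i)) (\<lambda>S. poly_subst f (a S))"
proof
  fix T
  have pow: "poly_subst f ((- 1) ^ k) = (- 1) ^ k" for k
    by (simp add: poly_subst_power poly_subst_uminus)
  have inv: "poly_subst f (shuffle_sign {i} T) = shuffle_sign {i} T" for i
    by (simp only: shuffle_sign_def pow)
  have "poly_subst f (x i * contract i a T) = poly_subst f (x i) * contract i (\<lambda>S. poly_subst f (a S)) T" for i
    by (simp add: contract_def poly_subst_mult inv)
  then show "poly_subst f (ediff r x a T) = ediff r (\<lambda>i. poly_subst f (x i)) (\<lambda>S. poly_subst f (a S)) T"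
    by (simp add: ediff_def poly_subst_sum)
qed

lemma lin_combs_add: "f \<in> lin_combs x k \<Longrightarrow> g \<in> lin_combs x k \<Longrightarrow> f + g \<in> lin_combs x k"
proof -
  assume "f \<in> lin_combs x k" "g \<in> lin_combs x k"
  then obtain h h' where "f = (\<Sum>j<k. x j * h j)" "g = (\<Sum>j<k. x j * h' j)"
    by (auto simp: lin_combs_def)
  then have "f + g = (\<Sum>j<k. x j * (h j + h' j))" by (simp add: distrib_left sum.distrib)
  then show ?thesis
    unfolding lin_combs_def by (intro CollectI exI[of _ "\<lambda>j. h j + h' j"]) simp
qed

lemma lin_combs_0: "0 \<in> lin_combs x k"
  unfolding lin_combs_def by (intro CollectI exI[of _ "\<lambda>_. 0"]) simp

lemma lin_combs_sum: "(\<And>i. i \<in> A \<Longrightarrow> f i \<in> lin_combs x k) \<Longrightarrow> (\<Sum>i\<in>A. f i) \<in> lin_combs x k"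
  by (induction A rule: infinite_finite_induct) (auto intro: lin_combs_0 lin_combs_add)

lemma lin_combs_mult: "j < k \<Longrightarrow> x j * f \<in> lin_combs x k"
  unfolding lin_combs_def
  by (intro CollectI exI[of _ "\<lambda>i. if i = j then f else 0"]) (simp add: if_distrib cong: if_cong)

lemma single_split_var:
  assumes "v \<in> keys m"
  shows "single m c = var v * single (m - single v 1) c"
  using monom_remove_var[OF assms] by (simp add: var_def mult_single)

text \<open>The ideal of the first \<open>k\<close> variables is a monomial ideal, so membership can be read off from
  the monomials.\<close>

lemma lin_combs_var_iff:
  "f \<in> lin_combs var k \<longleftrightarrow> (\<forall>m\<in>keys f. \<exists>j<k. j \<in> keys m)"
  for f :: "(nat, 'k::field) mpoly"
proof
  assume "f \<in> lin_combs var k"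
  then obtain h where f: "f = (\<Sum>j<k. var j * h j)" by (auto simp: lin_combs_def)
  show "\<forall>m\<in>keys f. \<exists>j<k. j \<in> keys m"
  proof
    fix m assume "m \<in> keys f"
    then have "(\<Sum>j<k. lookup (var j * h j) m) \<noteq> 0"
      by (simp add: in_keys_iff f lookup_sum)
    then obtain j where j: "j < k" "lookup (var j * h j) m \<noteq> 0"
      by (metis (no_types, lifting) lessThan_iff sum.neutral)
    then obtain m' where "m = single j 1 + m'"
      using keys_mult[of "var j" "h j"] by (auto simp: in_keys_iff var_def lookup_single when_def split: if_splits)
    then show "\<exists>j<k. j \<in> keys m"
      using j(1) by (auto simp: keys_monom_add)
  qed
next
  assume *: "\<forall>m\<in>keys f. \<exists>j<k. j \<in> keys m"
  have "(\<Sum>m\<in>keys f. single m (lookup f m)) \<in> lin_combs var k"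
  proof (rule lin_combs_sum)
    fix m assume "m \<in> keys f"
    then obtain j where "j < k" "j \<in> keys m" using * by blast
    then show "single m (lookup f m) \<in> lin_combs var k"
      by (simp add: single_split_var lin_combs_mult)
  qed
  then show "f \<in> lin_combs var k" by (simp add: sum_singles)
qed

lemma regular_seq_var: "regular_seq (var :: nat \<Rightarrow> (nat, 'k::field) mpoly) r"
  unfolding regular_seq_def lin_combs_var_iff
proof (intro allI impI ballI)
  fix i and f :: "(nat, 'k) mpoly" and m
  assume *: "\<forall>m\<in>keys (var i * f). \<exists>j<i. j \<in> keys m" "m \<in> keys f"
  then have "single i 1 + m \<in> keys (var i * f)"
    unfolding in_keys_iff lookup_var_mult by simp
  then show "\<exists>j<i. j \<in> keys m"
    using * by (fastforce simp: keys_monom_add)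
qed

section \<open>Koszul complexes on linear forms\<close>

lemma ideal_subset: "ideal J (poly_ring V) \<Longrightarrow> f \<in> J \<Longrightarrow> f \<in> polys V"
  using additive_subgroup.a_subset ideal.axioms(1) by blast

lemma ideal_zero: "ideal J (poly_ring V) \<Longrightarrow> 0 \<in> J"
  using additive_subgroup.zero_closed ideal.axioms(1) by fastforce

lemma ideal_add: "ideal J (poly_ring V) \<Longrightarrow> f \<in> J \<Longrightarrow> g \<in> J \<Longrightarrow> f + g \<in> J"
  using additive_subgroup.a_closed[OF ideal.axioms(1)] by fastforce

lemma ideal_mult: "ideal J (poly_ring V) \<Longrightarrow> f \<in> J \<Longrightarrow> g \<in> polys V \<Longrightarrow> g * f \<in> J"
  using ideal.I_l_closed by fastforce

lemma ideal_mult': "ideal J (poly_ring V) \<Longrightarrow> f \<in> J \<Longrightarrow> g \<in> polys V \<Longrightarrow> f * g \<in> J"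
  using ideal_mult by (metis mult.commute)

lemma ideal_uminus: "ideal J (poly_ring V) \<Longrightarrow> f \<in> J \<Longrightarrow> - f \<in> J"
  using ideal_mult[of J V f "- 1"] polys_uminus[OF polys_one] by force

lemma ideal_diff: "ideal J (poly_ring V) \<Longrightarrow> f \<in> J \<Longrightarrow> g \<in> J \<Longrightarrow> f - g \<in> J"
  using ideal_add[of J V f "- g"] ideal_uminus[of J V g] by simp

lemma ideal_sum: "ideal J (poly_ring V) \<Longrightarrow> (\<And>i. i \<in> A \<Longrightarrow> f i \<in> J) \<Longrightarrow> (\<Sum>i\<in>A. f i) \<in> J"
  by (induction A rule: infinite_finite_induct) (auto intro: ideal_zero ideal_add)

lemma ideal_minus_commute: "ideal J (poly_ring V) \<Longrightarrow> f - g \<in> J \<Longrightarrow> g - f \<in> J"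
  using ideal_uminus[of J V "f - g"] by simp

lemma ideal_trans: "ideal J (poly_ring V) \<Longrightarrow> f - g \<in> J \<Longrightarrow> g - h \<in> J \<Longrightarrow> f - h \<in> J"
  using ideal_add[of J V "f - g" "g - h"] by simp

lemma zero_ideal_poly_ring: "ideal {0} (poly_ring V)"
  using ring.zeroideal[OF cring.axioms(1)[OF poly_ring_cring]] by simp

lemma ideal_poly_ringI:
  assumes "J \<subseteq> polys V" "0 \<in> J" "\<And>f g. f \<in> J \<Longrightarrow> g \<in> J \<Longrightarrow> f + g \<in> J"
    "\<And>f g. f \<in> J \<Longrightarrow> g \<in> polys V \<Longrightarrow> g * f \<in> J"
  shows "ideal J (poly_ring V)"
proof (rule idealI)
  show "ring (poly_ring V :: ('a, 'b) mpoly ring)" using poly_ring_cring cring.axioms(1) by blast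
  have "inv\<^bsub>add_monoid (poly_ring V)\<^esub> f \<in> J" if "f \<in> J" for f
  proof -
    have "inv\<^bsub>add_monoid (poly_ring V)\<^esub> f = - 1 * f"
      using poly_ring_a_minus[of f V] that assms(1) by (auto simp: a_inv_def)
    then show ?thesis using assms(4)[OF that polys_uminus[OF polys_one]] by simp
  qed
  then show "subgroup J (add_monoid (poly_ring V))"
    using assms by unfold_locales auto
qed (use assms in \<open>auto simp: mult.commute\<close>)

lemma monom_eval_var: "(monom_eval var m :: ('v, 'k::field) mpoly) = single m 1"
proof -
  have pow: "(var v :: ('v, 'k) mpoly) ^ k = single (single v k) 1" for v :: 'v and k
    by (induction k) (simp_all add: var_def mult_single flip: single_add)
  have "(\<Prod>v\<in>A. var v ^ lookup m v :: ('v, 'k) mpoly) =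
      single (\<Sum>v\<in>A. single v (lookup m v)) 1"
    if "finite A" for A :: "'v set" and m
    using that by (induction A) (simp_all add: pow mult_single)
  then show ?thesis by (simp add: monom_eval_def sum_singles)
qed

lemma poly_subst_poly_subst: "poly_subst g (poly_subst f q) = poly_subst (\<lambda>v. poly_subst g (f v)) q"
proof -
  have "poly_subst g (\<Prod>v\<in>A. f v ^ k v) = (\<Prod>v\<in>A. poly_subst g (f v) ^ k v)" for A k
    by (induction A rule: infinite_finite_induct) (auto simp: poly_subst_mult poly_subst_power)
  then have "poly_subst g (monom_eval f m) = monom_eval (\<lambda>v. poly_subst g (f v)) m" for m
    by (simp add: monom_eval_def)
  then show ?thesis
    by (simp add: poly_subst_def[of f] poly_subst_def[of "\<lambda>v. poly_subst g (f v)"] poly_subst_sum poly_subst_mult)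
qed

lemma ideal_cong_mult:
  assumes J: "ideal J (poly_ring V)" and "f - f' \<in> J" "g - g' \<in> J" "f' \<in> polys V" "g \<in> polys V"
  shows "f * g - f' * g' \<in> J"
proof -
  have "f * g - f' * g' = (f - f') * g + f' * (g - g')" by (simp add: algebra_simps)
  then show ?thesis
    using ideal_add[OF J ideal_mult'[OF J] ideal_mult[OF J]] assms by simp
qed

lemma ideal_cong_power:
  assumes J: "ideal J (poly_ring V)" and "f - g \<in> J" "f \<in> polys V" "g \<in> polys V"
  shows "f ^ k - g ^ k \<in> J"
  by (induction k) (use assms in \<open>auto intro!: ideal_cong_mult[OF J] polys_power simp: ideal_zero\<close>)

lemma ideal_cong_prod:
  assumes J: "ideal J (poly_ring V)"
    and "finite A" "\<And>i. i \<in> A \<Longrightarrow> f i - g i \<in> J" "\<And>i. i \<in> A \<Longrightarrow> f i \<in> polys V"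
      "\<And>i. i \<in> A \<Longrightarrow> g i \<in> polys V"
  shows "(\<Prod>i\<in>A. f i) - (\<Prod>i\<in>A. g i) \<in> J"
  using assms(2-)
  by (induction A rule: finite_induct) (auto intro!: ideal_cong_mult[OF J] polys_prod simp: ideal_zero[OF J])

text \<open>Congruence modulo \<open>J\<close> respects products and sums, so it passes from the variables to all
  polynomials.\<close>

lemma poly_subst_cong_id:
  assumes J: "ideal J (poly_ring V)" and f: "\<And>v. v \<in> V \<Longrightarrow> f v \<in> polys V"
    and cong: "\<And>v. v \<in> V \<Longrightarrow> f v - var v \<in> J" and q: "q \<in> polys V"
  shows "poly_subst f q - q \<in> J"
proof -
  have "(\<Sum>m\<in>keys q. const (lookup q m) *
      (monom_eval f m - single m 1)) \<in> J"
  proof (intro ideal_sum[OF J] ideal_mult[OF J] polys_const)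
    fix m assume "m \<in> keys q"
    then have "keys m \<subseteq> V" using q by (auto simp: poly_ring_def)
    then have "monom_eval f m - monom_eval var m \<in> J"
      unfolding monom_eval_def
      by (intro ideal_cong_prod[OF J] ideal_cong_power[OF J] polys_power cong f polys_var) auto
    then show "monom_eval f m - single m 1 \<in> J" by (simp add: monom_eval_var)
  qed
  moreover have "(\<Sum>m\<in>keys q. const (lookup q m) * single m 1) = q"
    by (simp add: const_def mult_single sum_singles)
  ultimately show ?thesis by (simp add: poly_subst_def right_diff_distrib sum_subtractf)
qed

text \<open>Each monomial of \<open>f\<close> is assigned to one of the variables that divide it.\<close>

lemma no_constant_term:
  assumes "f \<in> polys V" "lookup f 0 = 0" "finite V"
  obtains h where "\<And>v. h v \<in> polys V" "f = (\<Sum>v\<in>V. var v * h v)"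
proof -
  define w where "w m = (SOME v. v \<in> keys m)" for m :: "'a monom"
  have w: "w m \<in> keys m" "keys m \<subseteq> V" if "m \<in> keys f" for m
  proof -
    have "m \<noteq> 0" using assms(2) that by (auto simp: in_keys_iff)
    then have "keys m \<noteq> {}" by simp
    then show "w m \<in> keys m" unfolding w_def by (rule some_in_eq[THEN iffD2])
    show "keys m \<subseteq> V" using assms(1) that by (auto simp: poly_ring_def)
  qed
  define h where "h v = (\<Sum>m | m \<in> keys f \<and> w m = v.
      single (m - single v 1) (lookup f m))" for v
  have sub: "keys (m - single v 1) \<subseteq> keys m" for m :: "'a monom" and v
    by (auto simp: in_keys_iff lookup_minus)
  have h: "h v \<in> polys V" for v
    unfolding h_def using w sub by (intro polys_sum polys_single) blast
  have "(\<Sum>v\<in>V. var v * h v) = (\<Sum>v\<in>V. \<Sum>m | m \<in> keys f \<and> w m = v.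
      single m (lookup f m))"
    unfolding h_def sum_distrib_left
  proof (intro sum.cong refl)
    fix v m assume "m \<in> {m \<in> keys f. w m = v}"
    then have "v \<in> keys m" using w(1) by auto
    then show "var v * single (m - single v 1) (lookup f m) =
        single m (lookup f m)"
      by (rule single_split_var[symmetric])
  qed
  also have "\<dots> = (\<Sum>m\<in>keys f. single m (lookup f m))"
    using w assms(3) by (intro sum.group) auto
  finally have "f = (\<Sum>v\<in>V. var v * h v)" by (simp add: sum_singles)
  then show thesis using that h by blast
qed

lemma single_inj: "single u 1 = single v (1::nat) \<longleftrightarrow> u = v"
  by (metis keys_single singleton_insert_inj_eq one_neq_zero)

lemma linear_form_expand:
  assumes "f \<in> polys V" "homogeneous 1 f" "finite V"
  shows "f = (\<Sum>v\<in>V. const (lookup f (single v 1)) * var v)"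
proof (rule poly_mapping_eqI)
  fix m
  show "lookup f m =
      lookup (\<Sum>v\<in>V. const (lookup f (single v 1)) * var v) m"
  proof (cases "\<exists>v\<in>V. m = single v 1")
    case True
    then obtain v where v: "v \<in> V" "m = single v 1" by blast
    have "(\<Sum>u\<in>V. lookup f (single u 1) * lookup (var u) m) =
      (\<Sum>u\<in>V. if u = v then lookup f m else 0)"
      by (intro sum.cong) (auto simp: v(2) var_def lookup_single when_def single_inj[unfolded One_nat_def])
    then show ?thesis using v(1) assms(3) by (simp add: lookup_sum lookup_const_mult)
  next
    case False
    have "lookup f m = 0"
    proof (rule ccontr)
      assume m: "lookup f m \<noteq> 0"
      then have "mdeg m = 1" using assms(2) by (auto simp: homogeneous_iff)
      then obtain v where "m = single v 1" using mdeg_eq_1 by blast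
      moreover from this have "v \<in> V" using m assms(1) by (auto simp: polys_iff)
      ultimately show False using False by blast
    qed
    moreover have "lookup (var u :: ('a, 'b) mpoly) m = 0" if "u \<in> V" for u
      using False that by (auto simp: var_def lookup_single when_def)
    ultimately show ?thesis by (simp add: lookup_sum lookup_const_mult)
  qed
qed

text \<open>The Koszul complex over the polynomial ring in the variables \<open>V\<close>, whose elements lift those
  over its quotients.\<close>

definition koszul_polys :: "'v set \<Rightarrow> nat \<Rightarrow> ('v, 'k::field) mpoly ext set" where
  "koszul_polys V r = {a. esupp r a \<and> (\<forall>S. a S \<in> polys V)}"

lemma koszul_polys_add: "a \<in> koszul_polys V r \<Longrightarrow> b \<in> koszul_polys V r \<Longrightarrow> a + b \<in> koszul_polys V r"
  by (simp add: koszul_polys_def esupp_add polys_add)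

lemma koszul_polys_diff: "a \<in> koszul_polys V r \<Longrightarrow> b \<in> koszul_polys V r \<Longrightarrow> a - b \<in> koszul_polys V r"
  by (simp add: koszul_polys_def esupp_diff polys_diff)

lemma koszul_polys_zero: "0 \<in> koszul_polys V r"
  by (simp add: koszul_polys_def esupp_zero polys_zero)

lemma koszul_polys_sum:
  "(\<And>i. i \<in> A \<Longrightarrow> f i \<in> koszul_polys V r) \<Longrightarrow> (\<Sum>i\<in>A. f i) \<in> koszul_polys V r"
  by (simp add: koszul_polys_def esupp_sum polys_sum sum_fun_apply)

lemma koszul_polys_scale: "a \<in> koszul_polys V r \<Longrightarrow> c \<in> polys V \<Longrightarrow> escale c a \<in> koszul_polys V r"
  by (auto simp: koszul_polys_def esupp_scale) (simp add: escale_def polys_mult)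

lemma polys_sign: "(-1) ^ k \<in> polys V" and polys_shuffle_sign: "shuffle_sign S T \<in> polys V"
  by (auto simp: shuffle_sign_def intro!: polys_power polys_uminus polys_one)

lemma koszul_polys_ediff:
  assumes "a \<in> koszul_polys V r" "\<And>i. i < r \<Longrightarrow> p i \<in> polys V"
  shows "ediff r p a \<in> koszul_polys V r"
proof -
  have "ediff r p a S \<in> polys V" for S
    unfolding ediff_def contract_def
    using assms by (auto simp: koszul_polys_def intro!: polys_sum polys_mult polys_zero polys_shuffle_sign)
  then show ?thesis using assms(1) by (simp add: koszul_polys_def esupp_ediff)
qed

lemma koszul_polys_emul:
  assumes "a \<in> koszul_polys V r" "b \<in> koszul_polys V r"
  shows "emul a b \<in> koszul_polys V r"
  using assms by (auto simp: koszul_polys_def esupp_emul)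
    (auto simp: emul_def intro!: polys_sum polys_mult polys_shuffle_sign)

lemma koszul_polys_ebar: "a \<in> koszul_polys V r \<Longrightarrow> ebar a \<in> koszul_polys V r"
  by (auto simp: koszul_polys_def esupp_ebar) (simp only: ebar_def polys_mult polys_sign)

text \<open>Linear forms whose residues form a basis of the degree 1 part of \<open>R/I\<close>: a variable \<open>v\<close> has
  the coordinates \<open>C v\<close> with respect to them.\<close>

locale linear_forms =
  fixes V :: "'v set" and I :: "('v, 'k::field) mpoly set" and p :: "nat \<Rightarrow> ('v, 'k) mpoly"
    and r :: nat and C :: "'v \<Rightarrow> nat \<Rightarrow> 'k"
  assumes fin_V: "finite V" and I: "ideal I (poly_ring V)"
    and p: "i < r \<Longrightarrow> p i \<in> polys V" and p_lin: "i < r \<Longrightarrow> homogeneous 1 (p i)"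
    and span: "v \<in> V \<Longrightarrow> (\<Sum>i<r. const (C v i) * p i) - var v \<in> I"
    and indep: "(\<Sum>i<r. const (l i) * p i) \<in> I \<Longrightarrow> i < r \<Longrightarrow> l i = 0"
begin

text
  \<open>The homomorphism to a polynomial ring in new variables, one for each linear form, that expresses a polynomial in terms of the linear forms.\<close>

definition coords :: "('v, 'k) mpoly \<Rightarrow> (nat, 'k) mpoly" where
  "coords = poly_subst (\<lambda>v. \<Sum>i<r. const (C v i) * var i)"

text \<open>Expanding \<open>p i\<close> in the variables and these in the \<open>p j\<close> gives a linear combination of the
  \<open>p j\<close> that agrees with \<open>p i\<close> modulo \<open>I\<close>. By independence it is the trivial one.\<close>

lemma coords_p:
  assumes "i < r"
  shows "coords (p i) = var i"
proof -
  define b where "b v = lookup (p i) (single v 1)" for v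
  define l where "l j = (\<Sum>v\<in>V. b v * C v j) - (if j = i then 1 else 0)" for j
  have expand: "p i = (\<Sum>v\<in>V. const (b v) * var v)"
    unfolding b_def by (rule linear_form_expand[OF p[OF assms] p_lin[OF assms] fin_V])
  have l: "(\<Sum>j<r. const (l j) * y j) = (\<Sum>v\<in>V. const (b v) * (\<Sum>j<r. const (C v j) * y j)) - y i"
    for y :: "nat \<Rightarrow> ('w, 'k) mpoly"
  proof -
    have "(\<Sum>j<r. const (l j) * y j) = (\<Sum>j<r. \<Sum>v\<in>V. const (b v) * (const (C v j) * y j)) -
        (\<Sum>j<r. const (if j = i then 1 else 0) * y j)"
      unfolding l_def by (auto simp: const_add[of _ "- _", simplified] const_uminus const_sum const_mult
          sum_distrib_right mult.assoc left_diff_distrib sum_subtractf intro!: sum.cong)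
    also have "(\<Sum>j<r. const (if j = i then 1 else 0) * y j) = (\<Sum>j<r. if j = i then y j else 0)"
      by (rule sum.cong) auto
    finally show ?thesis using assms by (subst (asm) sum.swap) (simp add: sum_distrib_left)
  qed
  have "(\<Sum>j<r. const (l j) * p j) = (\<Sum>v\<in>V. const (b v) * ((\<Sum>j<r. const (C v j) * p j) - var v))"
    unfolding l right_diff_distrib sum_subtractf expand[symmetric] ..
  also have "\<dots> \<in> I" by (intro ideal_sum[OF I] ideal_mult[OF I] span polys_const)
  finally have "l j = 0" if "j < r" for j using indep that by blast
  then have "(\<Sum>v\<in>V. const (b v) * (\<Sum>j<r. const (C v j) * var j)) = var i"
    using l[of var] by simp
  then show ?thesis
    unfolding coords_def by (subst expand) (simp add: poly_subst_sum poly_subst_mult)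
qed

text \<open>The map \<open>coords\<close> and the substitution of the linear forms for the new variables are inverse
  to each other modulo \<open>J\<close>. So a cycle modulo \<open>J\<close> is carried to a cycle over the new polynomial
  ring, where the variables form a regular sequence, and a primitive found there is carried back.
  The lemma serves for \<open>J = 0\<close>, when \<open>I\<close> contains no linear forms, and for \<open>J = I\<close>, when \<open>I\<close> is
  generated by linear forms.\<close>

lemma acyclic_mod:
  assumes J: "ideal J (poly_ring V)" and J0: "\<And>f. f \<in> J \<Longrightarrow> coords f = 0"
    and span: "\<And>v. v \<in> V \<Longrightarrow> (\<Sum>i<r. const (C v i) * p i) - var v \<in> J"
    and a: "a \<in> koszul_polys V r" "a {} = 0" "\<And>S. ediff r p a S \<in> J"
  shows "\<exists>b\<in>koszul_polys V r. b {} = 0 \<and> (\<forall>S. (a - ediff r p b) S \<in> J)"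
proof -
  let ?ca = "\<lambda>S. coords (a S)"
  have cd: "ediff r var ?ca = ediff r (\<lambda>i. coords (p i)) ?ca"
    by (auto simp: ediff_def coords_p intro!: ext sum.cong)
  also have "\<dots> = (\<lambda>S. coords (ediff r p a S))"
    unfolding coords_def by (simp add: poly_subst_ext_ediff)
  also have "\<dots> = 0" using J0 a(3) by auto
  finally have "ediff r var ?ca = 0" .
  moreover have "esupp r ?ca" using a(1) by (auto simp: koszul_polys_def esupp_def coords_def)
  ultimately obtain b where b: "esupp r b" "?ca = ediff r var b"
    using koszul_acyclic[OF regular_seq_var, of r ?ca] a(2) by (auto simp: coords_def)
  \<comment> \<open>The primitive may involve variables beyond the first \<open>r\<close>; sending them to 0 keeps the image
    in \<open>polys V\<close>.\<close>
  define f where "f i = (if i < r then p i else 0)" for i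
  have f: "f i \<in> polys V" for i by (simp add: f_def p polys_zero)
  have inverse: "poly_subst f (coords q) - q \<in> J" if "q \<in> polys V" for q
    unfolding coords_def poly_subst_poly_subst
  proof (rule poly_subst_cong_id[OF J _ _ that])
    fix v assume v: "v \<in> V"
    have "poly_subst f (\<Sum>i<r. const (C v i) * var i) = (\<Sum>i<r. const (C v i) * p i)"
      by (simp add: poly_subst_sum poly_subst_mult f_def)
    then show "poly_subst f (\<Sum>i<r. const (C v i) * var i) - var v \<in> J"
      "poly_subst f (\<Sum>i<r. const (C v i) * var i) \<in> polys V"
      using span[OF v] p by (auto intro!: polys_sum polys_mult polys_const)
  qed
  define b' where "b' S = (if S = {} then 0 else poly_subst f (b S))" for S
  have "ediff r p b' = ediff r (\<lambda>i. poly_subst f (var i)) (\<lambda>S. poly_subst f (b S))"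
    by (simp add: ediff_def contract_def b'_def f_def fun_eq_iff cong: if_cong)
  also have "\<dots> = (\<lambda>S. poly_subst f (ediff r var b S))"
    by (simp only: poly_subst_ext_ediff)
  also have "\<dots> = (\<lambda>S. poly_subst f (coords (a S)))"
    by (simp flip: b(2))
  finally have db': "ediff r p b' = (\<lambda>S. poly_subst f (coords (a S)))" .
  have "a S \<in> polys V" for S using a(1) by (simp add: koszul_polys_def)
  then have "(a - ediff r p b') S \<in> J" for S
    using ideal_minus_commute[OF J inverse] by (simp add: db')
  moreover have "poly_subst f q \<in> polys V" for q
    by (rule poly_subst_polys[of UNIV], rule f) (simp add: polys_iff)
  then have "b' \<in> koszul_polys V r"
    using b(1) by (auto simp: koszul_polys_def esupp_def b'_def polys_zero)
  ultimately show ?thesis by (intro bexI[of _ b']) (auto simp: b'_def)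
qed

end

section \<open>Koszul homology of an ideal with linear resolution\<close>

definition bihomogeneous :: "nat \<Rightarrow> nat \<Rightarrow> ('v, 'k::field) mpoly ext \<Rightarrow> bool" where
  "bihomogeneous q e a \<longleftrightarrow> (\<forall>S. a S \<noteq> 0 \<longrightarrow> card S = q \<and> homogeneous e (a S))"

lemma bihomogeneous_coeff: "bihomogeneous q e a \<Longrightarrow> homogeneous e (a S)"
  by (cases "a S = 0") (auto simp: bihomogeneous_def)

lemma bihomogeneous_add: "bihomogeneous q e a \<Longrightarrow> bihomogeneous q e b \<Longrightarrow> bihomogeneous q e (a + b)"
  unfolding bihomogeneous_def by (metis homogeneous_0 homogeneous_add add_0 plus_fun_apply)

lemma bihomogeneous_0: "bihomogeneous q e 0"
  by (simp add: bihomogeneous_def)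

lemma bihomogeneous_sum:
  "(\<And>i. i \<in> A \<Longrightarrow> bihomogeneous q e (f i)) \<Longrightarrow> bihomogeneous q e (\<Sum>i\<in>A. f i)"
  by (induction A rule: infinite_finite_induct)
    (simp_all only: sum.infinite sum.empty sum.insert bihomogeneous_0 bihomogeneous_add insert_iff simp_thms)

lemma homogeneous_sign: "homogeneous 0 ((-1) ^ k :: ('v, 'k::field) mpoly)"
proof -
  have "((-1) ^ k :: ('v, 'k) mpoly) = const ((-1) ^ k)"
    by (induction k) (simp_all add: const_mult const_uminus)
  then show ?thesis by (simp add: homogeneous_const)
qed

lemma homogeneous_shuffle_sign: "homogeneous 0 (shuffle_sign S T :: ('v, 'k::field) mpoly)"
  unfolding shuffle_sign_def by (rule homogeneous_sign)

lemma bihomogeneous_ediff: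
  assumes "bihomogeneous (Suc q) e a" "esupp r a" "\<And>i. i < r \<Longrightarrow> homogeneous 1 (p i)"
  shows "bihomogeneous q (Suc e) (ediff r p a)"
  unfolding bihomogeneous_def
proof (intro allI impI conjI)
  fix S assume "ediff r p a S \<noteq> 0"
  then obtain i where "i < r" "p i * contract i a S \<noteq> 0"
    unfolding ediff_def by (rule sum.not_neutral_contains_not_neutral) auto
  then have "i < r" "i \<notin> S" "a (insert i S) \<noteq> 0"
    by (auto simp: contract_def split: if_splits)
  moreover from this have "finite (insert i S)"
    using assms(2) by (meson esuppD finite_subset finite_lessThan)
  ultimately show "card S = q"
    using assms(1) by (force simp: bihomogeneous_def)
next
  fix S
  show "homogeneous (Suc e) (ediff r p a S)"
    unfolding ediff_def
  proof (rule homogeneous_sum)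
    fix i assume "i \<in> {..<r}"
    moreover have "homogeneous e (contract i a S)"
      using homogeneous_mult[OF homogeneous_shuffle_sign bihomogeneous_coeff[OF assms(1)]]
      by (simp add: contract_def)
    ultimately show "homogeneous (Suc e) (p i * contract i a S)"
      using homogeneous_mult[OF assms(3)] by (metis lessThan_iff plus_1_eq_Suc)
  qed
qed

text \<open>Any preimages of the coefficients of \<open>X\<close> may be used: as the entries of the matrix are
  homogeneous of degree \<open>k\<close>, the components of degree \<open>e - k\<close> of the preimages are preimages as
  well.\<close>

lemma lift_through_matrix:
  fixes X :: "nat \<Rightarrow> ('v, 'k::field) mpoly ext"
  assumes X: "\<And>i. i < n \<Longrightarrow> X i \<in> koszul_polys V r" "\<And>i. i < n \<Longrightarrow> bihomogeneous q e (X i)"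
    and N: "\<And>i j. i < n \<Longrightarrow> j < c \<Longrightarrow> homogeneous k (N i j)" and "k \<le> e"
    and img: "\<And>S. \<exists>u. (\<forall>j. u j \<in> polys V) \<and> (\<forall>i<n. X i S = (\<Sum>j<c. N i j * u j))"
  obtains U where "\<And>j. U j \<in> koszul_polys V r" "\<And>j. bihomogeneous q (e - k) (U j)"
    "\<And>i. i < n \<Longrightarrow> X i = (\<Sum>j<c. escale (N i j) (U j))"
proof -
  obtain u where u: "\<And>S j. u S j \<in> polys V" "\<And>S i. i < n \<Longrightarrow> X i S = (\<Sum>j<c. N i j * u S j)"
    using img by metis
  define U where "U j S = (if S \<subseteq> {..<r} \<and> card S = q then hcomp (e - k) (u S j) else 0)" for j S
  have "U j \<in> koszul_polys V r" for j
    by (auto simp: koszul_polys_def esupp_def U_def u(1) hcomp_polys polys_zero)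
  moreover have "bihomogeneous q (e - k) (U j)" for j
    by (auto simp: bihomogeneous_def U_def)
  moreover have "X i = (\<Sum>j<c. escale (N i j) (U j))" if i: "i < n" for i
  proof
    fix S
    show "X i S = (\<Sum>j<c. escale (N i j) (U j)) S"
    proof (cases "S \<subseteq> {..<r} \<and> card S = q")
      case True
      have "X i S = hcomp e (X i S)"
        using hcomp_homogeneous[OF bihomogeneous_coeff[OF X(2)[OF i]], of e S] by simp
      also have "\<dots> = (\<Sum>j<c. N i j * hcomp (e - k) (u S j))"
        unfolding u(2)[OF i] hcomp_sum using \<open>k \<le> e\<close> by (auto simp: hcomp_mult[OF N[OF i]] intro!: sum.cong)
      finally show ?thesis using True by (simp add: sum_fun_apply escale_def U_def)
    next
      case False
      then have "X i S = 0" using X[OF i] by (auto simp: koszul_polys_def bihomogeneous_def esupp_def)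
      moreover have "U j S = 0" for j
        using False unfolding U_def by (rule if_not_P)
      ultimately show ?thesis by (simp add: sum_fun_apply escale_def)
    qed
  qed
  ultimately show thesis using that by blast
qed

text \<open>The absence of linear forms in \<open>I\<close> makes the \<open>p i\<close> a basis of all linear forms, so that
  their Koszul complex over the polynomial ring is acyclic.\<close>

locale linear_resolution = linear_forms V I p r C
  for V :: "'v set" and I :: "('v, 'k::field) mpoly set" and p r C +
  fixes t :: nat and b :: "nat \<Rightarrow> nat" and g :: "nat \<Rightarrow> ('v, 'k) mpoly"
    and \<phi> :: "nat \<Rightarrow> nat \<Rightarrow> nat \<Rightarrow> ('v, 'k) mpoly"
  assumes no_linear_forms: "f \<in> I \<Longrightarrow> homogeneous 1 f \<Longrightarrow> f = 0"
    and res: "graded_free_resolution V I b (\<lambda>s j. s + t) g \<phi>"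
begin

text
  \<open>The resolution is extended by the ring itself in position 0, with the row of generators as the first matrix. All steps of the resolution can then be treated alike.\<close>

definition rk :: "nat \<Rightarrow> nat" where
  "rk s = (case s of 0 \<Rightarrow> 1 | Suc s \<Rightarrow> b s)"

definition mat :: "nat \<Rightarrow> nat \<Rightarrow> nat \<Rightarrow> ('v, 'k) mpoly" where
  "mat s = (case s of 0 \<Rightarrow> (\<lambda>i. g) | Suc s \<Rightarrow> \<phi> s)"

lemma g: "j < b 0 \<Longrightarrow> g j \<in> polys V" "j < b 0 \<Longrightarrow> homogeneous t (g j)"
  using res by (auto simp: graded_free_resolution_def)

lemma \<phi>: "i < b s \<Longrightarrow> j < b (Suc s) \<Longrightarrow> \<phi> s i j \<in> polys V"
  "i < b s \<Longrightarrow> j < b (Suc s) \<Longrightarrow> homogeneous 1 (\<phi> s i j)"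
  using res by (auto simp: graded_free_resolution_def homogeneous_def)

lemma I_iff: "f \<in> I \<longleftrightarrow> (\<exists>v\<in>free_module V (b 0). f = (\<Sum>j<b 0. g j * v j))"
  using res by (auto simp: graded_free_resolution_def)

lemma generator_in_I: "j < b 0 \<Longrightarrow> g j \<in> I"
  unfolding I_iff
  by (intro bexI[of _ "\<lambda>i. if i = j then 1 else 0"])
    (auto simp: free_module_def polys_one polys_zero if_distrib cong: if_cong)

lemma mat_polys: "i < rk s \<Longrightarrow> j < rk (Suc s) \<Longrightarrow> mat s i j \<in> polys V"
  by (cases s) (auto simp: rk_def mat_def g \<phi>)

lemma mat_linear: "i < rk (Suc s) \<Longrightarrow> j < rk (Suc (Suc s)) \<Longrightarrow> homogeneous 1 (mat (Suc s) i j)"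
  using \<phi>(2) by (simp add: rk_def mat_def)

lemma kernel_eq_image:
  "mat_apply (rk (Suc s)) (rk (Suc (Suc s))) (mat (Suc s)) ` free_module V (rk (Suc (Suc s))) =
   {v \<in> free_module V (rk (Suc s)). \<forall>i<rk s. (\<Sum>j<rk (Suc s). mat s i j * v j) = 0}"
proof (cases s)
  case 0
  then show ?thesis using res by (simp add: graded_free_resolution_def rk_def mat_def)
next
  case (Suc s')
  have "mat_apply n c N v = (\<lambda>_. 0) \<longleftrightarrow> (\<forall>i<n. (\<Sum>j<c. N i j * v j) = 0)"
    for n c and N :: "nat \<Rightarrow> nat \<Rightarrow> ('v, 'k) mpoly" and v
    by (auto simp: mat_apply_def fun_eq_iff)
  then show ?thesis using res Suc by (simp add: graded_free_resolution_def rk_def mat_def)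
qed

lemma exact:
  assumes "\<And>j. j < rk (Suc s) \<Longrightarrow> v j \<in> polys V"
    "\<And>i. i < rk s \<Longrightarrow> (\<Sum>j<rk (Suc s). mat s i j * v j) = 0"
  obtains u where "\<And>j. u j \<in> polys V"
    "\<And>i. i < rk (Suc s) \<Longrightarrow> v i = (\<Sum>j<rk (Suc (Suc s)). mat (Suc s) i j * u j)"
proof -
  let ?v = "\<lambda>j. if j < rk (Suc s) then v j else 0"
  have "?v \<in> {v \<in> free_module V (rk (Suc s)). \<forall>i<rk s. (\<Sum>j<rk (Suc s). mat s i j * v j) = 0}"
    using assms by (simp add: free_module_def)
  then obtain u where u: "u \<in> free_module V (rk (Suc (Suc s)))"
    "?v = mat_apply (rk (Suc s)) (rk (Suc (Suc s))) (mat (Suc s)) u"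
    unfolding kernel_eq_image[symmetric] by blast
  have "u j \<in> polys V" for j
    using u(1) polys_zero by (cases "j < rk (Suc (Suc s))") (auto simp: free_module_def)
  moreover have "v i = (\<Sum>j<rk (Suc (Suc s)). mat (Suc s) i j * u j)" if "i < rk (Suc s)" for i
    using fun_cong[OF u(2), of i] that by (simp add: mat_apply_def)
  ultimately show thesis using that by blast
qed

lemma complex:
  assumes "\<And>j. u j \<in> polys V" "i < rk s"
  shows "(\<Sum>j<rk (Suc s). mat s i j * (\<Sum>k<rk (Suc (Suc s)). mat (Suc s) j k * u k)) = 0"
proof -
  let ?u = "\<lambda>j. if j < rk (Suc (Suc s)) then u j else 0"
  have "?u \<in> free_module V (rk (Suc (Suc s)))" using assms by (simp add: free_module_def)
  then have "mat_apply (rk (Suc s)) (rk (Suc (Suc s))) (mat (Suc s)) ?u \<in>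
    {v \<in> free_module V (rk (Suc s)). \<forall>i<rk s. (\<Sum>j<rk (Suc s). mat s i j * v j) = 0}"
    unfolding kernel_eq_image[symmetric] by blast
  then show ?thesis using assms(2) by (simp add: mat_apply_def)
qed

definition act :: "nat \<Rightarrow> (nat \<Rightarrow> ('v, 'k) mpoly ext) \<Rightarrow> nat \<Rightarrow> ('v, 'k) mpoly ext" where
  "act s u i = (\<Sum>j<rk (Suc s). escale (mat s i j) (u j))"

lemma act_apply: "act s u i S = (\<Sum>j<rk (Suc s). mat s i j * u j S)"
  by (simp add: act_def sum_fun_apply escale_def)

lemma ediff_act: "ediff r p (act s u i) = act s (\<lambda>j. ediff r p (u j)) i"
  by (simp add: act_def ediff_sum ediff_scale)

lemma act_diff: "act s (\<lambda>j. u j - w j) i = act s u i - act s w i"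
  by (simp add: fun_eq_iff act_apply right_diff_distrib sum_subtractf)

lemma act_act:
  assumes "\<And>j. u j \<in> koszul_polys V r" "i < rk s"
  shows "act s (act (Suc s) u) i = 0"
  using complex[of "\<lambda>j. u j S" i s for S] assms by (auto simp: fun_eq_iff act_apply koszul_polys_def)

lemma act_koszul_polys:
  "(\<And>j. j < rk (Suc s) \<Longrightarrow> u j \<in> koszul_polys V r) \<Longrightarrow> i < rk s \<Longrightarrow> act s u i \<in> koszul_polys V r"
  unfolding act_def using mat_polys by (intro koszul_polys_sum koszul_polys_scale) auto

lemma span_eq: "v \<in> V \<Longrightarrow> (\<Sum>i<r. const (C v i) * p i) = var v"
proof -
  assume v: "v \<in> V"
  have "homogeneous 1 ((\<Sum>i<r. const (C v i) * p i) - var v)"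
    using p_lin by (intro homogeneous_diff homogeneous_sum homogeneous_const_mult homogeneous_var) auto
  then show ?thesis using no_linear_forms[OF span[OF v]] by simp
qed

lemma acyclic:
  assumes "a \<in> koszul_polys V r" "a {} = 0" "ediff r p a = 0"
  obtains c where "c \<in> koszul_polys V r" "c {} = 0" "a = ediff r p c"
proof -
  have "\<exists>c\<in>koszul_polys V r. c {} = 0 \<and> (\<forall>S. (a - ediff r p c) S \<in> {0})"
    by (rule acyclic_mod[OF zero_ideal_poly_ring]) (use assms in \<open>auto simp: coords_def span_eq\<close>)
  then show thesis using that by (auto simp: fun_eq_iff)
qed

text \<open>An element of the maximal ideal is a combination of the variables, hence of the \<open>p i\<close>.\<close>

lemma positive_degree_boundary:
  assumes "f \<in> polys V" "lookup f 0 = 0"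
  obtains c where "c \<in> koszul_polys V r" "c {} = 0" "ediff r p c {} = f"
proof -
  obtain h where h: "\<And>v. h v \<in> polys V" "f = (\<Sum>v\<in>V. var v * h v)"
    using no_constant_term[OF assms fin_V] by blast
  define c where "c S = (\<Sum>i<r. if S = {i} then (\<Sum>v\<in>V. const (C v i) * h v) else 0)" for S
  have c: "c {i} = (\<Sum>v\<in>V. const (C v i) * h v)" if "i < r" for i
    using that by (simp add: c_def eq_commute[of i])
  have "c \<in> koszul_polys V r"
    unfolding koszul_polys_def esupp_def c_def
    by (auto intro!: polys_sum polys_mult polys_const h polys_zero sum.neutral)
  moreover have "c {} = 0" by (simp add: c_def)
  moreover have "ediff r p c {} = (\<Sum>i<r. \<Sum>v\<in>V. const (C v i) * p i * h v)"
    by (simp add: ediff_empty c sum_distrib_left mult_ac)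
  then have "ediff r p c {} = (\<Sum>v\<in>V. (\<Sum>i<r. const (C v i) * p i) * h v)"
    by (subst (asm) sum.swap) (simp add: sum_distrib_right)
  then have "ediff r p c {} = f" by (simp add: span_eq h(2))
  ultimately show thesis using that by blast
qed

text \<open>The diagram chase in the double complex formed by the Koszul complex and the resolution, by
  induction on \<open>q\<close>. The boundary of \<open>u\<close> is a cycle in the kernel of the matrix \<open>s\<close>, so it lifts
  through the next matrix to a chain \<open>u'\<close> of homological degree one less and the same coefficient
  degree. By induction the image of \<open>u'\<close> is the image of a boundary of \<open>w'\<close>; subtracting the image
  of \<open>w'\<close> from \<open>u\<close> gives a genuine cycle, which is a boundary by acyclicity. The coefficient
  degree matters only at the bottom, where \<open>e \<ge> 1\<close> puts \<open>u\<close> into the maximal ideal.\<close>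

lemma boundary_lift:
  assumes "\<And>j. u j \<in> koszul_polys V r" "\<And>j. bihomogeneous q e (u j)" "e \<ge> 1"
    "\<And>i. i < rk s \<Longrightarrow> act s (\<lambda>j. ediff r p (u j)) i = 0"
  shows "\<exists>w. (\<forall>j. w j \<in> koszul_polys V r \<and> w j {} = 0) \<and>
    (\<forall>i<rk s. act s u i = act s (\<lambda>j. ediff r p (w j)) i)"
  using assms
proof (induction q arbitrary: s u)
  case 0
  have const0: "lookup (u j {}) 0 = 0" for j
    using bihomogeneous_coeff[OF 0(2)[of j], of "{}"] \<open>e \<ge> 1\<close> by (force simp: homogeneous_iff)
  have "\<exists>c. c \<in> koszul_polys V r \<and> c {} = 0 \<and> ediff r p c {} = u j {}" for j
    using positive_degree_boundary[OF _ const0] 0(1) by (metis (no_types, lifting) koszul_polys_def mem_Collect_eq)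
  then obtain c where c: "\<And>j. c j \<in> koszul_polys V r" "\<And>j. c j {} = 0" "\<And>j. ediff r p (c j) {} = u j {}"
    by metis
  \<comment>
    \<open>Only the values at singletons contribute to the coefficient at the empty set; without the other values the boundary has no further coefficients.\<close>
  define w where "w j S = (if card S = 1 then c j S else 0)" for j S
  have w: "w j \<in> koszul_polys V r" "w j {} = 0" for j
    using c(1)[of j] by (auto simp: koszul_polys_def esupp_def w_def polys_zero)
  have u0: "u j S = 0" if "S \<noteq> {}" for j S
  proof (rule ccontr)
    assume "u j S \<noteq> 0"
    then have "card S = 0" "S \<subseteq> {..<r}"
      using 0(1)[of j] 0(2)[of j] by (auto simp: koszul_polys_def bihomogeneous_def dest: esuppD)
    then show False using that finite_subset[of S "{..<r}"] by simp
  qed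
  have "u j = ediff r p (w j)" for j
  proof
    fix S
    show "u j S = ediff r p (w j) S"
    proof (cases "S = {}")
      case True
      then show ?thesis using c(3)[of j] by (simp add: ediff_empty w_def)
    next
      case False
      have "card (insert i S) \<noteq> 1" if "i \<notin> S" for i
        using that False by (auto simp: card_1_singleton_iff)
      then show ?thesis using False by (simp add: u0 ediff_def contract_def w_def cong: if_cong)
    qed
  qed
  then show ?case using w by (intro exI[of _ w]) simp
next
  case (Suc q)
  let ?R = "rk (Suc s)"
  have du: "ediff r p (u j) \<in> koszul_polys V r" for j
    using Suc.prems(1) p by (intro koszul_polys_ediff)
  have du_bi: "bihomogeneous q (Suc e) (ediff r p (u j))" for j
    using Suc.prems(1,2) p_lin by (intro bihomogeneous_ediff) (auto simp: koszul_polys_def)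
  have img: "\<exists>v. (\<forall>j. v j \<in> polys V) \<and>
      (\<forall>i<?R. ediff r p (u i) S = (\<Sum>j<rk (Suc (Suc s)). mat (Suc s) i j * v j))" for S
  proof -
    have "(\<Sum>j<?R. mat s i j * ediff r p (u j) S) = 0" if "i < rk s" for i
      using fun_cong[OF Suc.prems(4)[OF that], of S] by (simp add: act_apply)
    moreover have "ediff r p (u j) S \<in> polys V" for j
      using du[of j] by (simp add: koszul_polys_def)
    ultimately obtain v where "\<And>j. v j \<in> polys V"
      "\<And>i. i < ?R \<Longrightarrow> ediff r p (u i) S = (\<Sum>j<rk (Suc (Suc s)). mat (Suc s) i j * v j)"
      using exact[of s "\<lambda>j. ediff r p (u j) S"] by blast
    then show ?thesis by blast
  qed
  obtain u' where u': "\<And>j. u' j \<in> koszul_polys V r" "\<And>j. bihomogeneous q (Suc e - 1) (u' j)"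
    "\<And>i. i < ?R \<Longrightarrow> ediff r p (u i) = (\<Sum>j<rk (Suc (Suc s)). escale (mat (Suc s) i j) (u' j))"
    using lift_through_matrix[of ?R "\<lambda>i. ediff r p (u i)" V r q "Suc e" "rk (Suc (Suc s))" 1 "mat (Suc s)"]
      du du_bi mat_linear img by auto
  have du_act: "ediff r p (u i) = act (Suc s) u' i" if "i < ?R" for i
    using u'(3)[OF that] by (simp add: act_def)
  have "act (Suc s) (\<lambda>j. ediff r p (u' j)) i = 0" if "i < ?R" for i
    unfolding ediff_act[symmetric] du_act[OF that, symmetric] by (rule ediff_ediff)
  then have "\<exists>w. (\<forall>j. w j \<in> koszul_polys V r \<and> w j {} = 0) \<and>
      (\<forall>i<?R. act (Suc s) u' i = act (Suc s) (\<lambda>j. ediff r p (w j)) i)"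
    using u'(1,2) \<open>e \<ge> 1\<close> by (intro Suc.IH) auto
  then obtain w' where w': "\<And>j. w' j \<in> koszul_polys V r" "\<And>j. w' j {} = 0"
    "\<And>i. i < ?R \<Longrightarrow> act (Suc s) u' i = act (Suc s) (\<lambda>j. ediff r p (w' j)) i"
    by blast
  have "\<exists>c. c \<in> koszul_polys V r \<and> c {} = 0 \<and> u i - act (Suc s) w' i = ediff r p c" if i: "i < ?R" for i
  proof -
    have 1: "u i - act (Suc s) w' i \<in> koszul_polys V r"
      using Suc.prems(1) w' i by (intro koszul_polys_diff act_koszul_polys)
    have "u i {} = 0" using Suc.prems(2)[of i] by (force simp: bihomogeneous_def)
    then have 2: "(u i - act (Suc s) w' i) {} = 0" by (simp add: act_apply w')
    have 3: "ediff r p (u i - act (Suc s) w' i) = 0"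
      unfolding ediff_diff ediff_act du_act[OF i] w'(3)[OF i] by simp
    show ?thesis using acyclic[OF 1 2 3] by metis
  qed
  then obtain c where c: "\<And>i. i < ?R \<Longrightarrow> c i \<in> koszul_polys V r" "\<And>i. i < ?R \<Longrightarrow> c i {} = 0"
    "\<And>i. i < ?R \<Longrightarrow> u i - act (Suc s) w' i = ediff r p (c i)"
    by metis
  define w where "w i = (if i < ?R then c i else 0)" for i
  have "w i \<in> koszul_polys V r \<and> w i {} = 0" for i
    using c(1,2) by (simp add: w_def koszul_polys_zero)
  moreover have "act s u i = act s (\<lambda>j. ediff r p (w j)) i" if i: "i < rk s" for i
  proof -
    have "act s (\<lambda>j. ediff r p (w j)) i = act s (\<lambda>j. u j - act (Suc s) w' j) i"
      unfolding act_def[of s] by (intro sum.cong refl) (simp add: w_def c(3)[symmetric])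
    then show ?thesis using act_act[OF w'(1) i] by (simp add: act_diff)
  qed
  ultimately show ?case by blast
qed

text \<open>The boundary of \<open>a\<close> has coefficients of degree \<open>e + 1\<close> in \<open>I\<close>. If \<open>e + 1 < t\<close>, it is zero
  because \<open>I\<close> starts in degree \<open>t\<close>; otherwise it lifts to a chain with coefficients of degree
  \<open>e + 1 - t \<ge> 1\<close>, to which \<open>boundary_lift\<close> applies.\<close>

theorem koszul_concentrated:
  assumes a: "a \<in> koszul_polys V r" "bihomogeneous q e a" "q \<ge> 1" "e + 1 \<noteq> t"
    "\<And>S. ediff r p a S \<in> I"
  shows "\<exists>c\<in>koszul_polys V r. \<forall>S. (a - ediff r p c) S \<in> I"
proof -
  obtain q' where q: "q = Suc q'" using \<open>q \<ge> 1\<close> by (cases q) auto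
  have a0: "a {} = 0" using a(2) q by (force simp: bihomogeneous_def)
  have da: "ediff r p a \<in> koszul_polys V r" using a(1) p by (intro koszul_polys_ediff)
  have da_bi: "bihomogeneous q' (Suc e) (ediff r p a)"
    using a(1,2) p_lin q by (intro bihomogeneous_ediff) (auto simp: koszul_polys_def)
  have img: "\<exists>u. (\<forall>j. u j \<in> polys V) \<and> (\<forall>i<1. ediff r p a S = (\<Sum>j<b 0. mat 0 i j * u j))" for S
  proof -
    obtain v where v: "v \<in> free_module V (b 0)" "ediff r p a S = (\<Sum>j<b 0. g j * v j)"
      using a(5) I_iff by blast
    have "v j \<in> polys V" for j
      using v(1) polys_zero by (cases "j < b 0") (auto simp: free_module_def)
    then show ?thesis using v(2) by (auto simp: mat_def)
  qed
  show ?thesis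
  proof (cases "t \<le> Suc e")
    case False
    have "ediff r p a S = 0" for S
    proof -
      obtain u where "ediff r p a S = (\<Sum>j<b 0. g j * u j)" using img[of S] by (auto simp: mat_def)
      then have "hcomp (Suc e) (ediff r p a S) = (\<Sum>j<b 0. hcomp (Suc e) (g j * u j))"
        by (simp add: hcomp_sum)
      also have "\<dots> = 0" using False by (intro sum.neutral) (auto simp: hcomp_mult[OF g(2)])
      finally show ?thesis
        using hcomp_homogeneous[OF bihomogeneous_coeff[OF da_bi], of "Suc e" S] by simp
    qed
    then have "ediff r p a = 0" by auto
    then obtain c where "c \<in> koszul_polys V r" "a = ediff r p c"
      using acyclic[OF a(1) a0] by blast
    then show ?thesis using ideal_zero[OF I] by (intro bexI[of _ c]) auto
  next
    case True
    obtain u where u: "\<And>j. u j \<in> koszul_polys V r" "\<And>j. bihomogeneous q' (Suc e - t) (u j)"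
      "\<And>i. i < 1 \<Longrightarrow> ediff r p a = (\<Sum>j<b 0. escale (mat 0 i j) (u j))"
      using lift_through_matrix[of 1 "\<lambda>i. ediff r p a" V r q' "Suc e" "b 0" t "mat 0"]
        da da_bi img True g(2) by (auto simp: mat_def)
    have da_act: "ediff r p a = act 0 u 0"
      using u(3)[of 0] by (simp add: act_def rk_def)
    have "act 0 (\<lambda>j. ediff r p (u j)) i = 0" if "i < rk 0" for i
      using that ediff_ediff[of r p a] unfolding da_act ediff_act by (simp add: rk_def)
    moreover have "Suc e - t \<ge> 1" using True a(4) by simp
    ultimately have "\<exists>w. (\<forall>j. w j \<in> koszul_polys V r \<and> w j {} = 0) \<and>
        (\<forall>i<rk 0. act 0 u i = act 0 (\<lambda>j. ediff r p (w j)) i)"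
      using u(1,2) by (intro boundary_lift[of u q' "Suc e - t" 0])
    then obtain w where w: "\<And>j. w j \<in> koszul_polys V r" "\<And>j. w j {} = 0"
      "act 0 u 0 = act 0 (\<lambda>j. ediff r p (w j)) 0"
      by (auto simp: rk_def)
    have 1: "a - act 0 w 0 \<in> koszul_polys V r"
      using a(1) w by (intro koszul_polys_diff act_koszul_polys) (auto simp: rk_def)
    have 2: "(a - act 0 w 0) {} = 0" by (simp add: a0 act_apply w)
    have 3: "ediff r p (a - act 0 w 0) = 0"
      unfolding ediff_diff ediff_act da_act w(3) by simp
    obtain c where c: "c \<in> koszul_polys V r" "a - act 0 w 0 = ediff r p c"
      using acyclic[OF 1 2 3] by blast
    have "(a - ediff r p c) S \<in> I" for S
    proof -
      have "(a - ediff r p c) S = (\<Sum>j<b 0. g j * w j S)"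
        unfolding c(2)[symmetric] by (simp add: act_apply rk_def mat_def)
      then show ?thesis
        using w(1) generator_in_I by (auto simp: koszul_polys_def intro!: ideal_sum[OF I] ideal_mult'[OF I])
    qed
    then show ?thesis using c(1) by blast
  qed
qed

end

section \<open>Lifting the Koszul complex of the quotient ring\<close>

text \<open>The relation to the Koszul complex of the quotient ring: \<open>rmap\<close> takes residues of all
  coefficients. It is surjective and commutes with all operations, and its kernel consists of the
  elements with values in \<open>I\<close>. So cycles, boundaries and homology classes can be handled by
  polynomial representatives.\<close>

locale koszul_quotient =
  fixes V :: "'v set" and I :: "('v, 'k::field) mpoly set" and p :: "nat \<Rightarrow> ('v, 'k) mpoly"
    and xs :: "('v, 'k) mpoly set list"
  assumes I: "ideal I (poly_ring V)"
    and p: "i < length xs \<Longrightarrow> p i \<in> polys V"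
    and xs: "i < length xs \<Longrightarrow> xs ! i = residue V I (p i)"
begin

abbreviation r :: nat where "r \<equiv> length xs"
abbreviation Q :: "('v, 'k) mpoly set ring" where "Q \<equiv> quotient_ring V I"
abbreviation K :: "(nat set \<Rightarrow> ('v, 'k) mpoly set) ring" where "K \<equiv> koszul Q xs"
abbreviation res :: "('v, 'k) mpoly \<Rightarrow> ('v, 'k) mpoly set" where "res \<equiv> residue V I"
abbreviation KP :: "('v, 'k) mpoly ext set" where "KP \<equiv> koszul_polys V r"
abbreviation d :: "('v, 'k) mpoly ext \<Rightarrow> ('v, 'k) mpoly ext" where "d \<equiv> ediff r p"

lemma Q_cring: "cring Q"
  unfolding quotient_ring_def by (rule ideal.quotient_is_cring[OF I poly_ring_cring])

lemma res_ring_hom: "res \<in> ring_hom (poly_ring V) Q"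
  using ideal.rcos_ring_hom[OF I] by (simp add: residue_def[abs_def] quotient_ring_def)

lemma carrier_Q: "carrier Q = res ` polys V"
  by (auto simp: quotient_ring_def FactRing_def A_RCOSETS_def' residue_def)

lemma res_closed: "f \<in> polys V \<Longrightarrow> res f \<in> carrier Q"
  by (simp add: carrier_Q)

lemma res_add: "f \<in> polys V \<Longrightarrow> g \<in> polys V \<Longrightarrow> res (f + g) = res f \<oplus>\<^bsub>Q\<^esub> res g"
  using ring_hom_add[OF res_ring_hom, of f g] by simp

lemma res_mult: "f \<in> polys V \<Longrightarrow> g \<in> polys V \<Longrightarrow> res (f * g) = res f \<otimes>\<^bsub>Q\<^esub> res g"
  using ring_hom_mult[OF res_ring_hom, of f g] by simp

lemma res_one: "res 1 = \<one>\<^bsub>Q\<^esub>"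
  using ring_hom_one[OF res_ring_hom] by simp

lemma res_zero: "res 0 = \<zero>\<^bsub>Q\<^esub>"
  using ring_hom_zero[OF res_ring_hom cring.axioms(1)[OF poly_ring_cring] cring.axioms(1)[OF Q_cring]]
  by simp

lemma res_uminus: "f \<in> polys V \<Longrightarrow> res (- f) = \<ominus>\<^bsub>Q\<^esub> res f"
proof -
  assume f: "f \<in> polys V"
  interpret Q: cring Q by (rule Q_cring)
  have "res (- f) \<oplus>\<^bsub>Q\<^esub> res f = \<zero>\<^bsub>Q\<^esub>"
    using f by (simp add: polys_uminus flip: res_add res_zero)
  then show ?thesis using f by (simp add: Q.sum_zero_eq_neg res_closed polys_uminus)
qed

lemma res_eq_iff: "f \<in> polys V \<Longrightarrow> g \<in> polys V \<Longrightarrow> res f = res g \<longleftrightarrow> f - g \<in> I"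
proof -
  assume f: "f \<in> polys V" and g: "g \<in> polys V"
  have "f - g = f \<ominus>\<^bsub>poly_ring V\<^esub> g" by (simp add: a_minus_def poly_ring_a_minus g)
  then show ?thesis
    using ring.quotient_eq_iff_same_a_r_cos[OF cring.axioms(1)[OF poly_ring_cring] I f g]
    by (simp add: residue_def)
qed

lemma res_eq_zero_iff: "f \<in> polys V \<Longrightarrow> res f = \<zero>\<^bsub>Q\<^esub> \<longleftrightarrow> f \<in> I"
  using res_eq_iff[of f 0] by (simp add: polys_zero res_zero)

lemma res_sum: "(\<And>i. i \<in> A \<Longrightarrow> f i \<in> polys V) \<Longrightarrow> res (\<Sum>i\<in>A. f i) = (\<Oplus>\<^bsub>Q\<^esub>i\<in>A. res (f i))"
proof -
  interpret Q: cring Q by (rule Q_cring)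
  show "(\<And>i. i \<in> A \<Longrightarrow> f i \<in> polys V) \<Longrightarrow> res (\<Sum>i\<in>A. f i) = (\<Oplus>\<^bsub>Q\<^esub>i\<in>A. res (f i))"
    by (induction A rule: infinite_finite_induct)
      (simp_all add: Q.finsum_infinite res_zero res_add polys_sum Q.finsum_insert Pi_iff res_closed)
qed

lemma res_sgn: "f \<in> polys V \<Longrightarrow> res ((-1) ^ k * f) = sgn_mult Q k (res f)"
  by (auto simp: sgn_mult_def res_uminus)

definition rmap :: "('v, 'k) mpoly ext \<Rightarrow> nat set \<Rightarrow> ('v, 'k) mpoly set" where
  "rmap a = (\<lambda>S. res (a S))"

lemma KP_polys: "a \<in> KP \<Longrightarrow> a S \<in> polys V"
  by (simp add: koszul_polys_def)

lemma rmap_eq_iff: "a \<in> KP \<Longrightarrow> b \<in> KP \<Longrightarrow> rmap a = rmap b \<longleftrightarrow> (\<forall>S. (a - b) S \<in> I)"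
  by (simp add: rmap_def fun_eq_iff res_eq_iff KP_polys)

text \<open>Residues are lifted coefficient by coefficient; outside the subsets of \<open>{..<r}\<close> the lift has
  to be 0.\<close>

lemma carrier_K: "carrier K = rmap ` KP"
proof
  show "rmap ` KP \<subseteq> carrier K"
    by (auto simp: koszul_def rmap_def carrier_Q koszul_polys_def esupp_def res_zero)
  show "carrier K \<subseteq> rmap ` KP"
  proof
    fix z assume z: "z \<in> carrier K"
    then have "z S \<in> res ` polys V" for S
      by (simp add: koszul_def carrier_Q)
    then have "\<exists>f. f \<in> polys V \<and> z S = res f" for S by blast
    then obtain f where f: "\<And>S. f S \<in> polys V" "\<And>S. z S = res (f S)" by metis
    define a where "a S = (if S \<subseteq> {..<r} then f S else 0)" for S
    have "a \<in> KP" using f by (auto simp: koszul_polys_def esupp_def a_def polys_zero)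
    moreover have "z = rmap a"
      using z f by (auto simp: koszul_def rmap_def a_def fun_eq_iff res_zero)
    ultimately show "z \<in> rmap ` KP" by blast
  qed
qed

lemma rmap_zero: "rmap 0 = \<zero>\<^bsub>K\<^esub>"
  by (simp add: koszul_def rmap_def res_zero)

lemma rmap_one: "rmap eone = \<one>\<^bsub>K\<^esub>"
  by (auto simp: koszul_def rmap_def res_zero res_one eone_def fun_eq_iff)

lemma eone_KP: "eone \<in> KP"
  by (auto simp: koszul_polys_def esupp_def eone_def polys_zero polys_one)

lemma rmap_add: "a \<in> KP \<Longrightarrow> b \<in> KP \<Longrightarrow> rmap (a + b) = rmap a \<oplus>\<^bsub>K\<^esub> rmap b"
  by (simp add: koszul_def rmap_def res_add KP_polys)

lemma rmap_emul:
  assumes "a \<in> KP" "b \<in> KP"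
  shows "rmap (emul a b) = rmap a \<otimes>\<^bsub>K\<^esub> rmap b"
proof
  fix U
  interpret Q: cring Q by (rule Q_cring)
  have "res (emul a b U) = (\<Oplus>\<^bsub>Q\<^esub>S\<in>Pow U. res (shuffle_sign S (U - S) * (a S * b (U - S))))"
    unfolding emul_def
    by (intro res_sum polys_mult polys_shuffle_sign KP_polys[OF assms(1)] KP_polys[OF assms(2)])
  also have "\<dots> = (\<Oplus>\<^bsub>Q\<^esub>S\<in>Pow U. sgn_mult Q (card {(s, t). s \<in> S \<and> t \<in> U - S \<and> t < s})
      (res (a S) \<otimes>\<^bsub>Q\<^esub> res (b (U - S))))"
    using assms by (simp add: shuffle_sign_def res_sgn polys_mult KP_polys flip: res_mult)
  finally show "rmap (emul a b) U = (rmap a \<otimes>\<^bsub>K\<^esub> rmap b) U"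
    by (simp add: koszul_def rmap_def)
qed

lemma rmap_ediff:
  assumes "a \<in> KP"
  shows "rmap (d a) = koszul_diff Q xs (rmap a)"
proof
  fix T
  interpret Q: cring Q by (rule Q_cring)
  have sgn: "shuffle_sign {i} T = ((-1) ^ card {j \<in> T. j < i} :: ('v, 'k) mpoly)" for i
  proof -
    have "{(s, t). s \<in> {i} \<and> t \<in> T \<and> t < s} = {i} \<times> {j \<in> T. j < i}" by auto
    then show ?thesis unfolding shuffle_sign_def by (simp add: card_cartesian_product)
  qed
  have "d a T = (\<Sum>i\<in>{..<r} - T. (-1) ^ card {j \<in> T. j < i} * (p i * a (insert i T)))"
    unfolding ediff_def contract_def
    by (rule sum.mono_neutral_cong_right) (auto simp: sgn mult.left_commute)
  also have "res \<dots> = (\<Oplus>\<^bsub>Q\<^esub>i\<in>{..<r} - T. res ((-1) ^ card {j \<in> T. j < i} * (p i * a (insert i T))))"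
    using p by (intro res_sum polys_mult polys_sign KP_polys[OF assms]) auto
  also have "\<dots> = (\<Oplus>\<^bsub>Q\<^esub>i\<in>{..<r} - T.
      sgn_mult Q (card {j \<in> T. j < i}) (xs ! i \<otimes>\<^bsub>Q\<^esub> res (a (insert i T))))"
  proof (rule Q.finsum_cong')
    show "(\<lambda>i. sgn_mult Q (card {j \<in> T. j < i}) (xs ! i \<otimes>\<^bsub>Q\<^esub> res (a (insert i T))))
        \<in> {..<r} - T \<rightarrow> carrier Q"
      using KP_polys[OF assms] p
      by (auto simp: xs polys_mult polys_sign intro!: res_closed simp flip: res_mult res_sgn)
    show "res ((-1) ^ card {j \<in> T. j < i} * (p i * a (insert i T))) =
        sgn_mult Q (card {j \<in> T. j < i}) (xs ! i \<otimes>\<^bsub>Q\<^esub> res (a (insert i T)))"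
      if "i \<in> {..<r} - T" for i
      using KP_polys[OF assms] p that by (simp add: res_sgn xs polys_mult res_mult)
  qed simp
  finally show "rmap (d a) T = koszul_diff Q xs (rmap a) T"
    by (simp add: rmap_def koszul_diff_def)
qed

lemma rmap_ebar: "a \<in> KP \<Longrightarrow> rmap (ebar a) = koszul_bar Q (rmap a)"
  by (simp add: koszul_bar_def rmap_def ebar_def res_sgn KP_polys del: power_Suc)

lemma KP_d: "a \<in> KP \<Longrightarrow> d a \<in> KP"
  by (rule koszul_polys_ediff) (use p in auto)

lemma KP_uminus: "a \<in> KP \<Longrightarrow> - a \<in> KP"
  using koszul_polys_diff[OF koszul_polys_zero] by fastforce

lemma emul_eone:
  assumes "a \<in> KP" shows "emul eone a = a" "emul a eone = a"
proof -
  have 0: "a U = 0" if "infinite U" for U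
    using assms that finite_subset[of U "{..<r}"] by (auto simp: koszul_polys_def dest: esuppD)
  have "emul eone a U = a U" for U
    using emul_degree_0_left[of U 1 a] 0[of U] by (cases "finite U") (simp_all add: eone_def emul_infinite)
  then show "emul eone a = a" by auto
  have "emul a eone U = a U" for U
    using emul_degree_0_right[of U a 1] 0[of U] by (cases "finite U") (simp_all add: eone_def emul_infinite)
  then show "emul a eone = a" by auto
qed

lemmas K_simps = carrier_K rmap_add[symmetric] rmap_emul[symmetric] rmap_zero[symmetric]
  rmap_one[symmetric] koszul_polys_add koszul_polys_emul

lemma K_ring: "ring K"
proof (rule ringI)
  show "abelian_group K"
  proof (rule abelian_groupI)
    fix z assume "z \<in> carrier K"
    then obtain a where "a \<in> KP" "z = rmap a" by (auto simp: carrier_K)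
    then show "\<exists>y\<in>carrier K. y \<oplus>\<^bsub>K\<^esub> z = \<zero>\<^bsub>K\<^esub>"
      using KP_uminus[of a] by (intro bexI[of _ "rmap (- a)"]) (simp_all add: K_simps)
  qed (auto simp: K_simps koszul_polys_zero add_ac)
  show "monoid K"
    by (rule monoidI) (auto simp: K_simps eone_KP emul_eone emul_assoc)
qed (auto simp: K_simps emul_add_left emul_add_right)

definition ideal_valued :: "('v, 'k) mpoly ext set" where
  "ideal_valued = {a. \<forall>S. a S \<in> I}"

text \<open>The lifts of the cycles over the quotient ring, which are cycles only modulo \<open>I\<close>; similarly
  for the boundaries.\<close>

definition cycle_lifts :: "('v, 'k) mpoly ext set" where
  "cycle_lifts = {a \<in> KP. d a \<in> ideal_valued}"

definition boundary_lifts :: "('v, 'k) mpoly ext set" where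
  "boundary_lifts = {a \<in> KP. \<exists>b\<in>KP. a - d b \<in> ideal_valued}"

lemma ideal_valued_zero: "0 \<in> ideal_valued"
  by (simp add: ideal_valued_def ideal_zero[OF I])

lemma ideal_valued_add: "a \<in> ideal_valued \<Longrightarrow> b \<in> ideal_valued \<Longrightarrow> a + b \<in> ideal_valued"
  by (simp add: ideal_valued_def ideal_add[OF I])

lemma ideal_valued_uminus: "a \<in> ideal_valued \<Longrightarrow> - a \<in> ideal_valued"
  by (simp add: ideal_valued_def ideal_uminus[OF I])

lemma ideal_valued_diff: "a \<in> ideal_valued \<Longrightarrow> b \<in> ideal_valued \<Longrightarrow> a - b \<in> ideal_valued"
  by (simp add: ideal_valued_def ideal_diff[OF I])

lemma ideal_valued_sum: "(\<And>i. i \<in> A \<Longrightarrow> f i \<in> ideal_valued) \<Longrightarrow> (\<Sum>i\<in>A. f i) \<in> ideal_valued"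
  by (simp add: ideal_valued_def sum_fun_apply ideal_sum[OF I])

lemma ideal_valued_scale: "a \<in> ideal_valued \<Longrightarrow> c \<in> polys V \<Longrightarrow> escale c a \<in> ideal_valued"
  by (simp add: ideal_valued_def escale_def ideal_mult[OF I])

lemma ideal_valued_emul_left:
  assumes "a \<in> ideal_valued" "b \<in> KP"
  shows "emul a b \<in> ideal_valued"
proof -
  have "a S \<in> I" "b S \<in> polys V" for S using assms by (auto simp: ideal_valued_def KP_polys)
  then show ?thesis
    by (simp add: ideal_valued_def emul_def ideal_sum[OF I] ideal_mult[OF I] ideal_mult'[OF I] polys_shuffle_sign)
qed

lemma ideal_valued_emul_right:
  assumes "b \<in> ideal_valued" "a \<in> KP"
  shows "emul a b \<in> ideal_valued"
proof -
  have "b S \<in> I" "a S \<in> polys V" for S using assms by (auto simp: ideal_valued_def KP_polys)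
  then show ?thesis
    by (simp add: ideal_valued_def emul_def ideal_sum[OF I] ideal_mult[OF I] polys_shuffle_sign)
qed

lemma ideal_valued_ebar: "a \<in> ideal_valued \<Longrightarrow> ebar a \<in> ideal_valued"
  by (simp add: ideal_valued_def ebar_def ideal_mult[OF I] polys_sign del: power_Suc)

lemma ideal_valued_d:
  assumes "a \<in> ideal_valued"
  shows "d a \<in> ideal_valued"
proof -
  have "a S \<in> I" for S using assms by (auto simp: ideal_valued_def)
  then have "contract i a T \<in> I" for i T
    by (simp add: contract_def ideal_zero[OF I] ideal_mult[OF I] polys_shuffle_sign)
  then show ?thesis
    using p by (auto simp: ideal_valued_def ediff_def intro!: ideal_sum[OF I] ideal_mult[OF I])
qed

lemma rmap_eq_iff': "a \<in> KP \<Longrightarrow> b \<in> KP \<Longrightarrow> rmap a = rmap b \<longleftrightarrow> a - b \<in> ideal_valued"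
  by (simp add: rmap_eq_iff ideal_valued_def)

lemma cycles_eq: "koszul_cycles Q xs = rmap ` cycle_lifts"
proof -
  have "koszul_diff Q xs (rmap a) = \<zero>\<^bsub>K\<^esub> \<longleftrightarrow> d a \<in> ideal_valued" if "a \<in> KP" for a
    using rmap_eq_iff'[OF KP_d[OF that] koszul_polys_zero] that by (simp add: rmap_ediff rmap_zero)
  then show ?thesis by (auto simp: koszul_cycles_def carrier_K cycle_lifts_def)
qed

lemma boundaries_eq: "koszul_boundaries Q xs = rmap ` boundary_lifts"
proof -
  have "koszul_boundaries Q xs = (\<lambda>b. rmap (d b)) ` KP"
    by (auto simp: koszul_boundaries_def carrier_K rmap_ediff image_iff)
  also have "\<dots> = rmap ` boundary_lifts"
  proof (intro equalityI subsetI)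
    fix z assume "z \<in> (\<lambda>b. rmap (d b)) ` KP"
    then obtain b where b: "b \<in> KP" "z = rmap (d b)" by blast
    then have "d b \<in> boundary_lifts" by (auto simp: boundary_lifts_def KP_d ideal_valued_zero intro!: bexI[of _ b])
    then show "z \<in> rmap ` boundary_lifts" using b by blast
  next
    fix z assume "z \<in> rmap ` boundary_lifts"
    then obtain a b where "a \<in> KP" "z = rmap a" "b \<in> KP" "a - d b \<in> ideal_valued" by (auto simp: boundary_lifts_def)
    then have "z = rmap (d b)" by (simp add: rmap_eq_iff' KP_d)
    then show "z \<in> (\<lambda>b. rmap (d b)) ` KP" using \<open>b \<in> KP\<close> by blast
  qed
  finally show ?thesis .
qed

lemma cycle_lifts_KP: "a \<in> cycle_lifts \<Longrightarrow> a \<in> KP" and boundary_lifts_KP: "a \<in> boundary_lifts \<Longrightarrow> a \<in> KP"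
  by (auto simp: cycle_lifts_def boundary_lifts_def)

lemma d_ebar: "a \<in> KP \<Longrightarrow> d (ebar a) = - ebar (d a)"
proof
  fix T assume a: "a \<in> KP"
  show "d (ebar a) T = (- ebar (d a)) T"
  proof (cases "finite T")
    case False
    then have T: "\<not> T \<subseteq> {..<r}" using finite_subset by blast
    have "d (ebar a) T = 0" "ebar (d a) T = 0"
      using a T by (auto simp: koszul_polys_def intro!: esuppD[OF _ T] esupp_ediff esupp_ebar)
    then show ?thesis by simp
  qed (simp add: ediff_ebar)
qed

lemma boundary_lifts_subset_cycle_lifts: "boundary_lifts \<subseteq> cycle_lifts"
proof
  fix a assume "a \<in> boundary_lifts"
  then obtain b where b: "a \<in> KP" "b \<in> KP" "a - d b \<in> ideal_valued" by (auto simp: boundary_lifts_def)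
  have "d (a - d b) = d a" unfolding ediff_diff ediff_ediff by simp
  then show "a \<in> cycle_lifts" using ideal_valued_d[OF b(3)] b(1) by (simp add: cycle_lifts_def)
qed

lemma cycle_lifts_add: "a \<in> cycle_lifts \<Longrightarrow> b \<in> cycle_lifts \<Longrightarrow> a + b \<in> cycle_lifts"
  unfolding cycle_lifts_def mem_Collect_eq ediff_add by (blast intro: koszul_polys_add ideal_valued_add)

lemma cycle_lifts_uminus: "a \<in> cycle_lifts \<Longrightarrow> - a \<in> cycle_lifts"
  unfolding cycle_lifts_def mem_Collect_eq ediff_minus by (blast intro: KP_uminus ideal_valued_uminus)

lemma cycle_lifts_scale: "a \<in> cycle_lifts \<Longrightarrow> c \<in> polys V \<Longrightarrow> escale c a \<in> cycle_lifts"
  unfolding cycle_lifts_def mem_Collect_eq ediff_scale by (blast intro: koszul_polys_scale ideal_valued_scale)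

lemma cycle_lifts_emul: "a \<in> cycle_lifts \<Longrightarrow> b \<in> cycle_lifts \<Longrightarrow> emul a b \<in> cycle_lifts"
  unfolding cycle_lifts_def mem_Collect_eq ediff_emul
  by (blast intro: koszul_polys_emul koszul_polys_ebar ideal_valued_diff ideal_valued_emul_left ideal_valued_emul_right)

lemma d_degree_0: "d (\<lambda>S. if S = {} then f else 0) = 0"
  by (simp add: ediff_def contract_def fun_eq_iff cong: if_cong)

lemma cycle_lifts_degree_0: "f \<in> polys V \<Longrightarrow> (\<lambda>S. if S = {} then f else 0) \<in> cycle_lifts"
  unfolding cycle_lifts_def mem_Collect_eq d_degree_0
  by (auto simp: koszul_polys_def esupp_def polys_zero ideal_valued_zero)

lemma cycle_lifts_eone: "eone \<in> cycle_lifts"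
  unfolding eone_def by (rule cycle_lifts_degree_0[OF polys_one])

lemma boundary_lifts_zero: "0 \<in> boundary_lifts"
  using ideal_valued_zero by (auto simp: boundary_lifts_def koszul_polys_zero intro!: bexI[of _ 0])

lemma boundary_lifts_add: "a \<in> boundary_lifts \<Longrightarrow> b \<in> boundary_lifts \<Longrightarrow> a + b \<in> boundary_lifts"
proof -
  assume "a \<in> boundary_lifts" "b \<in> boundary_lifts"
  then obtain u v where uv: "a \<in> KP" "b \<in> KP" "u \<in> KP" "v \<in> KP" "a - d u \<in> ideal_valued" "b - d v \<in> ideal_valued"
    by (auto simp: boundary_lifts_def)
  have "a + b - d (u + v) = (a - d u) + (b - d v)" unfolding ediff_add by (simp add: algebra_simps)
  also have "\<dots> \<in> ideal_valued" by (rule ideal_valued_add[OF uv(5,6)])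
  finally show ?thesis unfolding boundary_lifts_def using uv koszul_polys_add by blast
qed

lemma boundary_lifts_scale: "a \<in> boundary_lifts \<Longrightarrow> c \<in> polys V \<Longrightarrow> escale c a \<in> boundary_lifts"
proof -
  assume "a \<in> boundary_lifts" and c: "c \<in> polys V"
  then obtain u where u: "a \<in> KP" "u \<in> KP" "a - d u \<in> ideal_valued"
    by (auto simp: boundary_lifts_def)
  have "escale c a - d (escale c u) = escale c (a - d u)"
    unfolding ediff_scale by (simp add: escale_def fun_eq_iff right_diff_distrib)
  also have "\<dots> \<in> ideal_valued" by (rule ideal_valued_scale[OF u(3) c])
  finally show ?thesis unfolding boundary_lifts_def using u c koszul_polys_scale by blast
qed

lemma boundary_lifts_uminus: "a \<in> boundary_lifts \<Longrightarrow> - a \<in> boundary_lifts"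
  using boundary_lifts_scale[of a "- 1"] polys_uminus[OF polys_one, of V] by (simp add: escale_def fun_Compl_def)

text \<open>By the Leibniz rule, \<open>a (d u)\<close> is the boundary of \<open>- (ebar a) u\<close> up to a product with \<open>d a\<close>,
  which has values in \<open>I\<close>.\<close>

lemma boundary_lifts_emul_left: "a \<in> cycle_lifts \<Longrightarrow> b \<in> boundary_lifts \<Longrightarrow> emul a b \<in> boundary_lifts"
proof -
  assume a: "a \<in> cycle_lifts" and "b \<in> boundary_lifts"
  then obtain u where u: "b \<in> KP" "u \<in> KP" "b - d u \<in> ideal_valued"
    by (auto simp: boundary_lifts_def)
  have aK: "a \<in> KP" "d a \<in> ideal_valued" using a by (auto simp: cycle_lifts_def)
  have "emul a b - d (- emul (ebar a) u) = emul a (b - d u) - emul (ebar (d a)) u"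
    unfolding ediff_minus ediff_emul d_ebar[OF aK(1)] emul_minus_left emul_diff_right ebar_ebar
    by (simp add: algebra_simps)
  also have "\<dots> \<in> ideal_valued"
    by (intro ideal_valued_diff ideal_valued_emul_right ideal_valued_emul_left ideal_valued_ebar u aK)
  finally show ?thesis
    unfolding boundary_lifts_def using aK u koszul_polys_emul koszul_polys_ebar KP_uminus by blast
qed

lemma boundary_lifts_emul_right: "a \<in> cycle_lifts \<Longrightarrow> b \<in> boundary_lifts \<Longrightarrow> emul b a \<in> boundary_lifts"
proof -
  assume a: "a \<in> cycle_lifts" and "b \<in> boundary_lifts"
  then obtain u where u: "b \<in> KP" "u \<in> KP" "b - d u \<in> ideal_valued"
    by (auto simp: boundary_lifts_def)
  have aK: "a \<in> KP" "d a \<in> ideal_valued" using a by (auto simp: cycle_lifts_def)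
  have "emul b a - d (emul u a) = emul (b - d u) a + emul (ebar u) (d a)"
    unfolding ediff_emul emul_diff_left by (simp add: algebra_simps)
  also have "\<dots> \<in> ideal_valued"
    by (intro ideal_valued_add ideal_valued_emul_right ideal_valued_emul_left koszul_polys_ebar u aK)
  finally show ?thesis
    unfolding boundary_lifts_def using aK u koszul_polys_emul by blast
qed

end

section \<open>Koszul homology as a vector space\<close>

lemma mpoly_ext_vector_space:
  "vector_space (\<lambda>c (a :: ('v, 'k::field) mpoly ext). escale (const c) a)"
  by unfold_locales (auto simp: escale_def fun_eq_iff distrib_left distrib_right const_add const_mult mult.assoc)

text
  \<open>The field acts on polynomial lifts, so that bases can be chosen there by linear algebra over a field and then be mapped to homology, where scalars act through their classes in degree 0.\<close>

interpretation ext: vector_space "\<lambda>c (a :: ('v, 'k::field) mpoly ext). escale (const c) a"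
  by (rule mpoly_ext_vector_space)

context koszul_quotient
begin

abbreviation Zring :: "(nat set \<Rightarrow> ('v, 'k) mpoly set) ring" where
  "Zring \<equiv> K\<lparr>carrier := koszul_cycles Q xs\<rparr>"

abbreviation H :: "(nat set \<Rightarrow> ('v, 'k) mpoly set) set ring" where
  "H \<equiv> koszul_homology Q xs"

lemma Zring_ring: "ring Zring"
proof -
  interpret K: ring K by (rule K_ring)
  have neg: "\<ominus>\<^bsub>K\<^esub> rmap a = rmap (- a)" if "a \<in> KP" for a
  proof -
    have "rmap (- a) \<oplus>\<^bsub>K\<^esub> rmap a = \<zero>\<^bsub>K\<^esub>"
      using that by (simp add: KP_uminus flip: rmap_add rmap_zero)
    then show ?thesis using that by (simp add: carrier_K KP_uminus K.minus_equality)
  qed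
  have "subring (koszul_cycles Q xs) K"
  proof (rule K.subringI)
    show "koszul_cycles Q xs \<subseteq> carrier K" by (auto simp: koszul_cycles_def)
    show "\<one>\<^bsub>K\<^esub> \<in> koszul_cycles Q xs"
      by (simp add: cycles_eq cycle_lifts_eone flip: rmap_one)
  qed (auto simp: cycles_eq neg cycle_lifts_KP cycle_lifts_uminus cycle_lifts_add cycle_lifts_emul simp flip: rmap_add rmap_emul)
  then show ?thesis by (rule K.subring_is_ring)
qed

lemma Zring_minus: "a \<in> cycle_lifts \<Longrightarrow> \<ominus>\<^bsub>Zring\<^esub> rmap a = rmap (- a)"
proof -
  interpret Z: ring Zring by (rule Zring_ring)
  assume a: "a \<in> cycle_lifts"
  then have "rmap (- a) \<oplus>\<^bsub>Zring\<^esub> rmap a = \<zero>\<^bsub>Zring\<^esub>"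
    by (simp add: KP_uminus cycle_lifts_KP flip: rmap_add rmap_zero)
  moreover have "rmap (- a) \<in> carrier Zring" "rmap a \<in> carrier Zring"
    using a by (auto simp: cycles_eq cycle_lifts_uminus)
  ultimately show ?thesis using Z.minus_equality by blast
qed

lemma boundaries_ideal: "ideal (koszul_boundaries Q xs) Zring"
proof (rule idealI[OF Zring_ring])
  interpret Z: ring Zring by (rule Zring_ring)
  show "subgroup (koszul_boundaries Q xs) (add_monoid Zring)"
  proof (rule group.subgroupI[OF Z.a_group])
    show "koszul_boundaries Q xs \<subseteq> carrier (add_monoid Zring)"
      using boundary_lifts_subset_cycle_lifts by (auto simp: boundaries_eq cycles_eq)
    show "koszul_boundaries Q xs \<noteq> {}" using boundary_lifts_zero by (auto simp: boundaries_eq)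
    show "inv\<^bsub>add_monoid Zring\<^esub> z \<in> koszul_boundaries Q xs" if "z \<in> koszul_boundaries Q xs" for z
    proof -
      obtain a where a: "a \<in> boundary_lifts" "z = rmap a" using \<open>z \<in> _\<close> by (auto simp: boundaries_eq)
      then have "\<ominus>\<^bsub>Zring\<^esub> z = rmap (- a)" using Zring_minus boundary_lifts_subset_cycle_lifts by blast
      then show ?thesis using boundary_lifts_uminus[OF a(1)] by (simp add: boundaries_eq a_inv_def)
    qed
    show "y \<otimes>\<^bsub>add_monoid Zring\<^esub> z \<in> koszul_boundaries Q xs"
      if "y \<in> koszul_boundaries Q xs" "z \<in> koszul_boundaries Q xs" for y z
      using that by (auto simp: boundaries_eq boundary_lifts_KP boundary_lifts_add simp flip: rmap_add)
  qed
qed (auto simp: boundaries_eq cycles_eq boundary_lifts_KP cycle_lifts_KP boundary_lifts_emul_left boundary_lifts_emul_right simp flip: rmap_emul)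

lemma H_ring: "ring H"
  unfolding koszul_homology_def by (rule ideal.quotient_is_ring[OF boundaries_ideal])

definition hclass :: "('v, 'k) mpoly ext \<Rightarrow> (nat set \<Rightarrow> ('v, 'k) mpoly set) set" where
  "hclass a = homology_class Q xs (rmap a)"

lemma hclass_coset: "hclass a = koszul_boundaries Q xs +>\<^bsub>Zring\<^esub> rmap a"
  by (simp add: hclass_def homology_class_def a_r_coset_def r_coset_def)

lemma coset_ring_hom: "(+>\<^bsub>Zring\<^esub>) (koszul_boundaries Q xs) \<in> ring_hom Zring H"
  unfolding koszul_homology_def by (rule ideal.rcos_ring_hom[OF boundaries_ideal])

lemma rmap_Zring: "a \<in> cycle_lifts \<Longrightarrow> rmap a \<in> carrier Zring"
  by (simp add: cycles_eq)

lemma hclass_carrier: "a \<in> cycle_lifts \<Longrightarrow> hclass a \<in> carrier H"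
  unfolding hclass_coset using ring_hom_closed[OF coset_ring_hom rmap_Zring] by simp

lemma hclass_add: "a \<in> cycle_lifts \<Longrightarrow> b \<in> cycle_lifts \<Longrightarrow> hclass (a + b) = hclass a \<oplus>\<^bsub>H\<^esub> hclass b"
  unfolding hclass_coset using ring_hom_add[OF coset_ring_hom rmap_Zring rmap_Zring, of a b]
  by (simp add: rmap_add cycle_lifts_KP)

lemma hclass_emul: "a \<in> cycle_lifts \<Longrightarrow> b \<in> cycle_lifts \<Longrightarrow> hclass (emul a b) = hclass a \<otimes>\<^bsub>H\<^esub> hclass b"
  unfolding hclass_coset using ring_hom_mult[OF coset_ring_hom rmap_Zring rmap_Zring, of a b]
  by (simp add: rmap_emul cycle_lifts_KP)

lemma hclass_zero: "hclass 0 = \<zero>\<^bsub>H\<^esub>"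
  unfolding hclass_coset using ring_hom_zero[OF coset_ring_hom Zring_ring H_ring]
  by (simp add: rmap_zero)

lemma hclass_eq_iff:
  assumes "a \<in> cycle_lifts" "b \<in> cycle_lifts"
  shows "hclass a = hclass b \<longleftrightarrow> a - b \<in> boundary_lifts"
proof -
  interpret Z: ring Zring by (rule Zring_ring)
  have "rmap a \<ominus>\<^bsub>Zring\<^esub> rmap b = rmap (a - b)"
    using assms rmap_add[of a "- b"] by (simp add: a_minus_def KP_uminus cycle_lifts_KP Zring_minus)
  moreover have "rmap (a - b) \<in> koszul_boundaries Q xs \<longleftrightarrow> a - b \<in> boundary_lifts"
  proof
    assume "rmap (a - b) \<in> koszul_boundaries Q xs"
    then obtain c where c: "c \<in> boundary_lifts" "rmap (a - b) = rmap c" by (auto simp: boundaries_eq)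
    have ab: "a - b \<in> KP" using assms by (simp add: cycle_lifts_KP koszul_polys_diff)
    then have "a - b - c \<in> ideal_valued" using c by (simp add: rmap_eq_iff' boundary_lifts_KP)
    moreover obtain u where u: "u \<in> KP" "c - d u \<in> ideal_valued" using c by (auto simp: boundary_lifts_def)
    ultimately have "(a - b - c) + (c - d u) \<in> ideal_valued" by (rule_tac ideal_valued_add)
    then have "a - b - d u \<in> ideal_valued" by (simp add: algebra_simps)
    then show "a - b \<in> boundary_lifts" using ab u by (auto simp: boundary_lifts_def)
  qed (simp add: boundaries_eq)
  ultimately show ?thesis
    unfolding hclass_coset
    using Z.quotient_eq_iff_same_a_r_cos[OF boundaries_ideal rmap_Zring[OF assms(1)] rmap_Zring[OF assms(2)]]
    by simp
qed

definition scalars :: "(nat set \<Rightarrow> ('v, 'k) mpoly set) set set" where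
  "scalars = homology_scalars Q xs (res ` range const)"

lemma scalars_eq: "scalars = range (\<lambda>c. hclass (\<lambda>S. if S = {} then const c else 0))"
proof -
  have "rmap (\<lambda>S. if S = {} then f else 0) = (\<lambda>S. if S = {} then res f else \<zero>\<^bsub>Q\<^esub>)" for f
    by (auto simp: rmap_def res_zero fun_eq_iff)
  then show ?thesis
    unfolding scalars_def homology_scalars_def hclass_def image_image by simp
qed

lemma hclass_scale:
  assumes "a \<in> cycle_lifts"
  shows "hclass (escale (const c) a) = hclass (\<lambda>S. if S = {} then const c else 0) \<otimes>\<^bsub>H\<^esub> hclass a"
proof -
  have "escale (const c) a U = emul (\<lambda>S. if S = {} then const c else 0) a U" for U
  proof (cases "finite U")
    case False
    then have "a U = 0"
      using assms finite_subset[of U "{..<r}"] by (auto simp: cycle_lifts_def koszul_polys_def dest: esuppD)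
    then show ?thesis using False by (simp add: emul_infinite escale_def)
  qed (simp add: emul_degree_0_left escale_def)
  then have "escale (const c) a = emul (\<lambda>S. if S = {} then const c else 0) a" by auto
  then show ?thesis using assms by (simp add: hclass_emul cycle_lifts_degree_0 polys_const)
qed

lemma cycle_lifts_subspace: "ext.subspace cycle_lifts" and boundary_lifts_subspace: "ext.subspace boundary_lifts"
  using boundary_lifts_zero boundary_lifts_subset_cycle_lifts
  by (auto intro!: ext.subspaceI cycle_lifts_add boundary_lifts_add cycle_lifts_scale boundary_lifts_scale polys_const)

lemma span_subset_cycle_lifts: "A \<subseteq> cycle_lifts \<Longrightarrow> ext.span A \<subseteq> cycle_lifts"
  using ext.span_minimal cycle_lifts_subspace by blast

text \<open>Connects the spans of lists in the homology ring with linear algebra over the field.\<close>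

lemma Span_eq:
  "set zs \<subseteq> cycle_lifts \<Longrightarrow> ring.Span H scalars (map hclass zs) = hclass ` ext.span (set zs)"
proof (induction zs)
  case Nil
  then show ?case by (simp add: ring.Span.simps[OF H_ring] flip: hclass_zero) (simp add: zero_fun_def)
next
  case (Cons a zs)
  have a: "a \<in> cycle_lifts" and zs: "ext.span (set zs) \<subseteq> cycle_lifts"
    using Cons.prems by (auto intro!: span_subset_cycle_lifts)
  have "ring.Span H scalars (map hclass (a # zs)) =
      ring.line_extension H scalars (hclass a) (ring.Span H scalars (map hclass zs))"
    by (simp add: ring.Span.simps[OF H_ring])
  also have "\<dots> = ring.line_extension H scalars (hclass a) (hclass ` ext.span (set zs))"
    using Cons by simp
  also have "\<dots> = {hclass (escale (const c) a) \<oplus>\<^bsub>H\<^esub> hclass y | c y. y \<in> ext.span (set zs)}"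
    unfolding ring.line_extension_def[OF H_ring] scalars_eq hclass_scale[OF a]
    by (auto simp: set_add_def set_mult_def r_coset_def)
  also have "\<dots> = {hclass (escale (const c) a + y) | c y. y \<in> ext.span (set zs)}"
  proof -
    have "hclass (escale (const c) a) \<oplus>\<^bsub>H\<^esub> hclass y = hclass (escale (const c) a + y)"
      if "y \<in> ext.span (set zs)" for c y
      using hclass_add[OF cycle_lifts_scale[OF a polys_const]] zs that by blast
    then show ?thesis by (intro Collect_cong ex_cong1) auto
  qed
  also have "\<dots> = hclass ` ext.span (set (a # zs))"
  proof -
    have "ext.span (set (a # zs)) = {escale (const c) a + y | c y. y \<in> ext.span (set zs)}"
    proof (intro equalityI subsetI)
      fix x assume "x \<in> ext.span (set (a # zs))"
      then obtain c where "x - escale (const c) a \<in> ext.span (set zs)"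
        by (auto simp: ext.span_insert)
      then show "x \<in> {escale (const c) a + y | c y. y \<in> ext.span (set zs)}"
        by (intro CollectI exI[of _ c] exI[of _ "x - escale (const c) a"]) simp
    next
      fix x assume "x \<in> {escale (const c) a + y | c y. y \<in> ext.span (set zs)}"
      then obtain c y where "x = escale (const c) a + y" "y \<in> ext.span (set zs)" by blast
      then have "x - escale (const c) a \<in> ext.span (set zs)" by simp
      then show "x \<in> ext.span (set (a # zs))" by (auto simp: ext.span_insert)
    qed
    then show ?thesis by auto
  qed
  finally show ?case .
qed

end

section \<open>Construction of a trivial Massey operation\<close>

text \<open>The bihomogeneous component of homological degree \<open>q\<close> and coefficient degree \<open>e\<close>.\<close>

definition ecomp :: "nat \<Rightarrow> nat \<Rightarrow> ('v, 'k::field) mpoly ext \<Rightarrow> ('v, 'k) mpoly ext" where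
  "ecomp q e a = (\<lambda>S. if card S = q then hcomp e (a S) else 0)"

lemma bihomogeneous_ecomp: "bihomogeneous q e (ecomp q e a)"
  by (simp add: bihomogeneous_def ecomp_def)

lemma ecomp_bihomogeneous: "bihomogeneous q e a \<Longrightarrow> ecomp q e a = a"
  using hcomp_homogeneous[OF bihomogeneous_coeff, of q e a e]
  by (auto simp: bihomogeneous_def ecomp_def fun_eq_iff)

lemma ecomp_diff: "ecomp q e (a - b) = ecomp q e a - ecomp q e b"
  by (simp add: ecomp_def fun_eq_iff hcomp_diff)

lemma ecomp_koszul_polys: "a \<in> koszul_polys V r \<Longrightarrow> ecomp q e a \<in> koszul_polys V r"
  by (auto simp: koszul_polys_def esupp_def ecomp_def hcomp_polys polys_zero)

lemma ediff_ecomp: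
  fixes a :: "('v, 'k::field) mpoly ext"
  assumes "a \<in> koszul_polys V r" "\<And>i. i < r \<Longrightarrow> homogeneous 1 (p i)"
  shows "ediff r p (ecomp (Suc q) e a) = ecomp q (Suc e) (ediff r p a)"
proof
  fix T
  show "ediff r p (ecomp (Suc q) e a) T = ecomp q (Suc e) (ediff r p a) T"
  proof (cases "T \<subseteq> {..<r}")
    case False
    then show ?thesis
      using assms(1) esuppD[OF esupp_ediff False, of a] esuppD[OF esupp_ediff False, of "ecomp (Suc q) e a"]
        ecomp_koszul_polys[OF assms(1), of "Suc q" e]
      by (simp add: koszul_polys_def ecomp_def[of q])
  next
    case True
    then have fin: "finite T" using finite_subset by blast
    have "p i * contract i (ecomp (Suc q) e a) T =
        (if card T = q then hcomp (Suc e) (p i * contract i a T) else 0)" if "i < r" for i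
      using fin hcomp_mult[OF assms(2)[OF that], of "Suc e"] hcomp_mult[OF homogeneous_shuffle_sign[of "{i}" T], of e "a (insert i T)"]
      by (auto simp: contract_def ecomp_def)
    then show ?thesis by (simp add: ediff_def ecomp_def hcomp_sum)
  qed
qed

lemma bihomogeneous_emul:
  assumes "bihomogeneous q e a" "bihomogeneous q' e' b"
  shows "bihomogeneous (q + q') (e + e') (emul a b)"
  unfolding bihomogeneous_def
proof (intro allI impI conjI)
  fix U assume U: "emul a b U \<noteq> 0"
  then have fin: "finite U" using emul_infinite[of U a b] by (cases "finite U") auto
  from U obtain S where S: "S \<in> Pow U" "shuffle_sign S (U - S) * (a S * b (U - S)) \<noteq> 0"
    unfolding emul_def by (rule sum.not_neutral_contains_not_neutral) auto
  then have "card S = q" "card (U - S) = q'"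
    using assms unfolding bihomogeneous_def by (metis mult_zero_left mult_zero_right)+
  then show "card U = q + q'"
    using S(1) fin card_mono[OF fin, of S] by (simp add: card_Diff_subset finite_subset)
next
  fix U
  show "homogeneous (e + e') (emul a b U)"
    unfolding emul_def
    using homogeneous_mult[OF homogeneous_shuffle_sign homogeneous_mult[OF bihomogeneous_coeff[OF assms(1)]
      bihomogeneous_coeff[OF assms(2)]]] by (intro homogeneous_sum) simp
qed

lemma bihomogeneous_ebar: "bihomogeneous q e a \<Longrightarrow> bihomogeneous q e (ebar a)"
  using homogeneous_mult[OF homogeneous_sign] unfolding bihomogeneous_def ebar_def
  by (metis add_0 mult_zero_right)

text \<open>The recursion behind a Massey operation: \<open>primitive\<close> chooses a value that bounds the sum of
  the products over all splittings of the list. Both parts of a splitting are shorter than the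
  list.\<close>

function massey_operation ::
    "('h \<Rightarrow> 'b::comm_monoid_add) \<Rightarrow> ('h list \<Rightarrow> 'b \<Rightarrow> 'b) \<Rightarrow> ('b \<Rightarrow> 'b \<Rightarrow> 'b) \<Rightarrow> 'h list \<Rightarrow> 'b" where
  "massey_operation rep primitive prd hs =
    (if length hs \<le> 1 then rep (hd hs)
     else primitive hs (\<Sum>j\<in>{1..<length hs}.
       prd (massey_operation rep primitive prd (take j hs)) (massey_operation rep primitive prd (drop j hs))))"
  by pat_completeness auto
termination
  by (relation "measure (\<lambda>(_, _, _, hs). length hs)") auto

declare massey_operation.simps [simp del]

text \<open>All that the construction uses of a linear resolution: positive homology lives in
  coefficient degree \<open>t - 1\<close> with \<open>t \<ge> 2\<close>, and \<open>I\<close> is homogeneous.\<close>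

locale concentrated_koszul_homology = koszul_quotient V I p xs
  for V :: "'v set" and I :: "('v, 'k::field) mpoly set" and p xs +
  fixes t :: nat
  assumes t: "t \<ge> 2"
    and p_lin: "i < length xs \<Longrightarrow> homogeneous 1 (p i)"
    and hcomp_I: "f \<in> I \<Longrightarrow> hcomp e f \<in> I"
    and concentrated: "a \<in> cycle_lifts \<Longrightarrow> bihomogeneous q e a \<Longrightarrow> q \<ge> 1 \<Longrightarrow> e + 1 \<noteq> t \<Longrightarrow> a \<in> boundary_lifts"
begin

lemma ideal_valued_ecomp: "a \<in> ideal_valued \<Longrightarrow> ecomp q e a \<in> ideal_valued"
  by (simp add: ideal_valued_def ecomp_def hcomp_I ideal_zero[OF I])

text \<open>The cycles in the only bidegrees that carry positive homology.\<close>

definition strand_cycles :: "('v, 'k) mpoly ext set" where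
  "strand_cycles = {a \<in> cycle_lifts. \<exists>q\<ge>1. bihomogeneous q (t - 1) a}"

lemma ideal_valued_KP_boundary_lifts:
  assumes "a \<in> ideal_valued" "a \<in> KP"
  shows "a \<in> boundary_lifts"
proof -
  have "a - d 0 \<in> ideal_valued" using assms(1) unfolding ediff_zero diff_zero .
  then have "\<exists>b\<in>KP. a - d b \<in> ideal_valued" using koszul_polys_zero by (rule bexI)
  then show ?thesis using assms(2) unfolding boundary_lifts_def by (intro CollectI conjI)
qed

lemma ecomp_cycle_lifts:
  assumes "a \<in> cycle_lifts"
  shows "ecomp q e a \<in> cycle_lifts"
proof (cases q)
  case 0
  have "contract i (ecomp 0 e a) T = 0" if "i < r" for i T
  proof (cases "insert i T \<subseteq> {..<r}")
    case True
    then have "finite T" using finite_subset[OF True] by simp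
    then show ?thesis by (simp add: contract_def ecomp_def)
  next
    case False
    have "esupp r a" using assms by (simp add: cycle_lifts_def koszul_polys_def)
    then have "a (insert i T) = 0" using False by (rule esuppD)
    then show ?thesis by (simp add: contract_def ecomp_def)
  qed
  then have "d (ecomp 0 e a) = 0" by (simp add: ediff_def fun_eq_iff)
  then show ?thesis using assms 0 by (simp add: cycle_lifts_def ecomp_koszul_polys ideal_valued_zero)
next
  case (Suc q')
  have "d (ecomp q e a) = ecomp q' (Suc e) (d a)"
    unfolding Suc by (rule ediff_ecomp) (use assms p_lin in \<open>auto simp: cycle_lifts_def\<close>)
  then show ?thesis using assms by (simp add: cycle_lifts_def ecomp_koszul_polys ideal_valued_ecomp)
qed

lemma sum_ecomp:
  assumes "a \<in> KP"
  obtains E where "finite E" "a = (\<Sum>q\<le>r. \<Sum>e\<in>E. ecomp q e a)"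
proof
  let ?E = "\<Union>S\<in>Pow {..<r}. mdeg ` keys (a S)"
  show "finite ?E" by auto
  show "a = (\<Sum>q\<le>r. \<Sum>e\<in>?E. ecomp q e a)"
  proof
    fix S
    show "a S = (\<Sum>q\<le>r. \<Sum>e\<in>?E. ecomp q e a) S"
    proof (cases "S \<subseteq> {..<r}")
      case True
      then have "card S \<le> r" using card_mono[of "{..<r}" S] by simp
      have "(\<Sum>q\<le>r. \<Sum>e\<in>?E. ecomp q e a) S = (\<Sum>q\<le>r. if q = card S then \<Sum>e\<in>?E. hcomp e (a S) else 0)"
        unfolding sum_fun_apply ecomp_def by (rule sum.cong) auto
      also have "\<dots> = (\<Sum>e\<in>?E. hcomp e (a S))" using \<open>card S \<le> r\<close> by simp
      also have "\<dots> = a S" by (rule sum_hcomp) (use True in auto)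
      finally show ?thesis by simp
    next
      case False
      then have "a S = 0" using assms by (auto simp: koszul_polys_def dest: esuppD)
      then show ?thesis by (simp add: sum_fun_apply ecomp_def cong: if_cong)
    qed
  qed
qed

text \<open>The bihomogeneous components of a cycle modulo \<open>I\<close> are again such cycles, since \<open>I\<close> is
  homogeneous. Each of them is a boundary or lies in the strand.\<close>

lemma positive_cycle_in_span:
  assumes "z \<in> cycle_lifts" "z {} \<in> I"
  shows "z \<in> ext.span (strand_cycles \<union> boundary_lifts)"
proof -
  obtain E where E: "finite E" "z = (\<Sum>q\<le>r. \<Sum>e\<in>E. ecomp q e z)"
    using sum_ecomp[OF cycle_lifts_KP[OF assms(1)]] by blast
  have "ecomp q e z \<in> strand_cycles \<union> boundary_lifts" for q e
  proof -
    have Z: "ecomp q e z \<in> cycle_lifts" by (rule ecomp_cycle_lifts[OF assms(1)])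
    consider "q = 0" | "q \<ge> 1" "e + 1 = t" | "q \<ge> 1" "e + 1 \<noteq> t" by linarith
    then show ?thesis
    proof cases
      case 1
      have "ecomp q e z S \<in> I" for S
      proof (cases "S = {}")
        case True
        then show ?thesis using assms(2) by (simp add: ecomp_def 1 hcomp_I)
      next
        case False
        have "z S = 0 \<or> card S \<noteq> 0"
        proof (cases "S \<subseteq> {..<r}")
          case True
          then show ?thesis using False finite_subset[OF True] by simp
        next
          case False
          then show ?thesis using cycle_lifts_KP[OF assms(1)] by (auto simp: koszul_polys_def dest: esuppD)
        qed
        then show ?thesis by (auto simp: ecomp_def 1 ideal_zero[OF I])
      qed
      then show ?thesis using ideal_valued_KP_boundary_lifts Z by (simp add: ideal_valued_def cycle_lifts_KP)
    next
      case 2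
      then have "bihomogeneous q (t - 1) (ecomp q e z)" using bihomogeneous_ecomp[of q e z] by auto
      then show ?thesis using Z 2 by (auto simp: strand_cycles_def)
    next
      case 3
      then show ?thesis using concentrated[OF Z bihomogeneous_ecomp] by blast
    qed
  qed
  then show ?thesis
    by (subst E(2)) (intro ext.span_sum ext.span_base)
qed

text \<open>A basis of the boundaries is extended to the span of boundaries and strand cycles by strand
  cycles \<open>D\<close>. The members of \<open>D\<close> are independent modulo boundaries, and together with the
  boundaries they span all cycles of positive degree, so their classes form a basis.\<close>

lemma homology_basis:
  obtains D where "D \<subseteq> strand_cycles" "inj_on hclass D" "homogeneous_basis Q xs (res ` range const) (hclass ` D)"
proof -
  obtain B0 where B0: "B0 \<subseteq> boundary_lifts" "ext.independent B0" "boundary_lifts \<subseteq> ext.span B0"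
    using ext.maximal_independent_subset by blast
  obtain B1 where B1: "B0 \<subseteq> B1" "B1 \<subseteq> B0 \<union> strand_cycles" "ext.independent B1" "B0 \<union> strand_cycles \<subseteq> ext.span B1"
    using ext.maximal_independent_subset_extend[of B0 "B0 \<union> strand_cycles"] B0(2) by blast
  define D where "D = B1 - B0"
  have D: "D \<subseteq> strand_cycles" using B1 by (auto simp: D_def)
  have D_cycle_lifts: "D \<subseteq> cycle_lifts" using D by (auto simp: strand_cycles_def)
  have span_B1: "ext.span B1 = {x + y | x y. x \<in> ext.span B0 \<and> y \<in> ext.span D}"
    using B1(1) ext.span_Un[of B0 D] by (simp add: D_def Un_absorb1)
  have span_B0: "ext.span B0 = boundary_lifts"
    using B0 ext.span_minimal[OF B0(1) boundary_lifts_subspace] by blast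
  \<comment> \<open>Independence modulo boundaries, in the form in which it gives injectivity on \<open>D\<close> as well as
    independence of the classes.\<close>
  have notin: "z - y \<notin> boundary_lifts" if "z \<in> D" "y \<in> ext.span A" "A \<subseteq> D - {z}" for z y A
  proof
    assume "z - y \<in> boundary_lifts"
    then have "z - y \<in> ext.span (B0 \<union> A)" using span_B0 ext.span_mono[of B0 "B0 \<union> A"] by blast
    moreover have "y \<in> ext.span (B0 \<union> A)" using that(2) ext.span_mono[of A "B0 \<union> A"] by blast
    ultimately have "z - y + y \<in> ext.span (B0 \<union> A)" by (rule ext.span_add)
    then have "z \<in> ext.span (B1 - {z})"
      using ext.span_mono[of "B0 \<union> A" "B1 - {z}"] that B1(1) by (auto simp: D_def)
    then show False using B1(3) that(1) by (auto simp: ext.dependent_def D_def)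
  qed
  have inj: "inj_on hclass D"
  proof (rule inj_onI, rule ccontr)
    fix y z assume yz: "y \<in> D" "z \<in> D" "hclass y = hclass z" "y \<noteq> z"
    then have "y - z \<in> boundary_lifts" using hclass_eq_iff D_cycle_lifts by blast
    then show False using notin[of y z "{z}"] yz by (auto intro: ext.span_base)
  qed
  have lists: "\<exists>zs. hs = map hclass zs \<and> set zs \<subseteq> D \<and> (distinct hs \<longrightarrow> distinct zs)" if "set hs \<subseteq> hclass ` D" for hs
  proof (intro exI conjI)
    show "hs = map hclass (map (inv_into D hclass) hs)"
      using that by (auto simp: f_inv_into_f subset_iff intro!: map_idI[symmetric])
    show "set (map (inv_into D hclass) hs) \<subseteq> D"
      using that by (auto simp: inv_into_into subset_iff)
    show "distinct hs \<longrightarrow> distinct (map (inv_into D hclass) hs)"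
      using that inj_on_inv_into by (auto simp: distinct_map)
  qed
  have indep: "ring.independent H scalars (map hclass zs)" if "set zs \<subseteq> D" "distinct zs" for zs
    using that
  proof (induction zs)
    case Nil
    then show ?case by (simp add: ring.li_Nil[OF H_ring])
  next
    case (Cons z zs)
    have z: "z \<in> cycle_lifts" and zs: "set zs \<subseteq> cycle_lifts" using Cons.prems D_cycle_lifts by auto
    have "hclass z \<notin> hclass ` ext.span (set zs)"
    proof
      assume "hclass z \<in> hclass ` ext.span (set zs)"
      then obtain y where y: "y \<in> ext.span (set zs)" "hclass z = hclass y" by blast
      then have "z - y \<in> boundary_lifts" using hclass_eq_iff z span_subset_cycle_lifts[OF zs] by blast
      then show False using notin[of z y "set zs"] y Cons.prems by auto
    qed
    then show ?case
      using Cons Span_eq[OF zs] hclass_carrier[OF z] by (simp add: ring.li_Cons[OF H_ring])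
  qed
  have pos: "positive_homology Q xs = hclass ` {z \<in> cycle_lifts. z {} \<in> I}"
  proof -
    have "{z \<in> koszul_cycles Q xs. z {} = \<zero>\<^bsub>Q\<^esub>} = rmap ` {z \<in> cycle_lifts. z {} \<in> I}"
      using res_eq_zero_iff[OF KP_polys[OF cycle_lifts_KP]] by (auto simp: cycles_eq rmap_def)
    then show ?thesis by (simp add: positive_homology_def hclass_def image_image)
  qed
  have "homogeneous_basis Q xs (res ` range const) (hclass ` D)"
    unfolding homogeneous_basis_def scalars_def[symmetric]
  proof (intro conjI ballI allI impI)
    fix h assume "h \<in> hclass ` D"
    then obtain z q where z: "z \<in> cycle_lifts" "q \<ge> 1" "bihomogeneous q (t - 1) z" "h = hclass z"
      using D by (auto simp: strand_cycles_def)
    have "koszul_homogeneous Q q (rmap z)"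
      using z(3) unfolding koszul_homogeneous_def rmap_def bihomogeneous_def by (metis res_zero)
    then show "\<exists>p\<ge>1. \<exists>z\<in>koszul_cycles Q xs. koszul_homogeneous Q p z \<and> h = homology_class Q xs z"
      using z by (auto simp: cycles_eq hclass_def)
  next
    fix hs assume "distinct hs \<and> set hs \<subseteq> hclass ` D"
    then show "ring.independent H scalars hs" using lists[of hs] indep by metis
  next
    show "(\<Union>hs\<in>lists (hclass ` D). ring.Span H scalars hs) = positive_homology Q xs"
    proof (intro equalityI subsetI)
      fix h assume "h \<in> (\<Union>hs\<in>lists (hclass ` D). ring.Span H scalars hs)"
      then obtain hs where hs: "set hs \<subseteq> hclass ` D" "h \<in> ring.Span H scalars hs" by auto
      obtain zs where zs: "hs = map hclass zs" "set zs \<subseteq> D" using lists[OF hs(1)] by metis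
      with hs obtain z where z: "z \<in> ext.span (set zs)" "h = hclass z"
        using Span_eq[of zs] D_cycle_lifts by auto
      have "ext.subspace {z \<in> cycle_lifts. z {} \<in> I}"
      proof (rule ext.subspaceI)
        show "0 \<in> {z \<in> cycle_lifts. z {} \<in> I}"
          using ext.subspace_0[OF cycle_lifts_subspace] ideal_zero[OF I] by simp
        show "x + y \<in> {z \<in> cycle_lifts. z {} \<in> I}"
          if "x \<in> {z \<in> cycle_lifts. z {} \<in> I}" "y \<in> {z \<in> cycle_lifts. z {} \<in> I}" for x y
          using that cycle_lifts_add ideal_add[OF I] by simp
        show "escale (const c) x \<in> {z \<in> cycle_lifts. z {} \<in> I}" if "x \<in> {z \<in> cycle_lifts. z {} \<in> I}" for c x
          using that cycle_lifts_scale[OF _ polys_const] ideal_mult[OF I _ polys_const]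
          by (simp add: escale_def[of _ x, THEN fun_cong])
      qed
      moreover have "set zs \<subseteq> {z \<in> cycle_lifts. z {} \<in> I}"
      proof
        fix y assume "y \<in> set zs"
        then obtain q where "y \<in> cycle_lifts" "q \<ge> 1" "bihomogeneous q (t - 1) y" using zs(2) D by (auto simp: strand_cycles_def)
        moreover from this have "y {} = 0" by (force simp: bihomogeneous_def)
        ultimately show "y \<in> {z \<in> cycle_lifts. z {} \<in> I}" by (simp add: ideal_zero[OF I])
      qed
      ultimately have "z \<in> {z \<in> cycle_lifts. z {} \<in> I}" using z(1) ext.span_minimal by blast
      then show "h \<in> positive_homology Q xs" using z pos by blast
    next
      fix h assume "h \<in> positive_homology Q xs"
      then obtain z where z: "z \<in> cycle_lifts" "z {} \<in> I" "h = hclass z" using pos by blast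
      have "strand_cycles \<union> boundary_lifts \<subseteq> ext.span B1"
        using B1(4) span_B0 ext.span_mono[OF B1(1)] by blast
      then have "z \<in> ext.span B1"
        using positive_cycle_in_span[OF z(1,2)] ext.span_minimal[OF _ ext.subspace_span] by blast
      then obtain x y where xy: "x \<in> boundary_lifts" "y \<in> ext.span D" "z = x + y"
        using span_B1 span_B0 by blast
      then obtain A where A: "finite A" "A \<subseteq> D" "y \<in> ext.span A"
        using ext.span_explicit[of D] ext.span_explicit by (auto intro: ext.span_sum ext.span_scale ext.span_base)
      obtain zs where zs: "set zs = A" using finite_list[OF A(1)] by blast
      have "y \<in> cycle_lifts" using xy(2) span_subset_cycle_lifts[OF D_cycle_lifts] by blast
      then have "hclass z = hclass y" using hclass_eq_iff[OF z(1)] xy by simp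
      then have "h \<in> ring.Span H scalars (map hclass zs)"
        using Span_eq[of zs] zs A D_cycle_lifts z(3) by auto
      moreover have "map hclass zs \<in> lists (hclass ` D)"
        using A(2) by (simp add: lists_eq_set zs image_mono)
      ultimately show "h \<in> (\<Union>hs\<in>lists (hclass ` D). ring.Span H scalars hs)" by blast
    qed
  qed
  then show thesis using that D inj by blast
qed

text \<open>The value on a list of length \<open>l\<close> is sought in coefficient degree \<open>l (t - 2) + 1\<close>, which is
  \<open>t - 1\<close> for \<open>l = 1\<close>. The sum of products to be bounded is a cycle by the Leibniz rule: the
  double sums that come from the differentials of the left and of the right factors are equal and
  enter with opposite signs. Its coefficient degree is \<open>l (t - 2) + 2\<close>, and for \<open>l \<ge> 2\<close> no
  homology lives there.\<close>

theorem admits_trivial_massey: "admits_trivial_massey Q xs (res ` range const)"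
proof -
  obtain D where D: "D \<subseteq> strand_cycles" "inj_on hclass D"
    "homogeneous_basis Q xs (res ` range const) (hclass ` D)"
    by (rule homology_basis)
  define B where "B = hclass ` D"
  define rep where "rep = inv_into D hclass"
  have rep: "rep h \<in> strand_cycles" "hclass (rep h) = h" if "h \<in> B" for h
    using that D(1) by (auto simp: B_def rep_def inv_into_into f_inv_into_f subset_iff)
  then have "\<exists>q. h \<in> B \<longrightarrow> q \<ge> 1 \<and> bihomogeneous q (t - 1) (rep h)" for h
    by (auto simp: strand_cycles_def)
  then obtain deg where deg: "\<And>h. h \<in> B \<Longrightarrow> deg h \<ge> 1" "\<And>h. h \<in> B \<Longrightarrow> bihomogeneous (deg h) (t - 1) (rep h)"
    by metis
  \<comment>
    \<open>Products add homological degrees, and each primitive raises them by one; the subtraction is proper as lists are nonempty.\<close>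
  define hdeg where "hdeg hs = sum_list (map deg hs) + length hs - 1" for hs
  define cdeg where "cdeg hs = length hs * (t - 2) + 1" for hs :: "(nat set \<Rightarrow> ('v, 'k) mpoly set) set list"
  define good where "good hs s a \<longleftrightarrow> a \<in> KP \<and> bihomogeneous (hdeg hs) (cdeg hs) a \<and> d a - s \<in> ideal_valued"
    for hs s a
  define \<nu> where "\<nu> = massey_operation rep (\<lambda>hs s. SOME a. good hs s a) (\<lambda>a b. emul (ebar a) b)"
  define \<sigma> where "\<sigma> hs = (\<Sum>j\<in>{1..<length hs}. emul (ebar (\<nu> (take j hs))) (\<nu> (drop j hs)))" for hs
  have \<nu>_single: "\<nu> [h] = rep h" for h
    by (simp add: \<nu>_def massey_operation.simps)
  have \<nu>_long: "\<nu> hs = (SOME a. good hs (\<sigma> hs) a)" if "length hs > 1" for hs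
    using that unfolding \<sigma>_def \<nu>_def by (subst massey_operation.simps) simp
  have "good hs (\<sigma> hs) (\<nu> hs)" if "set hs \<subseteq> B" "hs \<noteq> []" for hs
    using that
  proof (induction hs rule: length_induct)
    case (1 hs)
    show ?case
    proof (cases "length hs > 1")
      case False
      then obtain h where hs: "hs = [h]" using 1(3) by (cases hs) auto
      then have h: "h \<in> B" using 1(2) by simp
      have "cdeg hs = t - 1" using t by (simp add: cdeg_def hs)
      moreover have "hdeg hs = deg h" by (simp add: hdeg_def hs)
      moreover have "\<sigma> hs = 0" by (simp add: \<sigma>_def hs)
      then have "d (rep h) - \<sigma> hs = d (rep h)" by (simp only: diff_zero)
      ultimately show ?thesis
        using rep(1)[OF h] deg(2)[OF h] unfolding good_def hs \<nu>_single strand_cycles_def cycle_lifts_def by simp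
    next
      case True
      define n where "n = length hs"
      have "n \<ge> 2" using True by (simp add: n_def)
      have parts: "good ys (\<sigma> ys) (\<nu> ys)" if "set ys \<subseteq> set hs" "ys \<noteq> []" "length ys < n" for ys
        using 1 that by (simp add: n_def)
      \<comment> \<open>The value on the segment of \<open>hs\<close> between the positions \<open>i\<close> and \<open>j\<close>; only proper segments
        occur in the sum.\<close>
      define X where "X i j = \<nu> (drop i (take j hs))" for i j
      have X: "good (drop i (take j hs)) (\<sigma> (drop i (take j hs))) (X i j)"
        if "i < j" "j \<le> n" "\<not> (i = 0 \<and> j = n)" for i j
        unfolding X_def using that set_drop_subset set_take_subset
        by (intro parts) (auto simp: n_def intro: in_set_takeD in_set_dropD)
      have X_KP: "X i j \<in> KP" if "i < j" "j \<le> n" "\<not> (i = 0 \<and> j = n)" for i j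
        using X[OF that] by (simp add: good_def)
      have dX: "d (X i j) - (\<Sum>k\<in>{i<..<j}. emul (ebar (X i k)) (X k j)) \<in> ideal_valued"
        if "i < j" "j \<le> n" "\<not> (i = 0 \<and> j = n)" for i j
      proof -
        have "\<sigma> (drop i (take j hs)) = (\<Sum>k\<in>{1..<j - i}. emul (ebar (X i (i + k))) (X (i + k) j))"
          unfolding \<sigma>_def X_def
        proof (rule sum.cong)
          show "{1..<length (drop i (take j hs))} = {1..<j - i}" using that by (simp add: n_def)
          fix k assume k: "k \<in> {1..<j - i}"
          then have "take k (drop i (take j hs)) = drop i (take (i + k) hs)"
            by (auto simp: take_drop min_def add.commute)
          then show "emul (ebar (\<nu> (take k (drop i (take j hs))))) (\<nu> (drop k (drop i (take j hs)))) =
              emul (ebar (\<nu> (drop i (take (i + k) hs)))) (\<nu> (drop (i + k) (take j hs)))"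
            by (simp add: add.commute)
        qed
        also have "\<dots> = (\<Sum>k\<in>{i<..<j}. emul (ebar (X i k)) (X k j))"
          by (rule sum.reindex_bij_witness[where i = "\<lambda>k. k - i" and j = "\<lambda>k. i + k"]) auto
        finally show ?thesis using X[OF that] by (simp add: good_def)
      qed
      have \<sigma>_eq: "\<sigma> hs = (\<Sum>j\<in>{1..<n}. emul (ebar (X 0 j)) (X j n))"
        by (simp add: \<sigma>_def X_def n_def)
      have \<sigma>_KP: "\<sigma> hs \<in> KP"
        unfolding \<sigma>_eq
        by (intro koszul_polys_sum koszul_polys_emul koszul_polys_ebar X_KP) auto
      define q where "q = hdeg hs - 1"
      have len_le: "sum_list (map deg ys) \<ge> length ys" if "set ys \<subseteq> B" for ys
        using that
      proof (induction ys)
        case (Cons h ys)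
        then show ?case using deg(1)[of h] by simp
      qed simp
      have q: "q \<ge> 1" "hdeg hs = Suc q"
        using len_le[OF 1(2)] True by (auto simp: q_def hdeg_def)
      have \<sigma>_bi: "bihomogeneous q (cdeg hs + 1) (\<sigma> hs)"
        unfolding \<sigma>_eq
      proof (rule bihomogeneous_sum)
        fix j assume j: "j \<in> {1..<n}"
        have *: "hdeg (take j hs) + hdeg (drop j hs) = q"
        proof -
          have "sum_list (map deg hs) = sum_list (map deg (take j hs)) + sum_list (map deg (drop j hs))"
            by (metis append_take_drop_id map_append sum_list_append)
          then show ?thesis using j by (simp add: hdeg_def q_def n_def)
        qed
        have **: "cdeg (take j hs) + cdeg (drop j hs) = cdeg hs + 1"
        proof -
          have "length hs = j + (length hs - j)" using j by (simp add: n_def)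
          then have "length hs * (t - 2) = j * (t - 2) + (length hs - j) * (t - 2)"
            by (metis add_mult_distrib)
          then show ?thesis using j by (simp add: cdeg_def n_def min_def)
        qed
        have "bihomogeneous (hdeg (take j hs)) (cdeg (take j hs)) (X 0 j)"
          "bihomogeneous (hdeg (drop j hs)) (cdeg (drop j hs)) (X j n)"
          using X[of 0 j] X[of j n] j by (auto simp: good_def n_def)
        then show "bihomogeneous q (cdeg hs + 1) (emul (ebar (X 0 j)) (X j n))"
          using bihomogeneous_emul[OF bihomogeneous_ebar] unfolding *[symmetric] **[symmetric] by blast
      qed
      have \<sigma>_cycle_lifts: "\<sigma> hs \<in> cycle_lifts"
      proof -
        \<comment> \<open>The threefold products over the splittings of \<open>hs\<close> into three segments.\<close>
        let ?T = "\<lambda>i j. emul (X 0 i) (emul (ebar (X i j)) (X j n))"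
        have "d (emul (ebar (X 0 j)) (X j n)) - ((\<Sum>i\<in>{0<..<j}. ?T i j) - (\<Sum>i\<in>{j<..<n}. ?T j i)) \<in> ideal_valued"
          if j: "j \<in> {1..<n}" for j
        proof -
          let ?e0 = "d (X 0 j) - (\<Sum>k\<in>{0<..<j}. emul (ebar (X 0 k)) (X k j))"
          let ?e1 = "d (X j n) - (\<Sum>k\<in>{j<..<n}. emul (ebar (X j k)) (X k n))"
          have e: "?e0 \<in> ideal_valued" "?e1 \<in> ideal_valued" using dX[of 0 j] dX[of j n] j by auto
          have KPs: "X 0 j \<in> KP" "X j n \<in> KP" using X_KP j by auto
          have s0: "(\<Sum>i\<in>{0<..<j}. ?T i j) =
              - emul (ebar (\<Sum>k\<in>{0<..<j}. emul (ebar (X 0 k)) (X k j))) (X j n)"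
            by (simp add: ebar_sum ebar_emul emul_sum_left emul_minus_left emul_assoc sum_negf)
          have s1: "(\<Sum>i\<in>{j<..<n}. ?T j i) = emul (X 0 j) (\<Sum>k\<in>{j<..<n}. emul (ebar (X j k)) (X k n))"
            by (simp add: emul_sum_right)
          have ebar_diff: "ebar (a - b) = ebar a - ebar b" for a b :: "('v, 'k) mpoly ext"
            by (simp add: ebar_def fun_eq_iff right_diff_distrib)
          have "d (emul (ebar (X 0 j)) (X j n)) - ((\<Sum>i\<in>{0<..<j}. ?T i j) - (\<Sum>i\<in>{j<..<n}. ?T j i)) =
              - emul (ebar ?e0) (X j n) - emul (X 0 j) ?e1"
            unfolding ediff_emul ebar_ebar d_ebar[OF KPs(1)] s0 s1 emul_minus_left ebar_diff
              emul_diff_left emul_diff_right by (simp add: algebra_simps)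
          also have "\<dots> \<in> ideal_valued"
            by (intro ideal_valued_diff ideal_valued_uminus ideal_valued_emul_left ideal_valued_emul_right ideal_valued_ebar e KPs)
          finally show ?thesis .
        qed
        then have "(\<Sum>j\<in>{1..<n}. d (emul (ebar (X 0 j)) (X j n)) -
            ((\<Sum>i\<in>{0<..<j}. ?T i j) - (\<Sum>i\<in>{j<..<n}. ?T j i))) \<in> ideal_valued"
          by (rule ideal_valued_sum)
        moreover have "(\<Sum>j\<in>{1..<n}. \<Sum>i\<in>{0<..<j}. ?T i j) = (\<Sum>j\<in>{1..<n}. \<Sum>i\<in>{j<..<n}. ?T j i)"
        proof -
          have "(\<Sum>j\<in>{1..<n}. \<Sum>i\<in>{0<..<j}. ?T i j) =
              (\<Sum>(j, i)\<in>Sigma {1..<n} (\<lambda>j. {0<..<j}). ?T i j)"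
            by (rule sum.Sigma) auto
          also have "\<dots> = (\<Sum>(j, i)\<in>Sigma {1..<n} (\<lambda>j. {j<..<n}). ?T j i)"
            by (rule sum.reindex_bij_witness[where i = prod.swap and j = prod.swap]) auto
          also have "\<dots> = (\<Sum>j\<in>{1..<n}. \<Sum>i\<in>{j<..<n}. ?T j i)"
            by (rule sum.Sigma[symmetric]) auto
          finally show ?thesis .
        qed
        ultimately have "d (\<sigma> hs) \<in> ideal_valued"
          unfolding \<sigma>_eq ediff_sum sum_subtractf by simp
        then show ?thesis using \<sigma>_KP by (simp add: cycle_lifts_def)
      qed
      have "cdeg hs + 1 + 1 \<noteq> t"
      proof -
        have "2 * (t - 2) \<le> length hs * (t - 2)" using True by (intro mult_right_mono) auto
        then have "cdeg hs + 1 + 1 \<ge> 2 * (t - 2) + 3" unfolding cdeg_def by linarith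
        then show ?thesis using t by linarith
      qed
      then have "\<sigma> hs \<in> boundary_lifts"
        using concentrated[OF \<sigma>_cycle_lifts \<sigma>_bi q(1)] by simp
      then obtain b where b: "b \<in> KP" "\<sigma> hs - d b \<in> ideal_valued" by (auto simp: boundary_lifts_def)
      \<comment> \<open>A primitive may be replaced by its component in the required bidegree.\<close>
      let ?b = "ecomp (Suc q) (cdeg hs) b"
      have "d ?b - \<sigma> hs = - ecomp q (Suc (cdeg hs)) (\<sigma> hs - d b)"
        using ediff_ecomp[OF b(1), of p q "cdeg hs"] p_lin ecomp_bihomogeneous[OF \<sigma>_bi]
        unfolding ecomp_diff by simp
      also have "\<dots> \<in> ideal_valued" by (intro ideal_valued_uminus ideal_valued_ecomp b)
      finally have "good hs (\<sigma> hs) ?b"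
        using b(1) bihomogeneous_ecomp by (simp add: good_def q(2) ecomp_koszul_polys)
      then show ?thesis unfolding \<nu>_long[OF True] by (rule someI[where P = "good hs (\<sigma> hs)"])
    qed
  qed
  then have \<nu>: "\<nu> hs \<in> KP" "bihomogeneous (hdeg hs) (cdeg hs) (\<nu> hs)" "d (\<nu> hs) - \<sigma> hs \<in> ideal_valued"
    if "hs \<in> lists B" "hs \<noteq> []" for hs
    using that by (auto simp: good_def lists_eq_set)
  have rmap_sum: "rmap (\<Sum>i\<in>A. f i) = (\<Oplus>\<^bsub>K\<^esub>i\<in>A. rmap (f i))"
    if "finite A" "\<And>i. i \<in> A \<Longrightarrow> f i \<in> KP" for A :: "nat set" and f
  proof -
    interpret K: ring K by (rule K_ring)
    show ?thesis
      using that
      by (induction A rule: finite_induct)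
        (auto simp: rmap_zero rmap_add koszul_polys_sum K.finsum_insert carrier_K)
  qed
  have "trivial_massey_operation Q xs B (\<lambda>hs. rmap (\<nu> hs))"
    unfolding trivial_massey_operation_def
  proof (intro conjI ballI impI)
    fix hs assume hs: "hs \<in> lists B" "hs \<noteq> []"
    show "rmap (\<nu> hs) \<in> carrier K" using \<nu>(1)[OF hs] by (simp add: carrier_K)
    show "\<exists>p. koszul_homogeneous Q p (rmap (\<nu> hs))"
      using \<nu>(2)[OF hs] unfolding koszul_homogeneous_def rmap_def bihomogeneous_def by (metis res_zero)
    have parts: "take j hs \<in> lists B" "take j hs \<noteq> []" "drop j hs \<in> lists B" "drop j hs \<noteq> []"
      if "j \<in> {1..<length hs}" for j
      using hs that by (auto simp: lists_eq_set dest: in_set_takeD in_set_dropD)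
    have \<sigma>_KP: "\<sigma> hs \<in> KP"
      unfolding \<sigma>_def by (intro koszul_polys_sum koszul_polys_emul koszul_polys_ebar \<nu> parts)
    have "koszul_diff Q xs (rmap (\<nu> hs)) = rmap (\<sigma> hs)"
      using \<nu>(3)[OF hs] \<nu>(1)[OF hs] \<sigma>_KP by (simp add: rmap_eq_iff' KP_d flip: rmap_ediff)
    also have "\<dots> = (\<Oplus>\<^bsub>K\<^esub>j\<in>{1..<length hs}. rmap (emul (ebar (\<nu> (take j hs))) (\<nu> (drop j hs))))"
      unfolding \<sigma>_def by (intro rmap_sum koszul_polys_emul koszul_polys_ebar \<nu> parts) auto
    also have "\<dots> = (\<Oplus>\<^bsub>K\<^esub>j\<in>{1..<length hs}. koszul_bar Q (rmap (\<nu> (take j hs))) \<otimes>\<^bsub>K\<^esub> rmap (\<nu> (drop j hs)))"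
    proof -
      interpret K: ring K by (rule K_ring)
      have KPs: "ebar (\<nu> (take j hs)) \<in> KP" "\<nu> (drop j hs) \<in> KP" if "j \<in> {1..<length hs}" for j
        using \<nu>(1)[OF parts(1,2)[OF that]] \<nu>(1)[OF parts(3,4)[OF that]] koszul_polys_ebar by auto
      have "rmap (emul (ebar (\<nu> (take j hs))) (\<nu> (drop j hs))) \<in> carrier K"
        if "j \<in> {1..<length hs}" for j
        unfolding carrier_K by (intro imageI koszul_polys_emul KPs that)
      moreover have "rmap (emul (ebar (\<nu> (take j hs))) (\<nu> (drop j hs))) =
          koszul_bar Q (rmap (\<nu> (take j hs))) \<otimes>\<^bsub>K\<^esub> rmap (\<nu> (drop j hs))"
        if "j \<in> {1..<length hs}" for j
        using \<nu>(1)[OF parts(1,2)[OF that]] KPs[OF that] by (simp add: rmap_emul rmap_ebar)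
      ultimately show ?thesis by (intro K.finsum_cong') auto
    qed
    finally show "koszul_diff Q xs (rmap (\<nu> hs)) =
      (\<Oplus>\<^bsub>K\<^esub>j\<in>{1..<length hs}. koszul_bar Q (rmap (\<nu> (take j hs))) \<otimes>\<^bsub>K\<^esub> rmap (\<nu> (drop j hs)))" .
  next
    fix h assume "h \<in> B"
    then show "rmap (\<nu> [h]) \<in> koszul_cycles Q xs" "homology_class Q xs (rmap (\<nu> [h])) = h"
      using rep[of h] by (auto simp: \<nu>_single cycles_eq strand_cycles_def simp flip: hclass_def)
  qed
  then show ?thesis
    unfolding admits_trivial_massey_def using D(3) B_def by blast
qed

end

section \<open>Minimal generators of the graded maximal ideal\<close>

text \<open>By comparing components of degree 1, every variable is modulo \<open>I\<close> a linear combination of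
  those generators that have linear representatives. So these already generate, and by minimality
  they are all the generators. A nontrivial linear relation modulo \<open>I\<close> would make one of them
  redundant.\<close>

lemma minimal_generators_linear_forms:
  fixes V :: "'v set" and I :: "('v, 'k::field) mpoly set"
  assumes fin_V: "finite V" and I: "ideal I (poly_ring V)"
    and hcomp_I: "\<And>f e. f \<in> I \<Longrightarrow> hcomp e f \<in> I"
    and I_m: "\<And>f. f \<in> I \<Longrightarrow> lookup f 0 = 0"
    and min: "minimal_generators V I xs"
  obtains p C where "linear_forms V I p (length xs) C"
    "\<And>i. i < length xs \<Longrightarrow> xs ! i = residue V I (p i)"
proof -
  interpret Q0: koszul_quotient V I "\<lambda>_. 0" "[]"
    by (rule koszul_quotient.intro) (use I in auto)
  interpret R: cring "poly_ring V :: ('v, 'k) mpoly ring" by (rule poly_ring_cring)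
  let ?Q = "quotient_ring V I" and ?m = "graded_maximal_ideal V I"
  interpret Q: cring ?Q by (rule Q0.Q_cring)
  note min' = min[unfolded minimal_generators_def]
  have dist: "distinct xs" using min' by (rule conjunct1)
  have gen: "Idl\<^bsub>?Q\<^esub> (set xs) = ?m"
    using min'[THEN conjunct2, THEN conjunct2] by (rule conjunct1)
  have minimal: "Idl\<^bsub>?Q\<^esub> Y \<noteq> ?m" if "Y \<subset> set xs" for Y
    using min'[THEN conjunct2, THEN conjunct2, THEN conjunct2] that by (elim allE impE)
  have "\<forall>x\<in>set xs. \<exists>e. \<exists>f\<in>polys V. homogeneous e f \<and> x = residue V I f"
    using min'[THEN conjunct2] by (rule conjunct1)
  then obtain e f where f: "\<And>x. x \<in> set xs \<Longrightarrow> f x \<in> polys V" "\<And>x. x \<in> set xs \<Longrightarrow> homogeneous (e x) (f x)"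
    "\<And>x. x \<in> set xs \<Longrightarrow> x = residue V I (f x)"
    by metis
  have xs_Q: "set xs \<subseteq> carrier ?Q" using f Q0.res_closed by (metis subsetI)
  have f_const: "lookup (f x) 0 = 0" if x: "x \<in> set xs" for x
  proof -
    have "x \<in> ?m" using Q.genideal_self[OF xs_Q] gen x by auto
    then obtain g where g: "g \<in> polys V" "lookup g 0 = 0" "x = residue V I g"
      by (auto simp: graded_maximal_ideal_def)
    then have "f x - g \<in> I" using f x Q0.res_eq_iff by metis
    then show ?thesis using I_m[of "f x - g"] g(2) by (simp add: lookup_minus)
  qed
  \<comment> \<open>The preimage of the ideal generated by \<open>Y\<close>. If it contains all variables, then \<open>Y\<close> generates
    the maximal ideal, and by minimality it is the whole generating set.\<close>
  define J where "J Y = {g \<in> polys V. residue V I g \<in> Idl\<^bsub>?Q\<^esub> Y}" for Y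
  have Idl_ideal: "ideal (Idl\<^bsub>?Q\<^esub> Y) ?Q" if "Y \<subseteq> set xs" for Y
    using Q.genideal_ideal that xs_Q by (meson subset_trans)
  have J_ideal: "ideal (J Y) (poly_ring V)" if Y: "Y \<subseteq> set xs" for Y
  proof (rule ideal_poly_ringI)
    interpret Y: ideal "Idl\<^bsub>?Q\<^esub> Y" ?Q by (rule Idl_ideal[OF Y])
    show "0 \<in> J Y" by (simp add: J_def polys_zero Q0.res_zero)
    show "g + h \<in> J Y" if "g \<in> J Y" "h \<in> J Y" for g h
      using that by (simp add: J_def polys_add Q0.res_add)
    show "h * g \<in> J Y" if "g \<in> J Y" "h \<in> polys V" for g h
      using that by (simp add: J_def polys_mult Q0.res_mult Y.I_l_closed Q0.res_closed)
  qed (auto simp: J_def)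
  have I_J: "I \<subseteq> J Y" if Y: "Y \<subseteq> set xs" for Y
  proof
    interpret Y: ideal "Idl\<^bsub>?Q\<^esub> Y" ?Q by (rule Idl_ideal[OF Y])
    fix g assume g: "g \<in> I"
    then have "residue V I g = \<zero>\<^bsub>?Q\<^esub>" using Q0.res_eq_zero_iff ideal_subset[OF I] by blast
    then show "g \<in> J Y" using g ideal_subset[OF I] by (simp add: J_def)
  qed
  have f_J: "f x \<in> J Y" if "x \<in> Y" "Y \<subseteq> set xs" for x Y
  proof -
    have "x \<in> Idl\<^bsub>?Q\<^esub> Y" using Q.genideal_self[of Y] that xs_Q by blast
    moreover have "residue V I (f x) = x" "f x \<in> polys V" using f(1,3)[of x] that by auto
    ultimately show ?thesis by (simp add: J_def)
  qed
  have Y_all: "Y = set xs" if Y: "Y \<subseteq> set xs" and vars: "\<And>v. v \<in> V \<Longrightarrow> var v \<in> J Y" for Y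
  proof -
    have "?m \<subseteq> Idl\<^bsub>?Q\<^esub> Y"
    proof
      fix x assume "x \<in> ?m"
      then obtain g where g: "g \<in> polys V" "lookup g 0 = 0" "x = residue V I g"
        by (auto simp: graded_maximal_ideal_def)
      then obtain h where "\<And>v. h v \<in> polys V" "g = (\<Sum>v\<in>V. var v * h v)"
        using no_constant_term[OF g(1,2) fin_V] by blast
      then have "g \<in> J Y"
        using vars by (auto intro!: ideal_sum[OF J_ideal[OF Y]] ideal_mult'[OF J_ideal[OF Y]])
      then show "x \<in> Idl\<^bsub>?Q\<^esub> Y" using g by (simp add: J_def)
    qed
    moreover have "Idl\<^bsub>?Q\<^esub> Y \<subseteq> ?m"
      using Q.genideal_minimal[OF Idl_ideal[of "set xs"]] Q.genideal_self[OF xs_Q] Y gen by blast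
    ultimately show ?thesis using minimal[of Y] Y by blast
  qed
  \<comment> \<open>The preimage of the ideal generated by the whole set, described by linear combinations.\<close>
  define U where "U = {g \<in> polys V. \<exists>h. (\<forall>x. h x \<in> polys V) \<and> g - (\<Sum>x\<in>set xs. h x * f x) \<in> I}"
  have U_ideal: "ideal U (poly_ring V)"
  proof (rule ideal_poly_ringI)
    show "0 \<in> U"
      unfolding U_def by (auto simp: polys_zero ideal_zero[OF I] intro!: exI[of _ "\<lambda>_. 0"])
    fix g assume "g \<in> U"
    then obtain h where h: "g \<in> polys V" "\<And>x. h x \<in> polys V" "g - (\<Sum>x\<in>set xs. h x * f x) \<in> I"
      by (auto simp: U_def)
    show "g + g' \<in> U" if "g' \<in> U" for g'
    proof -
      from that have "\<exists>h. (\<forall>x. h x \<in> polys V) \<and> g' - (\<Sum>x\<in>set xs. h x * f x) \<in> I"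
        and g': "g' \<in> polys V" by (simp_all add: U_def)
      then obtain h' where h': "\<And>x. h' x \<in> polys V" "g' - (\<Sum>x\<in>set xs. h' x * f x) \<in> I"
        by blast
      have eq: "(g + g') - (\<Sum>x\<in>set xs. (h x + h' x) * f x) =
          (g - (\<Sum>x\<in>set xs. h x * f x)) + (g' - (\<Sum>x\<in>set xs. h' x * f x))"
        by (simp add: distrib_right sum.distrib)
      have "(g + g') - (\<Sum>x\<in>set xs. (h x + h' x) * f x) \<in> I"
        unfolding eq by (rule ideal_add[OF I h(3) h'(2)])
      then show ?thesis
        unfolding U_def using h g' h'
        by (intro CollectI conjI polys_add exI[of _ "\<lambda>x. h x + h' x"]) (auto intro: polys_add)
    qed
    show "c * g \<in> U" if "c \<in> polys V" for c
    proof -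
      have "c * g - (\<Sum>x\<in>set xs. (c * h x) * f x) = c * (g - (\<Sum>x\<in>set xs. h x * f x))"
        by (simp add: right_diff_distrib sum_distrib_left mult.assoc)
      then have "c * g - (\<Sum>x\<in>set xs. (c * h x) * f x) \<in> I"
        using ideal_mult[OF I h(3) that] by simp
      then show ?thesis
        unfolding U_def using h that
        by (intro CollectI conjI polys_mult exI[of _ "\<lambda>x. c * h x"]) (auto intro: polys_mult)
    qed
  qed (auto simp: U_def)
  have m_U: "?m \<subseteq> residue V I ` U"
  proof -
    have "ideal (residue V I ` U) ?Q"
      using R.ring_ideal_imp_quot_ideal[OF I U_ideal]
      by (simp add: quotient_ring_def residue_def[abs_def])
    moreover have "set xs \<subseteq> residue V I ` U"
    proof
      fix x assume x: "x \<in> set xs"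
      have "f x = (\<Sum>y\<in>set xs. (if y = x then 1 else 0) * f y)"
        using x by (simp add: if_distrib[of "\<lambda>c. c * _"] cong: if_cong)
      then have "f x \<in> U"
        unfolding U_def using f(1)[OF x] ideal_zero[OF I]
        by (intro CollectI conjI exI[of _ "\<lambda>y. if y = x then 1 else 0"]) (auto simp: polys_one polys_zero)
      then show "x \<in> residue V I ` U" using f(3)[OF x] by blast
    qed
    ultimately show ?thesis using Q.genideal_minimal gen by metis
  qed
  have "\<exists>c. (\<Sum>x | x \<in> set xs \<and> e x = 1. const (c x) * f x) - var v \<in> I" if v: "v \<in> V" for v
  proof -
    have "residue V I (var v) \<in> ?m"
    proof -
      have "lookup (var v :: ('v, 'k) mpoly) 0 = 0"
        using homogeneous_var[of v] unfolding homogeneous_iff by (metis mdeg_zero zero_neq_one)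
      then show ?thesis
        unfolding graded_maximal_ideal_def using polys_var[OF v] by (intro imageI CollectI conjI)
    qed
    then obtain g where "g \<in> U" "residue V I (var v) = residue V I g" using m_U by auto
    then obtain h where h: "g \<in> polys V" "\<And>x. h x \<in> polys V" "g - (\<Sum>x\<in>set xs. h x * f x) \<in> I"
      "var v - g \<in> I"
      using Q0.res_eq_iff[OF polys_var[OF v]] by (auto simp: U_def)
    have "hcomp 1 (var v - (\<Sum>x\<in>set xs. h x * f x)) \<in> I"
      using hcomp_I ideal_trans[OF I h(4,3)] by blast
    also have "hcomp 1 (var v - (\<Sum>x\<in>set xs. h x * f x)) =
        var v - (\<Sum>x\<in>set xs. hcomp 1 (f x * h x))"
      using hcomp_homogeneous[OF homogeneous_var, of 1 v] by (simp add: hcomp_diff hcomp_sum mult.commute)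
    also have "(\<Sum>x\<in>set xs. hcomp 1 (f x * h x)) =
        (\<Sum>x\<in>set xs. if e x = 1 then const (lookup (h x) 0) * f x else 0)"
    proof (rule sum.cong)
      fix x assume x: "x \<in> set xs"
      have h0: "hcomp 0 (h x) = const (lookup (h x) 0)"
        by (rule poly_mapping_eqI) (auto simp: lookup_hcomp const_def lookup_single when_def mdeg_eq_0_iff)
      consider "e x = 0" | "e x = 1" | "e x \<ge> 2" by linarith
      then show "hcomp 1 (f x * h x) = (if e x = 1 then const (lookup (h x) 0) * f x else 0)"
      proof cases
        case 1
        have "f x = 0"
        proof (rule poly_mapping_eqI)
          fix m show "lookup (f x) m = lookup 0 m"
            using f(2)[OF x] f_const[OF x] 1 by (auto simp: homogeneous_iff mdeg_eq_0_iff)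
        qed
        then show ?thesis by simp
      qed (use hcomp_mult[OF f(2)[OF x], of 1 "h x"] h0 in \<open>auto simp: mult.commute\<close>)
    qed simp
    also have "\<dots> = (\<Sum>x | x \<in> set xs \<and> e x = 1. const (lookup (h x) 0) * f x)"
      by (rule sum.inter_filter[symmetric]) simp
    finally have "var v - (\<Sum>x | x \<in> set xs \<and> e x = 1. const (lookup (h x) 0) * f x) \<in> I" .
    from ideal_minus_commute[OF I this] show ?thesis
      by (rule exI[where x = "\<lambda>x. lookup (h x) 0"])
  qed
  then have "\<forall>v\<in>V. \<exists>c. (\<Sum>x | x \<in> set xs \<and> e x = 1. const (c x) * f x) - var v \<in> I" by (intro ballI)
  from bchoice[OF this]
  obtain c where "\<forall>v\<in>V. (\<Sum>x | x \<in> set xs \<and> e x = 1. const (c v x) * f x) - var v \<in> I"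
    by (rule exE)
  then have c: "(\<Sum>x | x \<in> set xs \<and> e x = 1. const (c v x) * f x) - var v \<in> I" if "v \<in> V" for v
    using that by (rule bspec)
  have var_J: "var v \<in> J Y"
    if Y: "Y \<subseteq> set xs" and v: "v \<in> V" and lin: "\<And>x. x \<in> set xs \<Longrightarrow> e x = 1 \<Longrightarrow> f x \<in> J Y" for Y v
  proof -
    have "(\<Sum>x | x \<in> set xs \<and> e x = 1. const (c v x) * f x) \<in> J Y"
      using lin by (intro ideal_sum[OF J_ideal[OF Y]] ideal_mult[OF J_ideal[OF Y]] polys_const) auto
    from ideal_diff[OF J_ideal[OF Y] this subsetD[OF I_J[OF Y] c[OF v]]] show ?thesis by simp
  qed
  have "{x \<in> set xs. e x = 1} = set xs"
    by (rule Y_all) (auto intro!: var_J f_J)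
  then have e1: "e x = 1" if "x \<in> set xs" for x using that by auto
  have sum_nth: "(\<Sum>x\<in>set xs. g x) = (\<Sum>i<length xs. g (xs ! i))" for g :: "_ \<Rightarrow> ('v, 'k) mpoly"
    using sum.reindex_bij_betw[OF bij_betw_nth[OF dist refl refl], of g] by simp
  have "linear_forms V I (\<lambda>i. f (xs ! i)) (length xs) (\<lambda>v i. c v (xs ! i))"
  proof (rule linear_forms.intro)
    show "finite V" "ideal I (poly_ring V)" by fact+
    show "f (xs ! i) \<in> polys V" "homogeneous 1 (f (xs ! i))" if "i < length xs" for i
      using f(1,2)[of "xs ! i"] e1[of "xs ! i"] that by auto
    show "(\<Sum>i<length xs. const (c v (xs ! i)) * f (xs ! i)) - var v \<in> I" if "v \<in> V" for v
      using c[OF that] sum_nth[of "\<lambda>x. const (c v x) * f x"] e1 by (simp cong: conj_cong)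
    show "l i = 0" if sum: "(\<Sum>i<length xs. const (l i) * f (xs ! i)) \<in> I" and i: "i < length xs" for l i
    proof (rule ccontr)
      assume "l i \<noteq> 0"
      define Y where "Y = set xs - {xs ! i}"
      have Y: "Y \<subseteq> set xs" by (auto simp: Y_def)
      note JY = J_ideal[OF Y]
      have others: "f (xs ! j) \<in> J Y" if "j < length xs" "j \<noteq> i" for j
        using that i dist by (intro f_J Y) (auto simp: Y_def nth_eq_iff_index_eq)
      have "const (l i) * f (xs ! i) = (\<Sum>j<length xs. const (l j) * f (xs ! j)) -
          (\<Sum>j\<in>{..<length xs} - {i}. const (l j) * f (xs ! j))"
        using i by (simp add: sum.remove[of "{..<length xs}" i])
      also have "\<dots> \<in> J Y"
        using others
        by (intro ideal_diff[OF JY subsetD[OF I_J[OF Y] sum]] ideal_sum[OF JY] ideal_mult[OF JY]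
            polys_const) auto
      finally have "const (inverse (l i)) * (const (l i) * f (xs ! i)) \<in> J Y"
        by (rule ideal_mult[OF JY _ polys_const])
      then have "f (xs ! i) \<in> J Y"
        using \<open>l i \<noteq> 0\<close> by (simp flip: mult.assoc const_mult)
      then have "f x \<in> J Y" if "x \<in> set xs" for x
        using others that by (metis in_set_conv_nth)
      then have "Y = set xs" by (intro Y_all[OF Y] var_J[OF Y])
      then show False using nth_mem[OF i] unfolding Y_def by blast
    qed
  qed
  moreover have "xs ! i = residue V I (f (xs ! i))" if "i < length xs" for i
    using f(3) that by simp
  ultimately show thesis using that by blast
qed

section \<open>Rainbow monomial ideals\<close>

lemma monomial_degree_ideal:
  "ideal {f \<in> polys V. \<forall>m. lookup f m \<noteq> 0 \<longrightarrow> n \<le> mdeg m} (poly_ring V)"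
proof (rule ideal_poly_ringI)
  fix f g :: "('a, 'b) mpoly"
  assume f: "f \<in> {f \<in> polys V. \<forall>m. lookup f m \<noteq> 0 \<longrightarrow> n \<le> mdeg m}"
  show "f + g \<in> {f \<in> polys V. \<forall>m. lookup f m \<noteq> 0 \<longrightarrow> n \<le> mdeg m}"
    if "g \<in> {f \<in> polys V. \<forall>m. lookup f m \<noteq> 0 \<longrightarrow> n \<le> mdeg m}"
    using f that by (auto simp: polys_add lookup_add) (metis add_0)
  show "g * f \<in> {f \<in> polys V. \<forall>m. lookup f m \<noteq> 0 \<longrightarrow> n \<le> mdeg m}" if "g \<in> polys V"
  proof (intro CollectI conjI allI impI)
    show "g * f \<in> polys V" using f that by (simp add: polys_mult)
    fix m assume "lookup (g * f) m \<noteq> 0"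
    then have "m \<in> {k + l | k l. k \<in> keys g \<and> l \<in> keys f}"
      using keys_mult[of g f] unfolding in_keys_iff[symmetric] by (rule rev_subsetD)
    then obtain k l where "m = k + l" "l \<in> keys f" by blast
    then show "n \<le> mdeg m" using f by (simp add: mdeg_add in_keys_iff trans_le_add2)
  qed
qed (auto simp: polys_zero)

text \<open>For an ideal generated by homogeneous polynomials this ideal contains the generators, hence
  all of \<open>I\<close>; so \<open>I\<close> contains the homogeneous components of its elements.\<close>

lemma hcomp_closed_ideal:
  assumes I: "ideal I (poly_ring V)"
  shows "ideal {f \<in> polys V. \<forall>e. hcomp e f \<in> I} (poly_ring V)"
proof (rule ideal_poly_ringI)
  fix f g :: "('a, 'b) mpoly"
  assume f: "f \<in> {f \<in> polys V. \<forall>e. hcomp e f \<in> I}" and g: "g \<in> polys V"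
  have "hcomp e (g * f) \<in> I" for e
  proof -
    let ?E = "mdeg ` keys g"
    have "hcomp e (g * f) = (\<Sum>k\<in>?E. hcomp e (hcomp k g * f))"
      by (subst sum_hcomp[of ?E g, symmetric]) (simp_all add: sum_distrib_right hcomp_sum)
    also have "\<dots> = (\<Sum>k\<in>?E. if k \<le> e then hcomp k g * hcomp (e - k) f else 0)"
      by (simp add: hcomp_mult[OF homogeneous_hcomp])
    also have "\<dots> \<in> I"
      using f hcomp_polys[OF g] by (auto intro!: ideal_sum[OF I] ideal_mult[OF I] ideal_zero[OF I])
    finally show ?thesis .
  qed
  then show "g * f \<in> {f \<in> polys V. \<forall>e. hcomp e f \<in> I}" using f g by (simp add: polys_mult)
qed (auto simp: polys_zero polys_add hcomp_add ideal_zero[OF I] ideal_add[OF I])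

lemma finite_rainbow_vars: "finite (rainbow_vars n d)"
proof -
  have "rainbow_vars n d = Sigma {1..n} (\<lambda>i. {1..d i})" by (auto simp: rainbow_vars_def)
  then show ?thesis by simp
qed

lemma rainbow_monomials_polys: "rainbow_monomials n d \<subseteq> polys (rainbow_vars n d)"
  by (auto simp: rainbow_monomials_def rainbow_vars_def intro!: polys_prod polys_var)

lemma rainbow_monomials_homogeneous: "f \<in> rainbow_monomials n d \<Longrightarrow> homogeneous n f"
  using homogeneous_prod_var[of "{1..n}"] by (auto simp: rainbow_monomials_def)

text
  \<open>Joins the two views of the generators: as linear forms, for the concentration of homology, and as lifts of elements of the quotient ring, for the Massey operation.\<close>

lemma koszul_golodI:
  assumes lin: "linear_forms V I p (length xs) C"
    and xs: "\<And>i. i < length xs \<Longrightarrow> xs ! i = residue V I (p i)"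
    and hcomp_I: "\<And>f e. f \<in> I \<Longrightarrow> hcomp e f \<in> I"
    and "t \<ge> 2"
    and conc: "\<And>a q e. a \<in> koszul_polys V (length xs) \<Longrightarrow> bihomogeneous q e a \<Longrightarrow> q \<ge> 1 \<Longrightarrow>
      e + 1 \<noteq> t \<Longrightarrow> (\<And>S. ediff (length xs) p a S \<in> I) \<Longrightarrow>
      \<exists>c\<in>koszul_polys V (length xs). \<forall>S. (a - ediff (length xs) p c) S \<in> I"
  shows "admits_trivial_massey (quotient_ring V I) xs (residue V I ` range const)"
proof -
  interpret linear_forms V I p "length xs" C by (rule lin)
  interpret K: koszul_quotient V I p xs
    by (rule koszul_quotient.intro) (use I p xs in auto)
  interpret concentrated_koszul_homology V I p xs t
  proof (intro concentrated_koszul_homology.intro concentrated_koszul_homology_axioms.intro)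
    show "koszul_quotient V I p xs" by (rule K.koszul_quotient_axioms)
    show "a \<in> K.boundary_lifts" if "a \<in> K.cycle_lifts" "bihomogeneous q e a" "q \<ge> 1" "e + 1 \<noteq> t" for a q e
      using conc[of a q e] that by (auto simp: K.cycle_lifts_def K.boundary_lifts_def K.ideal_valued_def)
  qed (use \<open>t \<ge> 2\<close> p_lin hcomp_I in auto)
  show ?thesis by (rule admits_trivial_massey)
qed

text \<open>If \<open>I\<close> vanishes in the new coordinates, then \<open>R/I\<close> is a polynomial ring in the linear forms,
  and its Koszul complex has no homology in positive degrees.\<close>

lemma boundary_if_coords_vanish:
  assumes lin: "linear_forms V I p r C"
    and coords: "\<And>f. f \<in> I \<Longrightarrow> linear_forms.coords r C f = 0"
    and a: "a \<in> koszul_polys V r" "bihomogeneous q e a" "q \<ge> 1" "\<And>S. ediff r p a S \<in> I"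
  shows "\<exists>c\<in>koszul_polys V r. \<forall>S. (a - ediff r p c) S \<in> I"
proof -
  interpret linear_forms V I p r C by (rule lin)
  have "a {} = 0" using a(2,3) by (force simp: bihomogeneous_def)
  then show ?thesis using acyclic_mod[OF I coords span a(1) _ a(4)] by blast
qed

theorem theorem5p13:
  fixes n :: nat and d :: "nat \<Rightarrow> nat"
    and I :: "(nat \<times> nat, 'k::field) mpoly set"
  assumes "n \<ge> 1"
    and "\<And>i. i \<in> {1..n} \<Longrightarrow> d i \<ge> 1"
    and "rainbow_monomial_ideal n d I"
    and "has_linear_resolution (rainbow_vars n d) I"
  shows "golod (rainbow_vars n d) I"
  unfolding golod_def
proof (intro allI impI)
  fix xs assume min: "minimal_generators (rainbow_vars n d) I xs"
  let ?V = "rainbow_vars n d"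
  interpret R: cring "poly_ring ?V :: (nat \<times> nat, 'k) mpoly ring" by (rule poly_ring_cring)
  obtain G where G: "G \<subseteq> rainbow_monomials n d" "I = Idl\<^bsub>poly_ring ?V\<^esub> G"
    using assms(3) by (auto simp: rainbow_monomial_ideal_def)
  have G_polys: "G \<subseteq> polys ?V" using G(1) rainbow_monomials_polys by blast
  have I: "ideal I (poly_ring ?V)" unfolding G(2) by (rule R.genideal_ideal[OF G_polys])
  have G_I: "G \<subseteq> I" unfolding G(2) by (rule R.genideal_self[OF G_polys])
  have G_hom: "homogeneous n f" if "f \<in> G" for f
    using that G(1) rainbow_monomials_homogeneous by blast
  have "I \<subseteq> {f \<in> polys ?V. \<forall>m. lookup f m \<noteq> 0 \<longrightarrow> n \<le> mdeg m}"
    unfolding G(2) by (rule R.genideal_minimal[OF monomial_degree_ideal])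
      (use G_polys G_hom in \<open>auto simp: homogeneous_iff\<close>)
  then have I_deg: "n \<le> mdeg m" if "f \<in> I" "lookup f m \<noteq> 0" for f m
    using that by blast
  have "I \<subseteq> {f \<in> polys ?V. \<forall>e. hcomp e f \<in> I}"
  proof (subst (1) G(2), rule R.genideal_minimal[OF hcomp_closed_ideal[OF I]], rule subsetI)
    fix f assume f: "f \<in> G"
    then have "hcomp e f \<in> I" for e
      using hcomp_homogeneous[OF G_hom[OF f], of e] G_I ideal_zero[OF I] by auto
    then show "f \<in> {f \<in> polys ?V. \<forall>e. hcomp e f \<in> I}" using f G_polys by auto
  qed
  then have hcomp_I: "hcomp e f \<in> I" if "f \<in> I" for e f using that by blast
  have I_m: "lookup f 0 = 0" if "f \<in> I" for f
    using I_deg[OF that, of 0] assms(1) by fastforce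
  obtain p C where lin: "linear_forms ?V I p (length xs) C"
    and xs: "\<And>i. i < length xs \<Longrightarrow> xs ! i = residue ?V I (p i)"
    using minimal_generators_linear_forms[OF finite_rainbow_vars I hcomp_I I_m min] by blast
  interpret linear_forms ?V I p "length xs" C by (rule lin)
  show "admits_trivial_massey (quotient_ring ?V I) xs (residue ?V I ` range const)"
  \<comment> \<open>In the first case positive homology vanishes altogether, so any \<open>t \<ge> 2\<close> will do.\<close>
  proof (cases "n = 1 \<or> I = {0}")
    case True
    have coords_I: "coords f = 0" if "f \<in> I" for f
    proof (cases "I = {0}")
      case True
      then show ?thesis using that by (simp add: coords_def)
    next
      case False
      then have "n = 1" using True by simp
      have "ideal {f \<in> polys ?V. coords f = 0} (poly_ring ?V)"
        by (rule ideal_poly_ringI)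
          (auto simp: coords_def poly_subst_add poly_subst_mult polys_zero polys_add polys_mult)
      moreover have "G \<subseteq> {f \<in> polys ?V. coords f = 0}"
      proof
        fix f assume f: "f \<in> G"
        then obtain a where a: "f = var (1, a 1)" "a 1 \<in> {1..d 1}"
          using G(1) \<open>n = 1\<close> by (auto simp: rainbow_monomials_def)
        then have v: "(1, a 1) \<in> ?V" using \<open>n = 1\<close> by (simp add: rainbow_vars_def)
        \<comment> \<open>The variable lies in \<open>I\<close>, so all its coordinates are zero by independence.\<close>
        have "((\<Sum>i<length xs. const (C (1, a 1) i) * p i) - var (1, a 1)) + var (1, a 1) \<in> I"
          using ideal_add[OF I span[OF v]] f G_I a by blast
        then have "C (1, a 1) i = 0" if "i < length xs" for i
          using indep[of "C (1, a 1)"] that by simp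
        then show "f \<in> {f \<in> polys ?V. coords f = 0}"
          using f G_polys by (auto simp: coords_def a)
      qed
      ultimately have "I \<subseteq> {f \<in> polys ?V. coords f = 0}"
        unfolding G(2) by (rule R.genideal_minimal)
      then show ?thesis using that by blast
    qed
    show ?thesis
      by (rule koszul_golodI[OF lin xs hcomp_I order_refl])
        (use boundary_if_coords_vanish[OF lin coords_I] in blast)+
  next
    case False
    then have "n \<ge> 2" using assms(1) by linarith
    obtain t b a g \<phi> where res: "graded_free_resolution ?V I b a g \<phi>" and a: "\<forall>s. \<forall>j < b s. a s j = s + t"
      using assms(4) by (auto simp: has_linear_resolution_def minimal_graded_free_resolution_def)
    have res': "graded_free_resolution ?V I b (\<lambda>s j. s + t) g \<phi>"
      using res a by (auto simp: graded_free_resolution_def)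
    interpret linear_resolution ?V I p "length xs" C t b g \<phi>
    proof (intro linear_resolution.intro lin linear_resolution_axioms.intro)
      fix f assume f: "f \<in> I" "homogeneous 1 f"
      show "f = 0"
      proof (rule poly_mapping_eqI, rule ccontr)
        fix m assume "lookup f m \<noteq> lookup 0 m"
        then show False using I_deg[OF f(1), of m] f(2) \<open>n \<ge> 2\<close> by (auto simp: homogeneous_iff)
      qed
    qed (rule res')
    have "t \<ge> 2"
    proof -
      obtain f where "f \<in> I" "f \<noteq> 0" using False ideal_zero[OF I] by blast
      then obtain v where "f = (\<Sum>j<b 0. g j * v j)" using I_iff by blast
      then obtain j where j: "j < b 0" "g j * v j \<noteq> 0"
        using \<open>f \<noteq> 0\<close> by (metis (no_types, lifting) lessThan_iff sum.neutral)
      then have "g j \<noteq> 0" by auto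
      then obtain m where m: "lookup (g j) m \<noteq> 0"
        by (metis poly_mapping_eqI lookup_zero)
      then have "mdeg m = t" using g(2)[OF j(1)] by (auto simp: homogeneous_iff)
      moreover have "n \<le> mdeg m" using I_deg[OF generator_in_I[OF j(1)] m] .
      ultimately show ?thesis using \<open>n \<ge> 2\<close> by linarith
    qed
    show ?thesis
      by (rule koszul_golodI[OF lin xs hcomp_I \<open>t \<ge> 2\<close>]) (use koszul_concentrated in blast)+
  qed
qed

end
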